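(* Let $X$ be a Banach space such that the Banach algebra $\mathcal A(X)$ is not self-induced. Then $\mathcal A(X)$ is weakly amenable if and only if both of the following hold: (a) $\mathcal A(X)=\mathcal N(X)$; (b) the kernel $K$ of the operator trace $\operatorname{Tr}\colon X\widehat\otimes X^*\to\mathcal N(X)$ is $1$-dimensional. If (a) and (b) hold, then moreover: (c) $\mathcal B(X)=\mathcal I(X)\oplus\mathbb C\mathbf 1_X$ and $\mathcal B(X^* )=\mathcal I(X^* )\oplus\mathbb C\mathbf 1_{X^*}$; (d) if $X=Y\oplus Z$, then either $Y$ or $Z$ is finite dimensional (i.e. $X$ is indecomposable); similarly, $X^*$ is indecomposable.
   Context: For a Banach space $X$: $\mathcal B(X)$ is the algebra of bounded operators on $X$; $\mathcal A(X)$ is the Banach algebra (operator norm) of approximable operators, i.e. the operator-norm closure of the finite rank bounded operators; $\mathcal N(X)$ is the space of nuclear operators on $X$; $\mathcal I(X)$ is the space of (Grothendieck) integral operators on $X$, and similarly with $X^*$ in place of $X$. $\mathbf 1_X$ is the identity operator on $X$. $\widehat\otimes$ is the projective tensor product of Banach spaces. The operator trace $\operatorname{Tr}\colon X\widehat\otimes X^*\to\mathcal N(X)$ is the bounded linear map determined by $\operatorname{Tr}(x\otimes x^* )(\xi)=x^*(\xi)x$; it maps onto $\mathcal N(X)$. For a Banach algebra $\mathfrak A$, a right Banach $\mathfrak A$-module $E$ and a left Banach $\mathfrak A$-module $F$, $E\widehat\otimes_{\mathfrak A}F=(E\widehat\otimes F)/N$, where $N$ is the closed linear span of $\{e.a\otimes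 f-e\otimes a.f\mid e\in E,f\in F,a\in\mathfrak A\}$. $\mathfrak A$ is called self-induced if multiplication induces an isomorphism (of Banach spaces) $\mathfrak A\widehat\otimes_{\mathfrak A}\mathfrak A\cong\mathfrak A$. $\mathfrak A$ is weakly amenable if every bounded derivation $D\colon\mathfrak A\to\mathfrak A^*$ is inner, where $\mathfrak A^*$ has the dual $\mathfrak A$-bimodule structure. A Banach space is indecomposable if it is not the direct sum of two infinite-dimensional Banach spaces (closed subspaces). *)

theory Defs
  imports "HOL-Analysis.Analysis"
begin

section \<open>Complex Banach spaces and bounded operators\<close>

class complex_normed_vector = real_normed_vector +
  fixes scaleC :: "complex \<Rightarrow> 'a \<Rightarrow> 'a"  (infixr \<open>*\<^sub>C\<close> 75)
  assumes scaleC_add_right: "c *\<^sub>C (x + y) = c *\<^sub>C x + c *\<^sub>C y"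
    and scaleC_add_left: "(c + d) *\<^sub>C x = c *\<^sub>C x + d *\<^sub>C x"
    and scaleC_scaleC: "c *\<^sub>C d *\<^sub>C x = (c * d) *\<^sub>C x"
    and scaleR_eq_scaleC: "r *\<^sub>R x = complex_of_real r *\<^sub>C x"
    and norm_scaleC: "norm (c *\<^sub>C x) = cmod c * norm x"

class complex_banach = complex_normed_vector + banach

class complex_banach_algebra = complex_banach + real_normed_algebra +
  assumes mult_scaleC_left: "(c *\<^sub>C x) * y = c *\<^sub>C (x * y)"
    and mult_scaleC_right: "x * (c *\<^sub>C y) = c *\<^sub>C (x * y)"

lemma scaleC_one [simp]: "1 *\<^sub>C x = (x::'a::complex_normed_vector)"
  using scaleR_eq_scaleC[of 1 x] by simp

global_interpretation complex_vector:
  vector_space "scaleC :: complex \<Rightarrow> 'a \<Rightarrow> 'a::complex_normed_vector"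
  by unfold_locales (simp_all add: scaleC_add_right scaleC_add_left scaleC_scaleC)

instantiation complex :: complex_banach_algebra
begin
definition scaleC_complex :: "complex \<Rightarrow> complex \<Rightarrow> complex" where "scaleC_complex c x = c * x"
instance
  by standard (simp_all add: scaleC_complex_def algebra_simps norm_mult scaleR_conv_of_real)
end

lemma scaleC_scaleR_commute: "c *\<^sub>C (r *\<^sub>R x) = r *\<^sub>R (c *\<^sub>C (x::'a::complex_normed_vector))"
  by (simp add: scaleR_eq_scaleC scaleC_scaleC mult.commute)

lemma bounded_linear_scaleC: "bounded_linear (\<lambda>x::'a::complex_normed_vector. c *\<^sub>C x)"
  by (rule bounded_linear_intro[where K = "cmod c"])
     (simp_all add: scaleC_add_right scaleC_scaleR_commute norm_scaleC)

typedef (overloaded) ('a, 'b) cblinfun (\<open>(_ \<Rightarrow>\<^sub>C\<^sub>L /_)\<close> [22, 21] 21) =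
  "{f :: 'a::complex_normed_vector \<Rightarrow>\<^sub>L 'b::complex_normed_vector.
      \<forall>c x. blinfun_apply f (c *\<^sub>C x) = c *\<^sub>C blinfun_apply f x}"
  morphisms blinfun_of_cblinfun Abs_cblinfun
  by (rule exI[of _ 0]) simp

setup_lifting type_definition_cblinfun

lift_definition cblinfun_apply ::
  "('a::complex_normed_vector \<Rightarrow>\<^sub>C\<^sub>L 'b::complex_normed_vector) \<Rightarrow> 'a \<Rightarrow> 'b"
  is blinfun_apply .

declare [[coercion cblinfun_apply]]

lift_definition blinfun_scaleC ::
  "complex \<Rightarrow> ('a::real_normed_vector \<Rightarrow>\<^sub>L 'b::complex_normed_vector) \<Rightarrow> 'a \<Rightarrow>\<^sub>L 'b"
  is "\<lambda>c f x. c *\<^sub>C f x"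
  by (rule bounded_linear_compose[OF bounded_linear_scaleC])

declare blinfun_scaleC.rep_eq [simp]

instantiation cblinfun :: (complex_normed_vector, complex_normed_vector) complex_normed_vector
begin
lift_definition norm_cblinfun :: "'a \<Rightarrow>\<^sub>C\<^sub>L 'b \<Rightarrow> real" is norm .
lift_definition zero_cblinfun :: "'a \<Rightarrow>\<^sub>C\<^sub>L 'b" is 0 by simp
lift_definition plus_cblinfun :: "'a \<Rightarrow>\<^sub>C\<^sub>L 'b \<Rightarrow> 'a \<Rightarrow>\<^sub>C\<^sub>L 'b \<Rightarrow> 'a \<Rightarrow>\<^sub>C\<^sub>L 'b" is "(+)"
  by (simp add: blinfun.bilinear_simps scaleC_add_right)
lift_definition minus_cblinfun :: "'a \<Rightarrow>\<^sub>C\<^sub>L 'b \<Rightarrow> 'a \<Rightarrow>\<^sub>C\<^sub>L 'b \<Rightarrow> 'a \<Rightarrow>\<^sub>C\<^sub>L 'b" is "(-)"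
  by (simp add: blinfun.bilinear_simps complex_vector.scale_right_diff_distrib)
lift_definition uminus_cblinfun :: "'a \<Rightarrow>\<^sub>C\<^sub>L 'b \<Rightarrow> 'a \<Rightarrow>\<^sub>C\<^sub>L 'b" is uminus
  by (simp add: blinfun.bilinear_simps)
lift_definition scaleR_cblinfun :: "real \<Rightarrow> 'a \<Rightarrow>\<^sub>C\<^sub>L 'b \<Rightarrow> 'a \<Rightarrow>\<^sub>C\<^sub>L 'b" is "(*\<^sub>R)"
  by (simp add: blinfun.bilinear_simps scaleC_scaleR_commute)
lift_definition scaleC_cblinfun :: "complex \<Rightarrow> 'a \<Rightarrow>\<^sub>C\<^sub>L 'b \<Rightarrow> 'a \<Rightarrow>\<^sub>C\<^sub>L 'b"
  is blinfun_scaleC by (simp add: scaleC_scaleC mult.commute)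
definition sgn_cblinfun :: "'a \<Rightarrow>\<^sub>C\<^sub>L 'b \<Rightarrow> 'a \<Rightarrow>\<^sub>C\<^sub>L 'b"
  where "sgn_cblinfun f = scaleR (inverse (norm f)) f"
definition dist_cblinfun :: "'a \<Rightarrow>\<^sub>C\<^sub>L 'b \<Rightarrow> 'a \<Rightarrow>\<^sub>C\<^sub>L 'b \<Rightarrow> real"
  where "dist_cblinfun f g = norm (f - g)"
definition "(uniformity :: (('a \<Rightarrow>\<^sub>C\<^sub>L 'b) \<times> ('a \<Rightarrow>\<^sub>C\<^sub>L 'b)) filter)
  = (INF e\<in>{0 <..}. principal {(f, g). dist f g < e})"
definition open_cblinfun :: "('a \<Rightarrow>\<^sub>C\<^sub>L 'b) set \<Rightarrow> bool"
  where "open_cblinfun S = (\<forall>f\<in>S. \<forall>\<^sub>F (f', g) in uniformity. f' = f \<longrightarrow> g \<in> S)"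
instance
proof
  fix f g h :: "'a \<Rightarrow>\<^sub>C\<^sub>L 'b" and r s :: real and c d :: complex
  show "f + g + h = f + (g + h)" "f + g = g + f" "0 + f = f" "- f + f = 0" "f - g = f + - g"
    by (transfer, simp)+
  show "r *\<^sub>R (f + g) = r *\<^sub>R f + r *\<^sub>R g" "(r + s) *\<^sub>R f = r *\<^sub>R f + s *\<^sub>R f"
    "r *\<^sub>R s *\<^sub>R f = (r * s) *\<^sub>R f" "1 *\<^sub>R f = f"
    by (transfer, simp add: algebra_simps)+
  show "norm (f + g) \<le> norm f + norm g" "norm (r *\<^sub>R f) = \<bar>r\<bar> * norm f" "norm f = 0 \<longleftrightarrow> f = 0"
    by (transfer, simp add: norm_triangle_ineq)+
  show "c *\<^sub>C (f + g) = c *\<^sub>C f + c *\<^sub>C g"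
    by transfer (rule blinfun_eqI, simp add: blinfun.bilinear_simps scaleC_add_right)
  show "(c + d) *\<^sub>C f = c *\<^sub>C f + d *\<^sub>C f"
    by transfer (rule blinfun_eqI, simp add: blinfun.bilinear_simps scaleC_add_left)
  show "c *\<^sub>C d *\<^sub>C f = (c * d) *\<^sub>C f"
    by transfer (rule blinfun_eqI, simp add: blinfun.bilinear_simps scaleC_scaleC)
  show "r *\<^sub>R f = complex_of_real r *\<^sub>C f"
    by transfer (rule blinfun_eqI, simp add: blinfun.bilinear_simps scaleR_eq_scaleC)
  have le: "norm (c *\<^sub>C f) \<le> cmod c * norm f" for c and f :: "'a \<Rightarrow>\<^sub>C\<^sub>L 'b"
  proof (transfer, rule norm_blinfun_bound)
    fix c and f :: "'a \<Rightarrow>\<^sub>L 'b" and x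
    show "norm (blinfun_apply (blinfun_scaleC c f) x) \<le> cmod c * norm f * norm x"
      using norm_blinfun[of f x] by (simp add: norm_scaleC mult_left_mono mult.assoc)
  qed simp
  show "norm (c *\<^sub>C f) = cmod c * norm f"
  proof (cases "c = 0")
    case True
    have "norm (0 *\<^sub>C f) \<ge> 0" by transfer simp
    with True le[of c f] show ?thesis by simp
  next
    case False
    have one: "1 *\<^sub>C f = f"
      by transfer (rule blinfun_eqI, simp)
    have two: "inverse c *\<^sub>C c *\<^sub>C f = (inverse c * c) *\<^sub>C f"
      by transfer (rule blinfun_eqI, simp add: scaleC_scaleC)
    have "norm f \<le> cmod (inverse c) * norm (c *\<^sub>C f)"
      using le[of "inverse c" "c *\<^sub>C f"] two one False by simp
    then have "cmod c * norm f \<le> norm (c *\<^sub>C f)"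
      using False by (simp add: norm_inverse norm_divide field_simps)
    with le[of c f] show ?thesis by simp
  qed
qed (simp_all add: sgn_cblinfun_def dist_cblinfun_def uniformity_cblinfun_def open_cblinfun_def)
end

lemma cblinfun_eqI: "(\<And>x. cblinfun_apply f x = cblinfun_apply g x) \<Longrightarrow> f = g"
  by transfer (rule blinfun_eqI)

lemma cblinfun_apply_zero [simp]: "cblinfun_apply 0 x = 0"
  and cblinfun_apply_add: "cblinfun_apply (f + g) x = cblinfun_apply f x + cblinfun_apply g x"
  and cblinfun_apply_diff: "cblinfun_apply (f - g) x = cblinfun_apply f x - cblinfun_apply g x"
  and cblinfun_apply_minus: "cblinfun_apply (- f) x = - cblinfun_apply f x"
  and cblinfun_apply_scaleR: "cblinfun_apply (r *\<^sub>R f) x = r *\<^sub>R cblinfun_apply f x"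
  and cblinfun_apply_scaleC: "cblinfun_apply (c *\<^sub>C f) x = c *\<^sub>C cblinfun_apply f x"
  and cblinfun_scaleC_arg: "cblinfun_apply f (c *\<^sub>C x) = c *\<^sub>C cblinfun_apply f x"
  and norm_cblinfun: "norm (cblinfun_apply f x) \<le> norm f * norm x"
  by (transfer, simp add: blinfun.bilinear_simps norm_blinfun)+

lemma bounded_linear_cblinfun_apply: "bounded_linear (cblinfun_apply f)"
  by transfer (rule blinfun.bounded_linear_right)

lemma norm_cblinfun_bound:
  "0 \<le> b \<Longrightarrow> (\<And>x. norm (cblinfun_apply f x) \<le> b * norm x) \<Longrightarrow> norm f \<le> b"
  by transfer (rule norm_blinfun_bound)

lemma bounded_bilinear_cblinfun_apply: "bounded_bilinear cblinfun_apply"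
proof
  show "\<exists>K. \<forall>(f::'a \<Rightarrow>\<^sub>C\<^sub>L 'b) x. norm (cblinfun_apply f x) \<le> norm f * norm x * K"
    by (rule exI[of _ 1]) (simp add: norm_cblinfun)
qed (simp_all add: cblinfun_apply_add cblinfun_apply_scaleR
      linear_simps[OF bounded_linear_cblinfun_apply])

interpretation cblinfun: bounded_bilinear cblinfun_apply
  by (rule bounded_bilinear_cblinfun_apply)

definition bounded_clinear ::
  "('a::complex_normed_vector \<Rightarrow> 'b::complex_normed_vector) \<Rightarrow> bool"
  where "bounded_clinear f \<longleftrightarrow> bounded_linear f \<and> (\<forall>c x. f (c *\<^sub>C x) = c *\<^sub>C f x)"

definition CBlinfun ::
  "('a::complex_normed_vector \<Rightarrow> 'b::complex_normed_vector) \<Rightarrow> 'a \<Rightarrow>\<^sub>C\<^sub>L 'b"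
  where "CBlinfun f = Abs_cblinfun (Blinfun f)"

lemma CBlinfun_apply: "bounded_clinear f \<Longrightarrow> cblinfun_apply (CBlinfun f) = f"
  by (simp add: CBlinfun_def bounded_clinear_def cblinfun_apply.rep_eq Abs_cblinfun_inverse
      bounded_linear_Blinfun_apply)

lemma bounded_clinear_intro:
  assumes "\<And>x y. f (x + y) = f x + f y" "\<And>c x. f (c *\<^sub>C x) = c *\<^sub>C f x"
    "\<And>x. norm (f x) \<le> norm x * K"
  shows "bounded_clinear f"
  unfolding bounded_clinear_def
  by (auto intro!: bounded_linear_intro[where K = K] assms simp: scaleR_eq_scaleC)

instance cblinfun :: (complex_normed_vector, complex_banach) complex_banach
proof
  fix X :: "nat \<Rightarrow> 'a \<Rightarrow>\<^sub>C\<^sub>L 'b"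
  assume C: "Cauchy X"
  have dist: "dist (blinfun_of_cblinfun f) (blinfun_of_cblinfun g) = dist f g" for f g :: "'a \<Rightarrow>\<^sub>C\<^sub>L 'b"
    by (simp add: dist_norm norm_cblinfun.rep_eq minus_cblinfun.rep_eq)
  have "Cauchy (\<lambda>n. blinfun_of_cblinfun (X n))"
    using C by (simp add: Cauchy_def dist)
  then obtain L where L: "(\<lambda>n. blinfun_of_cblinfun (X n)) \<longlonglongrightarrow> L"
    by (auto simp: Cauchy_convergent_iff convergent_def)
  have lim: "(\<lambda>n. X n x) \<longlonglongrightarrow> blinfun_apply L x" for x
    using L unfolding cblinfun_apply.rep_eq by (intro tendsto_intros) auto
  have "blinfun_apply L (c *\<^sub>C x) = c *\<^sub>C blinfun_apply L x" for c x
  proof (rule LIMSEQ_unique[OF lim])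
    show "(\<lambda>n. X n (c *\<^sub>C x)) \<longlonglongrightarrow> c *\<^sub>C blinfun_apply L x"
      unfolding cblinfun_scaleC_arg by (rule bounded_linear.tendsto[OF bounded_linear_scaleC lim])
  qed
  then have rep: "blinfun_of_cblinfun (Abs_cblinfun L) = L"
    by (simp add: Abs_cblinfun_inverse)
  have "X \<longlonglongrightarrow> Abs_cblinfun L"
    using L unfolding tendsto_iff by (metis (no_types, lifting) rep dist eventually_mono)
  then show "convergent X" by (rule convergentI)
qed

lift_definition cblinfun_id :: "'a::complex_normed_vector \<Rightarrow>\<^sub>C\<^sub>L 'a" is id_blinfun
  by simp

lift_definition cblinfun_compose ::
  "('b::complex_normed_vector \<Rightarrow>\<^sub>C\<^sub>L 'c::complex_normed_vector) \<Rightarrow>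
   ('a::complex_normed_vector \<Rightarrow>\<^sub>C\<^sub>L 'b) \<Rightarrow> 'a \<Rightarrow>\<^sub>C\<^sub>L 'c" (infixl \<open>o\<^sub>C\<^sub>L\<close> 67)
  is blinfun_compose by simp

lemma cblinfun_id_apply [simp]: "cblinfun_apply cblinfun_id x = x"
  by transfer simp

lemma cblinfun_compose_apply [simp]: "cblinfun_apply (f o\<^sub>C\<^sub>L g) x = f (g x)"
  by transfer simp

lemma norm_cblinfun_compose: "norm (f o\<^sub>C\<^sub>L g) \<le> norm f * norm g"
  by transfer (rule norm_blinfun_compose)

type_synonym 'a cdual = "'a \<Rightarrow>\<^sub>C\<^sub>L complex"

section \<open>Subspaces and direct sums\<close>

definition finite_cdim :: "'a::complex_normed_vector set \<Rightarrow> bool"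
  where "finite_cdim S \<longleftrightarrow> (\<exists>B. finite B \<and> S \<subseteq> complex_vector.span B)"

text \<open>
  Internal direct sum of linear subspaces. It is purely algebraic: where closed summands are meant,
  closedness is required separately.
\<close>

definition direct_sum :: "'a::complex_normed_vector set \<Rightarrow> 'a set \<Rightarrow> bool"
  where "direct_sum V W \<longleftrightarrow> complex_vector.subspace V \<and> complex_vector.subspace W \<and>
    V \<inter> W = {0} \<and> (\<forall>x. \<exists>v\<in>V. \<exists>w\<in>W. x = v + w)"

definition indecomposable :: "'a::complex_banach itself \<Rightarrow> bool"
  where "indecomposable _ \<longleftrightarrow>
    (\<forall>Y Z :: 'a set. closed Y \<and> closed Z \<and> direct_sum Y Z \<longrightarrow> finite_cdim Y \<or> finite_cdim Z)"

section \<open>The Banach algebra of approximable operators\<close>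

definition finite_rank :: "('a::complex_normed_vector \<Rightarrow>\<^sub>C\<^sub>L 'b::complex_normed_vector) \<Rightarrow> bool"
  where "finite_rank T \<longleftrightarrow> finite_cdim (range (cblinfun_apply T))"

definition approximable_operators ::
  "('a::complex_normed_vector \<Rightarrow>\<^sub>C\<^sub>L 'b::complex_normed_vector) set"
  where "approximable_operators = closure {T. finite_rank T}"

lemma finite_rank_0: "finite_rank 0"
  unfolding finite_rank_def finite_cdim_def by (rule exI[of _ "{}"]) auto

lemma finite_rank_add: "finite_rank S \<Longrightarrow> finite_rank T \<Longrightarrow> finite_rank (S + T)"
  unfolding finite_rank_def finite_cdim_def
proof (elim exE conjE)
  fix A B assume "finite A" "range S \<subseteq> complex_vector.span A" "finite B" "range T \<subseteq> complex_vector.span B"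
  then show "\<exists>C. finite C \<and> range (S + T) \<subseteq> complex_vector.span C"
    by (intro exI[of _ "A \<union> B"])
      (auto simp: cblinfun_apply_add complex_vector.span_Un image_subset_iff)
qed

lemma finite_rank_scaleC: "finite_rank T \<Longrightarrow> finite_rank (c *\<^sub>C T)"
  unfolding finite_rank_def finite_cdim_def
  by (auto simp: cblinfun_apply_scaleC image_subset_iff intro: complex_vector.span_scale)

lemma finite_rank_compose_left: "finite_rank S \<Longrightarrow> finite_rank (S o\<^sub>C\<^sub>L T)"
  unfolding finite_rank_def finite_cdim_def by (auto simp: image_subset_iff)

lemma approximable_iff:
  "T \<in> approximable_operators \<longleftrightarrow> (\<exists>F. (\<forall>n. finite_rank (F n)) \<and> F \<longlonglongrightarrow> T)"
  unfolding approximable_operators_def closure_sequential by simp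

lemma approximable_0: "0 \<in> approximable_operators"
  unfolding approximable_iff by (rule exI[of _ "\<lambda>_. 0"]) (simp add: finite_rank_0)

lemma approximable_add:
  assumes "S \<in> approximable_operators" "T \<in> approximable_operators"
  shows "S + T \<in> approximable_operators"
proof -
  obtain F G where "\<forall>n. finite_rank (F n)" "F \<longlonglongrightarrow> S" "\<forall>n. finite_rank (G n)" "G \<longlonglongrightarrow> T"
    using assms unfolding approximable_iff by blast
  then show ?thesis
    unfolding approximable_iff
    by (intro exI[of _ "\<lambda>n. F n + G n"]) (simp add: finite_rank_add tendsto_add)
qed

lemma approximable_scaleC:
  assumes "T \<in> approximable_operators"
  shows "c *\<^sub>C T \<in> approximable_operators"
proof -
  obtain F where "\<forall>n. finite_rank (F n)" "F \<longlonglongrightarrow> T"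
    using assms unfolding approximable_iff by blast
  then show ?thesis
    unfolding approximable_iff
    by (intro exI[of _ "\<lambda>n. c *\<^sub>C F n"])
      (simp add: finite_rank_scaleC bounded_linear.tendsto[OF bounded_linear_scaleC])
qed

lemma approximable_scaleR: "T \<in> approximable_operators \<Longrightarrow> r *\<^sub>R T \<in> approximable_operators"
  by (simp add: scaleR_eq_scaleC approximable_scaleC)

lemma approximable_uminus: "T \<in> approximable_operators \<Longrightarrow> - T \<in> approximable_operators"
  using approximable_scaleR[of T "-1"] by simp

lemma approximable_diff:
  assumes "S \<in> approximable_operators" "T \<in> approximable_operators"
  shows "S - T \<in> approximable_operators"
  using approximable_add[OF assms(1) approximable_uminus[OF assms(2)]] by simp

lemma bounded_bilinear_cblinfun_compose: "bounded_bilinear cblinfun_compose"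
proof
  show "\<exists>K. \<forall>(f::'a \<Rightarrow>\<^sub>C\<^sub>L 'b) g::'c \<Rightarrow>\<^sub>C\<^sub>L 'a. norm (f o\<^sub>C\<^sub>L g) \<le> norm f * norm g * K"
    by (rule exI[of _ 1]) (simp add: norm_cblinfun_compose)
qed (auto intro!: cblinfun_eqI simp: cblinfun_apply_add cblinfun.add_right cblinfun_apply_scaleR
      cblinfun.scaleR_right)

lemma approximable_compose_left:
  assumes "S \<in> approximable_operators"
  shows "S o\<^sub>C\<^sub>L T \<in> approximable_operators"
proof -
  obtain F where "\<forall>n. finite_rank (F n)" "F \<longlonglongrightarrow> S"
    using assms unfolding approximable_iff by blast
  then show ?thesis
    unfolding approximable_iff
    by (intro exI[of _ "\<lambda>n. F n o\<^sub>C\<^sub>L T"])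
      (simp add: finite_rank_compose_left
        bounded_bilinear.tendsto[OF bounded_bilinear_cblinfun_compose _ tendsto_const])
qed

typedef (overloaded) 'a approx_op =
  "approximable_operators :: ('a::complex_banach \<Rightarrow>\<^sub>C\<^sub>L 'a) set"
  morphisms op_of_approx Abs_approx_op
  using approximable_0 by blast

setup_lifting type_definition_approx_op

instantiation approx_op :: (complex_banach) complex_normed_vector
begin
lift_definition norm_approx_op :: "'a approx_op \<Rightarrow> real" is norm .
lift_definition zero_approx_op :: "'a approx_op" is 0 by (rule approximable_0)
lift_definition plus_approx_op :: "'a approx_op \<Rightarrow> 'a approx_op \<Rightarrow> 'a approx_op" is "(+)"
  by (rule approximable_add)
lift_definition minus_approx_op :: "'a approx_op \<Rightarrow> 'a approx_op \<Rightarrow> 'a approx_op" is "(-)"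
  by (rule approximable_diff)
lift_definition uminus_approx_op :: "'a approx_op \<Rightarrow> 'a approx_op" is uminus
  by (rule approximable_uminus)
lift_definition scaleR_approx_op :: "real \<Rightarrow> 'a approx_op \<Rightarrow> 'a approx_op" is "(*\<^sub>R)"
  by (rule approximable_scaleR)
lift_definition scaleC_approx_op :: "complex \<Rightarrow> 'a approx_op \<Rightarrow> 'a approx_op" is "(*\<^sub>C)"
  by (rule approximable_scaleC)
definition sgn_approx_op :: "'a approx_op \<Rightarrow> 'a approx_op"
  where "sgn_approx_op f = scaleR (inverse (norm f)) f"
definition dist_approx_op :: "'a approx_op \<Rightarrow> 'a approx_op \<Rightarrow> real"
  where "dist_approx_op f g = norm (f - g)"
definition "(uniformity :: ('a approx_op \<times> 'a approx_op) filter)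
  = (INF e\<in>{0 <..}. principal {(f, g). dist f g < e})"
definition open_approx_op :: "'a approx_op set \<Rightarrow> bool"
  where "open_approx_op S = (\<forall>f\<in>S. \<forall>\<^sub>F (f', g) in uniformity. f' = f \<longrightarrow> g \<in> S)"
instance
proof
  fix f g h :: "'a approx_op" and r s :: real and c d :: complex
  show "f + g + h = f + (g + h)" "f + g = g + f" "0 + f = f" "- f + f = 0" "f - g = f + - g"
    by (transfer, simp)+
  show "r *\<^sub>R (f + g) = r *\<^sub>R f + r *\<^sub>R g" "(r + s) *\<^sub>R f = r *\<^sub>R f + s *\<^sub>R f"
    "r *\<^sub>R s *\<^sub>R f = (r * s) *\<^sub>R f" "1 *\<^sub>R f = f"
    by (transfer, simp add: algebra_simps)+
  show "norm (f + g) \<le> norm f + norm g" "norm (r *\<^sub>R f) = \<bar>r\<bar> * norm f" "norm f = 0 \<longleftrightarrow> f = 0"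
    by (transfer, simp add: norm_triangle_ineq)+
  show "c *\<^sub>C (f + g) = c *\<^sub>C f + c *\<^sub>C g" "(c + d) *\<^sub>C f = c *\<^sub>C f + d *\<^sub>C f"
    "c *\<^sub>C d *\<^sub>C f = (c * d) *\<^sub>C f" "r *\<^sub>R f = complex_of_real r *\<^sub>C f"
    "norm (c *\<^sub>C f) = cmod c * norm f"
    by (transfer, simp add: scaleC_add_right scaleC_add_left scaleC_scaleC scaleR_eq_scaleC norm_scaleC)+
qed (simp_all add: sgn_approx_op_def dist_approx_op_def uniformity_approx_op_def open_approx_op_def)
end

instantiation approx_op :: (complex_banach) complex_banach_algebra
begin
lift_definition times_approx_op :: "'a approx_op \<Rightarrow> 'a approx_op \<Rightarrow> 'a approx_op"
  is "(o\<^sub>C\<^sub>L)" by (rule approximable_compose_left)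
instance
proof
  fix a b d :: "'a approx_op" and r :: real and c :: complex
  show "a * b * d = a * (b * d)" "(a + b) * d = a * d + b * d" "a * (b + d) = a * b + a * d"
    "r *\<^sub>R a * b = r *\<^sub>R (a * b)" "a * r *\<^sub>R b = r *\<^sub>R (a * b)"
    "c *\<^sub>C a * b = c *\<^sub>C (a * b)" "a * c *\<^sub>C b = c *\<^sub>C (a * b)"
    by (transfer, rule cblinfun_eqI, simp add: cblinfun_apply_add cblinfun.add_right
        cblinfun_apply_scaleR cblinfun.scaleR_right cblinfun_apply_scaleC cblinfun_scaleC_arg)+
  show "norm (a * b) \<le> norm a * norm b"
    by transfer (rule norm_cblinfun_compose)
next
  fix X :: "nat \<Rightarrow> 'a approx_op"
  assume C: "Cauchy X"
  have dist: "dist (op_of_approx f) (op_of_approx g) = dist f g" for f g :: "'a approx_op"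
    by (simp add: dist_norm norm_approx_op.rep_eq minus_approx_op.rep_eq)
  have "Cauchy (\<lambda>n. op_of_approx (X n))"
    using C by (simp add: Cauchy_def dist)
  then obtain L where L: "(\<lambda>n. op_of_approx (X n)) \<longlonglongrightarrow> L"
    by (auto simp: Cauchy_convergent_iff convergent_def)
  have "closed (approximable_operators :: ('a \<Rightarrow>\<^sub>C\<^sub>L 'a) set)"
    by (simp add: approximable_operators_def)
  then have "L \<in> approximable_operators"
    using closed_sequentially[of approximable_operators "\<lambda>n. op_of_approx (X n)" L] L op_of_approx
    by blast
  then have rep: "op_of_approx (Abs_approx_op L) = L"
    by (simp add: Abs_approx_op_inverse)
  have "X \<longlonglongrightarrow> Abs_approx_op L"
    using L unfolding tendsto_iff by (metis (no_types, lifting) rep dist eventually_mono)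
  then show "convergent X" by (rule convergentI)
qed
end

section \<open>Bounded functionals separate points\<close>

text \<open>
  Zorn's lemma gives a minimal sublinear functional below the norm; minimality forces it to be
  linear.
\<close>

definition norm_sublinear :: "('a::real_normed_vector \<Rightarrow> real) \<Rightarrow> bool"
  where "norm_sublinear p \<longleftrightarrow> (\<forall>x y. p (x + y) \<le> p x + p y) \<and>
    (\<forall>s>0. \<forall>x. p (s *\<^sub>R x) \<le> s * p x) \<and> (\<forall>x. p x \<le> norm x)"

lemma norm_sublinear_zero: "norm_sublinear p \<Longrightarrow> p 0 = 0"
  unfolding norm_sublinear_def by (metis add_0 add_le_cancel_left add.right_neutral norm_zero order_antisym)

lemma norm_sublinear_scale:
  assumes "norm_sublinear p" "s \<ge> 0" shows "p (s *\<^sub>R x) = s * p x"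
proof (cases "s = 0")
  case False
  then have s: "s > 0" using assms by simp
  have "p (s *\<^sub>R x) \<le> s * p x" using assms s by (simp add: norm_sublinear_def)
  moreover have "p (inverse s *\<^sub>R s *\<^sub>R x) \<le> inverse s * p (s *\<^sub>R x)"
    using assms(1) s unfolding norm_sublinear_def by (meson positive_imp_inverse_positive)
  then have "s * p x \<le> p (s *\<^sub>R x)" using s by (simp add: field_simps)
  ultimately show ?thesis by simp
qed (simp add: norm_sublinear_zero[OF assms(1)])

lemma norm_sublinear_lower: assumes "norm_sublinear p" shows "- norm x \<le> p x"
proof -
  have "p (x + - x) \<le> p x + p (- x)" "p (- x) \<le> norm (- x)"
    using assms unfolding norm_sublinear_def by blast+
  then show ?thesis using norm_sublinear_zero[OF assms] by simp
qed

lemma norm_sublinear_step: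
  fixes y :: "'a::real_normed_vector"
  assumes p: "norm_sublinear p"
  defines "q \<equiv> \<lambda>x. INF t\<in>{0..}. p (x + t *\<^sub>R y) - t * p y"
  shows "norm_sublinear q" "q x \<le> p x" "q x \<le> p (x + y) - p y"
proof -
  have add: "p (u + v) \<le> p u + p v" for u v using p by (simp add: norm_sublinear_def)
  have lower: "- norm x \<le> p (x + t *\<^sub>R y) - t * p y" if "t \<ge> 0" for x t
    using add[of "x + t *\<^sub>R y" "- x"] norm_sublinear_scale[OF p that, of y] p
      norm_minus_cancel[of x] unfolding norm_sublinear_def by (smt (verit) add_diff_cancel_left' diff_conv_add_uminus)
  have bdd: "bdd_below ((\<lambda>t. p (x + t *\<^sub>R y) - t * p y) ` {0..})" for x
    using lower[of _ x] by (intro bdd_belowI2[where m = "- norm x"]) auto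
  have upper: "q x \<le> p (x + t *\<^sub>R y) - t * p y" if "t \<ge> 0" for x t
    unfolding q_def using that by (intro cINF_lower bdd) auto
  have greatest: "a \<le> q x" if "\<And>t. t \<ge> 0 \<Longrightarrow> a \<le> p (x + t *\<^sub>R y) - t * p y" for a x
    unfolding q_def using that by (intro cINF_greatest) auto
  show le: "q x \<le> p x" for x using upper[of 0 x] by simp
  show "q x \<le> p (x + y) - p y" using upper[of 1 x] by simp
  show "norm_sublinear q"
    unfolding norm_sublinear_def
  proof (intro conjI allI impI)
    fix x1 x2
    have two: "q (x1 + x2) - (p (x2 + s *\<^sub>R y) - s * p y) \<le> p (x1 + t *\<^sub>R y) - t * p y"
      if "t \<ge> 0" "s \<ge> 0" for s t
    proof -
      have "q (x1 + x2) \<le> p (x1 + x2 + (t + s) *\<^sub>R y) - (t + s) * p y"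
        using that by (intro upper) simp
      also have "x1 + x2 + (t + s) *\<^sub>R y = (x1 + t *\<^sub>R y) + (x2 + s *\<^sub>R y)"
        by (simp add: algebra_simps)
      finally show ?thesis using add[of "x1 + t *\<^sub>R y" "x2 + s *\<^sub>R y"] by (simp add: algebra_simps)
    qed
    have "q (x1 + x2) - q x1 \<le> p (x2 + s *\<^sub>R y) - s * p y" if "s \<ge> 0" for s
      using greatest[of "q (x1 + x2) - (p (x2 + s *\<^sub>R y) - s * p y)" x1] two[OF _ that] by simp
    then show "q (x1 + x2) \<le> q x1 + q x2"
      using greatest[of "q (x1 + x2) - q x1" x2] by simp
  next
    fix s :: real and x assume s: "s > 0"
    have "inverse s * q (s *\<^sub>R x) \<le> p (x + t *\<^sub>R y) - t * p y" if "t \<ge> 0" for t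
    proof -
      have "q (s *\<^sub>R x) \<le> p (s *\<^sub>R x + (s * t) *\<^sub>R y) - (s * t) * p y"
        using that s by (intro upper) simp
      also have "s *\<^sub>R x + (s * t) *\<^sub>R y = s *\<^sub>R (x + t *\<^sub>R y)" by (simp add: algebra_simps)
      also have "p (s *\<^sub>R (x + t *\<^sub>R y)) = s * p (x + t *\<^sub>R y)"
        using s by (intro norm_sublinear_scale[OF p]) simp
      finally have "q (s *\<^sub>R x) \<le> s * (p (x + t *\<^sub>R y) - t * p y)" by (simp add: algebra_simps)
      then show ?thesis using s by (simp add: field_simps)
    qed
    then have "inverse s * q (s *\<^sub>R x) \<le> q x" by (rule greatest)
    then show "q (s *\<^sub>R x) \<le> s * q x" using s by (simp add: field_simps)
  next
    fix x show "q x \<le> norm x" using le[of x] p unfolding norm_sublinear_def by (meson order_trans)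
  qed
qed

lemma norm_sublinear_minimal:
  fixes p0 :: "'a::real_normed_vector \<Rightarrow> real"
  assumes p0: "norm_sublinear p0"
  obtains p where "norm_sublinear p" "p \<le> p0" "\<And>q. norm_sublinear q \<Longrightarrow> q \<le> p \<Longrightarrow> q = p"
proof -
  define A where "A = {p. norm_sublinear p \<and> p \<le> p0}"
  have "\<exists>m\<in>A. \<forall>a\<in>A. m \<ge> a \<longrightarrow> a = m"
  proof (rule predicate_Zorn)
    show "partial_order_on A (relation_of (\<ge>) A)"
      by (rule partial_order_on_relation_ofI) auto
    fix C assume C: "C \<in> Chains (relation_of (\<ge>) A)"
    then have CA: "C \<subseteq> A" and total: "\<And>p q. p \<in> C \<Longrightarrow> q \<in> C \<Longrightarrow> p \<le> q \<or> q \<le> p"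
      by (auto simp: Chains_def relation_of_def)
    show "\<exists>u\<in>A. \<forall>a\<in>C. a \<ge> u"
    proof (cases "C = {}")
      case True
      then show ?thesis using p0 by (auto simp: A_def)
    next
      case False
      define q where "q x = (INF p\<in>C. p x)" for x
      have sub: "norm_sublinear p" if "p \<in> C" for p using that CA by (auto simp: A_def)
      have bdd: "bdd_below ((\<lambda>p. p x) ` C)" for x
        using norm_sublinear_lower[OF sub] by (intro bdd_belowI2[where m = "- norm x"]) auto
      have lower: "q x \<le> p x" if "p \<in> C" for p x
        unfolding q_def using that by (intro cINF_lower bdd)
      have greatest: "a \<le> q x" if "\<And>p. p \<in> C \<Longrightarrow> a \<le> p x" for a x
        unfolding q_def using that False by (intro cINF_greatest) auto
      obtain c where c: "c \<in> C" using False by blast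
      have "norm_sublinear q"
        unfolding norm_sublinear_def
      proof (intro conjI allI impI)
        fix x y
        have two: "q (x + y) \<le> p x + r y" if "p \<in> C" "r \<in> C" for p r
        proof -
          obtain m where m: "m \<in> C" "m \<le> p" "m \<le> r" using total[OF \<open>p \<in> C\<close> \<open>r \<in> C\<close>] \<open>p \<in> C\<close> \<open>r \<in> C\<close> by blast
          have "q (x + y) \<le> m (x + y)" by (rule lower[OF m(1)])
          also have "\<dots> \<le> m x + m y" using sub[OF m(1)] by (simp add: norm_sublinear_def)
          finally show ?thesis using m(2,3) unfolding le_fun_def by (smt (verit))
        qed
        have "q (x + y) - q x \<le> r y" if "r \<in> C" for r
          using greatest[of "q (x + y) - r y" x] two[OF _ that] by (simp add: algebra_simps)
        then show "q (x + y) \<le> q x + q y" using greatest[of "q (x + y) - q x" y] by simp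
      next
        fix s :: real and x assume s: "s > 0"
        have "inverse s * q (s *\<^sub>R x) \<le> p x" if "p \<in> C" for p
        proof -
          have "q (s *\<^sub>R x) \<le> s * p x"
            using lower[OF that, of "s *\<^sub>R x"] norm_sublinear_scale[OF sub[OF that], of s x] s by simp
          then show ?thesis using s by (simp add: field_simps)
        qed
        then have "inverse s * q (s *\<^sub>R x) \<le> q x" by (rule greatest)
        then show "q (s *\<^sub>R x) \<le> s * q x" using s by (simp add: field_simps)
      next
        fix x show "q x \<le> norm x"
          using lower[OF c, of x] sub[OF c] unfolding norm_sublinear_def by (meson order_trans)
      qed
      moreover have "q \<le> p0" using lower[OF c] c CA unfolding A_def le_fun_def by (blast intro: order_trans)
      ultimately show ?thesis using lower by (auto simp: A_def le_fun_def)
    qed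
  qed
  then obtain m where m: "m \<in> A" "\<And>a. a \<in> A \<Longrightarrow> a \<le> m \<Longrightarrow> a = m" by blast
  show ?thesis
    by (rule that[of m]) (use m in \<open>auto simp: A_def intro: order_trans\<close>)
qed

lemma real_functional_nonzero:
  fixes y :: "'a::real_normed_vector"
  assumes "y \<noteq> 0"
  obtains f :: "'a \<Rightarrow> real" where "bounded_linear f" "f y \<noteq> 0"
proof -
  have nrm: "norm_sublinear (norm :: 'a \<Rightarrow> real)"
    by (auto simp: norm_sublinear_def norm_triangle_ineq)
  note step = norm_sublinear_step[OF nrm, where y = y]
  obtain p where p: "norm_sublinear p" "p \<le> (\<lambda>x. INF t\<in>{0..}. norm (x + t *\<^sub>R y) - t * norm y)"
    and min: "\<And>q. norm_sublinear q \<Longrightarrow> q \<le> p \<Longrightarrow> q = p"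
    using norm_sublinear_minimal[OF step(1)] by blast
  have add: "p (u + v) = p u + p v" for u v
  proof (rule antisym)
    show "p (u + v) \<le> p u + p v" using p by (simp add: norm_sublinear_def)
    note s = norm_sublinear_step[OF p(1), where y = v]
    have "(\<lambda>x. INF t\<in>{0..}. p (x + t *\<^sub>R v) - t * p v) = p"
      using s(1,2) by (intro min) (auto simp: le_fun_def)
    then show "p u + p v \<le> p (u + v)" using s(3)[of u] by (simp add: fun_eq_iff)
  qed
  have neg: "p (- x) = - p x" for x
    using add[of x "- x"] norm_sublinear_zero[OF p(1)] by simp
  have scale: "p (r *\<^sub>R x) = r * p x" for r x
  proof (cases "r \<ge> 0")
    case False
    then have "p ((- r) *\<^sub>R x) = - r * p x" by (intro norm_sublinear_scale[OF p(1)]) simp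
    then show ?thesis using neg[of "r *\<^sub>R x"] by simp
  qed (simp add: norm_sublinear_scale[OF p(1)])
  have "\<bar>p x\<bar> \<le> norm x" for x
    using p(1) norm_sublinear_lower[OF p(1), of x] unfolding norm_sublinear_def by (smt (verit))
  then have "bounded_linear p"
    by (intro bounded_linear_intro[where K = 1]) (simp_all add: add scale)
  moreover have "p (- y) \<le> norm (- y + y) - norm y"
    using p(2) step(3)[of "- y"] unfolding le_fun_def by (meson order_trans)
  then have "p y \<noteq> 0" using assms neg[of y] by auto
  ultimately show ?thesis by (rule that)
qed

lemma cdual_separates:
  fixes y :: "'a::complex_normed_vector"
  assumes "y \<noteq> 0"
  obtains \<phi> :: "'a cdual" where "\<phi> y \<noteq> 0"
proof -
  obtain f :: "'a \<Rightarrow> real" where f: "bounded_linear f" "f y \<noteq> 0"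
    using real_functional_nonzero[OF assms] .
  interpret f: bounded_linear f by fact
  obtain K where K: "\<And>x. norm (f x) \<le> norm x * K" using f.bounded by blast
  define g where "g x = Complex (f x) (- f (\<i> *\<^sub>C x))" for x
  have "bounded_clinear g"
  proof (rule bounded_clinear_intro)
    show "g (x + x') = g x + g x'" for x x'
      by (simp add: g_def f.add scaleC_add_right complex_eq_iff)
    have mult: "c *\<^sub>C x = Re c *\<^sub>R x + Im c *\<^sub>R (\<i> *\<^sub>C x)" for c and x :: 'a
      by (simp add: scaleR_eq_scaleC scaleC_scaleC flip: scaleC_add_left)
        (metis complex_eq mult.commute)
    show "g (c *\<^sub>C x) = c *\<^sub>C g x" for c x
    proof -
      have "\<i> *\<^sub>C c *\<^sub>C x = Re c *\<^sub>R (\<i> *\<^sub>C x) - Im c *\<^sub>R x"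
        using mult[of "\<i> * c" x] by (simp add: scaleC_scaleC)
      then have "f (\<i> *\<^sub>C c *\<^sub>C x) = Re c * f (\<i> *\<^sub>C x) - Im c * f x"
        by (simp add: f.diff f.scaleR)
      moreover have "f (c *\<^sub>C x) = Re c * f x + Im c * f (\<i> *\<^sub>C x)"
        by (subst mult) (simp add: f.add f.scaleR)
      ultimately show ?thesis by (simp add: g_def scaleC_complex_def complex_eq_iff)
    qed
    show "norm (g x) \<le> norm x * (2 * K)" for x
      using cmod_le[of "g x"] K[of x] K[of "\<i> *\<^sub>C x"] by (simp add: g_def norm_scaleC)
  qed
  then have "cblinfun_apply (CBlinfun g) y \<noteq> 0"
    using f(2) by (simp add: CBlinfun_apply g_def complex_eq_iff)
  then show ?thesis by (rule that)
qed

section \<open>The algebraic tensor product with the projective norm\<close>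

definition cbilinear ::
  "('a::complex_normed_vector \<Rightarrow> 'b::complex_normed_vector \<Rightarrow> 'c::complex_normed_vector) \<Rightarrow> bool"
  where "cbilinear B \<longleftrightarrow>
    (\<forall>x. Vector_Spaces.linear scaleC scaleC (B x)) \<and>
    (\<forall>y. Vector_Spaces.linear scaleC scaleC (\<lambda>x. B x y))"

lemma clinear_iff:
  "Vector_Spaces.linear scaleC scaleC (f :: 'a::complex_normed_vector \<Rightarrow> 'b::complex_normed_vector)
    \<longleftrightarrow> (\<forall>x y. f (x + y) = f x + f y) \<and> (\<forall>c x. f (c *\<^sub>C x) = c *\<^sub>C f x)"
  unfolding Vector_Spaces.linear_iff
  by (simp add: complex_vector.vector_space_axioms)

lemma cbilinear_simps:
  assumes "cbilinear B"
  shows "B (x + x') y = B x y + B x' y" "B x (y + y') = B x y + B x y'"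
    "B (c *\<^sub>C x) y = c *\<^sub>C B x y" "B x (c *\<^sub>C y) = c *\<^sub>C B x y"
    "B 0 y = 0" "B x 0 = 0" "B (- x) y = - B x y" "B x (- y) = - B x y"
proof -
  show *: "B (x + x') y = B x y + B x' y" "B x (y + y') = B x y + B x y'"
    "B (c *\<^sub>C x) y = c *\<^sub>C B x y" "B x (c *\<^sub>C y) = c *\<^sub>C B x y" for x x' y y' c
    using assms by (simp_all add: cbilinear_def clinear_iff)
  show z: "B 0 y = 0" "B x 0 = 0" for x y using *(1)[of 0 0 y] *(2)[of x 0 0] by simp_all
  show "B (- x) y = - B x y" using *(1)[of x "- x" y] z by (simp add: eq_neg_iff_add_eq_0 add.commute)
  show "B x (- y) = - B x y" using *(2)[of x y "- y"] z by (simp add: eq_neg_iff_add_eq_0 add.commute)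
qed

text \<open>
  A list \<open>[(x\<^sub>1, y\<^sub>1), \<dots>, (x\<^sub>n, y\<^sub>n)]\<close> represents the finite sum of the \<open>x\<^sub>i \<otimes> y\<^sub>i\<close>. Two lists represent
  the same tensor iff they have the same image under every bilinear form (no continuity required).
\<close>

definition form_sum :: "('a \<Rightarrow> 'b \<Rightarrow> 'c::comm_monoid_add) \<Rightarrow> ('a \<times> 'b) list \<Rightarrow> 'c"
  where "form_sum B ps = (\<Sum>(x, y)\<leftarrow>ps. B x y)"

lemma form_sum_simps [simp]:
  "form_sum B [] = 0" "form_sum B ((x, y) # ps) = B x y + form_sum B ps"
  "form_sum B (ps @ qs) = form_sum B ps + form_sum B qs"
  by (simp_all add: form_sum_def)

definition tensor_equiv ::
  "('a::complex_normed_vector \<times> 'b::complex_normed_vector) list \<Rightarrow> ('a \<times> 'b) list \<Rightarrow> bool"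
  where "tensor_equiv ps qs \<longleftrightarrow>
    (\<forall>B :: 'a \<Rightarrow> 'b \<Rightarrow> complex. cbilinear B \<longrightarrow> form_sum B ps = form_sum B qs)"

definition tensor_cost :: "('a::real_normed_vector \<times> 'b::real_normed_vector) list \<Rightarrow> real"
  where "tensor_cost ps = (\<Sum>(x, y)\<leftarrow>ps. norm x * norm y)"

definition projective_norm ::
  "('a::complex_normed_vector \<times> 'b::complex_normed_vector) list \<Rightarrow> real"
  where "projective_norm ps = Inf {tensor_cost qs | qs. tensor_equiv ps qs}"

lemma tensor_equiv_refl [simp]: "tensor_equiv ps ps"
  and tensor_equiv_sym: "tensor_equiv ps qs \<Longrightarrow> tensor_equiv qs ps"
  and tensor_equiv_trans: "tensor_equiv ps qs \<Longrightarrow> tensor_equiv qs rs \<Longrightarrow> tensor_equiv ps rs"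
  and tensor_equiv_append:
    "tensor_equiv ps ps' \<Longrightarrow> tensor_equiv qs qs' \<Longrightarrow> tensor_equiv (ps @ qs) (ps' @ qs')"
  by (auto simp: tensor_equiv_def)

lemma tensor_cost_simps [simp]:
  "tensor_cost [] = 0" "tensor_cost ((x, y) # ps) = norm x * norm y + tensor_cost ps"
  "tensor_cost (ps @ qs) = tensor_cost ps + tensor_cost qs"
  by (simp_all add: tensor_cost_def)

lemma tensor_cost_nonneg [simp]: "0 \<le> tensor_cost ps"
  by (induction ps) auto

definition list_scaleC :: "complex \<Rightarrow> ('a::complex_normed_vector \<times> 'b) list \<Rightarrow> ('a \<times> 'b) list"
  where "list_scaleC c = map (\<lambda>(x, y). (c *\<^sub>C x, y))"

lemma form_sum_list_scaleC:
  "cbilinear B \<Longrightarrow> form_sum B (list_scaleC c ps) = c *\<^sub>C form_sum B ps"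
  by (induction ps) (auto simp: list_scaleC_def cbilinear_simps scaleC_add_right)

lemma tensor_cost_list_scaleC: "tensor_cost (list_scaleC c ps) = cmod c * tensor_cost ps"
  by (induction ps) (auto simp: list_scaleC_def norm_scaleC algebra_simps)

lemma tensor_equiv_list_scaleC:
  "tensor_equiv ps qs \<Longrightarrow> tensor_equiv (list_scaleC c ps) (list_scaleC c qs)"
  by (simp add: tensor_equiv_def form_sum_list_scaleC)

lemma projective_norm_le_cost: "tensor_equiv ps qs \<Longrightarrow> projective_norm ps \<le> tensor_cost qs"
  unfolding projective_norm_def by (rule cInf_lower) (auto intro!: bdd_belowI[where m = 0])

lemma projective_norm_approx:
  assumes "e > 0"
  obtains qs where "tensor_equiv ps qs" "tensor_cost qs < projective_norm ps + e"
proof -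
  have "{tensor_cost qs | qs. tensor_equiv ps qs} \<noteq> {}" by (auto intro: tensor_equiv_refl)
  then have "\<exists>t\<in>{tensor_cost qs | qs. tensor_equiv ps qs}. t < projective_norm ps + e"
    unfolding projective_norm_def using assms by (intro cInf_lessD) auto
  then show ?thesis using that by auto
qed

lemma projective_norm_cong: "tensor_equiv ps qs \<Longrightarrow> projective_norm ps = projective_norm qs"
  unfolding projective_norm_def by (metis tensor_equiv_sym tensor_equiv_trans)

lemma projective_norm_nonneg: "0 \<le> projective_norm ps"
  unfolding projective_norm_def by (rule cInf_greatest) (auto intro: tensor_equiv_refl)

lemma projective_norm_append: "projective_norm (ps @ qs) \<le> projective_norm ps + projective_norm qs"
proof (rule field_le_epsilon)
  fix e :: real assume "e > 0"
  then have e: "e / 2 > 0" by simp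
  obtain ps' qs' where "tensor_equiv ps ps'" "tensor_cost ps' < projective_norm ps + e / 2"
    "tensor_equiv qs qs'" "tensor_cost qs' < projective_norm qs + e / 2"
    using projective_norm_approx[OF e] by metis
  then show "projective_norm (ps @ qs) \<le> projective_norm ps + projective_norm qs + e"
    using projective_norm_le_cost[OF tensor_equiv_append[of ps ps' qs qs']] by simp
qed

lemma projective_norm_scaleC_le:
  "projective_norm (list_scaleC c ps) \<le> cmod c * projective_norm ps"
proof (rule field_le_epsilon)
  fix e :: real assume e: "e > 0"
  then have e': "e / (cmod c + 1) > 0" by (simp add: add_nonneg_pos)
  obtain qs where qs: "tensor_equiv ps qs" "tensor_cost qs < projective_norm ps + e / (cmod c + 1)"
    using projective_norm_approx[OF e'] .
  have "projective_norm (list_scaleC c ps) \<le> cmod c * tensor_cost qs"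
    using projective_norm_le_cost[OF tensor_equiv_list_scaleC[OF qs(1)], of c]
    by (simp add: tensor_cost_list_scaleC)
  also have "\<dots> \<le> cmod c * (projective_norm ps + e / (cmod c + 1))"
    using qs(2) by (intro mult_left_mono) auto
  also have "\<dots> \<le> cmod c * projective_norm ps + e"
  proof -
    have "cmod c * e \<le> e * (cmod c + 1)" using e by (simp add: algebra_simps)
    then have "cmod c * (e / (cmod c + 1)) \<le> e"
      by (simp add: pos_divide_le_eq add_nonneg_pos)
    then show ?thesis by (simp add: algebra_simps)
  qed
  finally show "projective_norm (list_scaleC c ps) \<le> cmod c * projective_norm ps + e" .
qed

definition bounded_cbilinear ::
  "('a::complex_normed_vector \<Rightarrow> 'b::complex_normed_vector \<Rightarrow> 'c::complex_normed_vector) \<Rightarrow> bool"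
  where "bounded_cbilinear B \<longleftrightarrow> cbilinear B \<and> (\<exists>K. \<forall>x y. norm (B x y) \<le> K * norm x * norm y)"

lemma form_sum_bound:
  assumes "\<And>x y. norm (B x y) \<le> K * norm x * norm y"
  shows "norm (form_sum B ps) \<le> K * tensor_cost ps"
proof (induction ps)
  case (Cons p ps)
  obtain x y where p: "p = (x, y)" by (cases p)
  show ?case
    unfolding p using Cons assms[of x y] norm_triangle_ineq[of "B x y" "form_sum B ps"]
    by (simp add: algebra_simps)
qed simp

lemma tensor_equiv_Nil:
  fixes ps :: "('a::complex_normed_vector \<times> 'b::complex_normed_vector) list"
  assumes "\<And>(\<phi>::'a cdual) (\<psi>::'b cdual). form_sum (\<lambda>x y. \<phi> x * \<psi> y) ps = 0"
  shows "tensor_equiv ps []"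
  using assms
proof (induction "length ps" arbitrary: ps)
  case (Suc n)
  then obtain x y qs where ps: "ps = (x, y) # qs" and n: "n = length qs"
    by (cases ps) auto
  show ?case
  proof (cases "y = 0")
    case True
    have "form_sum (\<lambda>x y. \<phi> x * \<psi> y) qs = 0" for \<phi> :: "'a cdual" and \<psi> :: "'b cdual"
      using Suc.prems[of \<phi> \<psi>] unfolding ps True by (simp add: cblinfun.zero_right)
    then have "tensor_equiv qs []" by (intro Suc.hyps(1) n)
    then show ?thesis
      unfolding ps True by (simp add: tensor_equiv_def cbilinear_simps)
  next
    case False
    obtain \<psi>' :: "'b cdual" where "\<psi>' y \<noteq> 0" using cdual_separates[OF False] .
    then have \<psi>: "(inverse (\<psi>' y) *\<^sub>C \<psi>') y = 1"
      by (simp add: cblinfun_apply_scaleC scaleC_complex_def)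
    define \<psi> where "\<psi> = inverse (\<psi>' y) *\<^sub>C \<psi>'"
    note \<psi> = \<psi>[folded \<psi>_def]
    define s where "s = form_sum (\<lambda>u v. \<psi> v *\<^sub>C u) qs"
    have app: "\<phi> (form_sum (\<lambda>u v. \<psi> v *\<^sub>C u) rs) = form_sum (\<lambda>u v. \<phi> u * \<psi> v) rs"
      for \<phi> :: "'a cdual" and rs
      by (induction rs) (auto simp: cblinfun.zero_right cblinfun.add_right cblinfun_scaleC_arg
          scaleC_complex_def)
    have "\<phi> (x + s) = 0" for \<phi> :: "'a cdual"
      using Suc.prems[of \<phi> \<psi>] by (simp add: ps \<psi> s_def cblinfun.add_right app)
    then have x: "x + s = 0" using cdual_separates[of "x + s"] by blast
    define rs where "rs = map (\<lambda>(u, v). (u, v - \<psi> v *\<^sub>C y)) qs"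
    have reduce: "form_sum B ps = form_sum B rs" if "cbilinear B" for B :: "'a \<Rightarrow> 'b \<Rightarrow> complex"
    proof -
      note B = cbilinear_simps[OF that]
      have "form_sum B (map (\<lambda>(u, v). (u, v - \<psi> v *\<^sub>C y)) ts)
          = form_sum B ts - B (form_sum (\<lambda>u v. \<psi> v *\<^sub>C u) ts) y" for ts
      proof (induction ts)
        case (Cons t ts)
        obtain u v where t: "t = (u, v)" by (cases t)
        have "B u (v - \<psi> v *\<^sub>C y) = B u v - \<psi> v *\<^sub>C B u y"
          using B(2)[of u v "- (\<psi> v *\<^sub>C y)"] by (simp add: B)
        then show ?case using Cons by (simp add: t B)
      qed (simp add: B)
      then have "form_sum B rs = form_sum B qs - B s y" by (simp add: rs_def s_def)
      moreover have "B x y = - B s y"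
        using B(1)[of x s y] x B(5)[of y] by (simp add: eq_neg_iff_add_eq_0)
      ultimately show ?thesis by (simp add: ps)
    qed
    have "form_sum (\<lambda>x y. \<phi> x * \<psi>2 y) rs = 0" for \<phi> :: "'a cdual" and \<psi>2 :: "'b cdual"
    proof -
      have "cbilinear (\<lambda>x y. \<phi> x * \<psi>2 y)"
        by (simp add: cbilinear_def clinear_iff cblinfun.add_right cblinfun_scaleC_arg
            scaleC_complex_def algebra_simps)
      from reduce[OF this] Suc.prems[of \<phi> \<psi>2] show ?thesis by simp
    qed
    then have "tensor_equiv rs []" by (intro Suc.hyps(1)) (simp_all add: rs_def n)
    then show ?thesis using reduce by (simp add: tensor_equiv_def)
  qed
qed simp

lemma projective_norm_eq_0:
  fixes ps :: "('a::complex_normed_vector \<times> 'b::complex_normed_vector) list"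
  assumes "projective_norm ps = 0"
  shows "tensor_equiv ps []"
proof (rule tensor_equiv_Nil)
  fix \<phi> :: "'a cdual" and \<psi> :: "'b cdual"
  have B: "cbilinear (\<lambda>x y. \<phi> x * \<psi> y)"
    by (simp add: cbilinear_def clinear_iff cblinfun.add_right cblinfun_scaleC_arg
        scaleC_complex_def algebra_simps)
  define K where "K = norm \<phi> * norm \<psi>"
  have K: "norm (\<phi> x * \<psi> y) \<le> K * norm x * norm y" for x y
    using mult_mono[OF norm_cblinfun[of \<phi> x] norm_cblinfun[of \<psi> y]]
    by (simp add: norm_mult K_def algebra_simps)
  have "norm (form_sum (\<lambda>x y. \<phi> x * \<psi> y) ps) \<le> 0 + e" if e: "e > 0" for e
  proof -
    have K0: "K \<ge> 0" by (simp add: K_def)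
    then have "e / (K + 1) > 0" using e by simp
    then obtain qs where qs: "tensor_equiv ps qs" "tensor_cost qs < projective_norm ps + e / (K + 1)"
      by (rule projective_norm_approx)
    have "norm (form_sum (\<lambda>x y. \<phi> x * \<psi> y) ps) \<le> K * tensor_cost qs"
      using form_sum_bound[OF K, of qs] qs(1) B by (simp add: tensor_equiv_def)
    also have "\<dots> \<le> K * (e / (K + 1))"
      using qs(2) assms K0 by (intro mult_left_mono) auto
    also have "\<dots> \<le> e" using K0 e by (simp add: pos_divide_le_eq algebra_simps)
    finally show ?thesis by simp
  qed
  then have "norm (form_sum (\<lambda>x y. \<phi> x * \<psi> y) ps) \<le> 0" by (rule field_le_epsilon)
  then show "form_sum (\<lambda>x y. \<phi> x * \<psi> y) ps = 0" by simp
qed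

quotient_type (overloaded) ('a, 'b) alg_tensor =
  "('a::complex_normed_vector \<times> 'b::complex_normed_vector) list" / tensor_equiv
  by (rule equivpI) (auto intro: reflpI sympI transpI tensor_equiv_sym tensor_equiv_trans)

instantiation alg_tensor :: (complex_normed_vector, complex_normed_vector) complex_normed_vector
begin
lift_definition norm_alg_tensor :: "('a, 'b) alg_tensor \<Rightarrow> real" is projective_norm
  by (rule projective_norm_cong)
lift_definition zero_alg_tensor :: "('a, 'b) alg_tensor" is "[]" .
lift_definition plus_alg_tensor :: "('a, 'b) alg_tensor \<Rightarrow> ('a, 'b) alg_tensor \<Rightarrow> ('a, 'b) alg_tensor"
  is "(@)" by (rule tensor_equiv_append)
lift_definition scaleC_alg_tensor :: "complex \<Rightarrow> ('a, 'b) alg_tensor \<Rightarrow> ('a, 'b) alg_tensor"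
  is list_scaleC by (rule tensor_equiv_list_scaleC)
definition scaleR_alg_tensor :: "real \<Rightarrow> ('a, 'b) alg_tensor \<Rightarrow> ('a, 'b) alg_tensor"
  where "scaleR_alg_tensor r u = complex_of_real r *\<^sub>C u"
definition uminus_alg_tensor :: "('a, 'b) alg_tensor \<Rightarrow> ('a, 'b) alg_tensor"
  where "uminus_alg_tensor u = (- 1) *\<^sub>C u"
definition minus_alg_tensor :: "('a, 'b) alg_tensor \<Rightarrow> ('a, 'b) alg_tensor \<Rightarrow> ('a, 'b) alg_tensor"
  where "minus_alg_tensor u v = u + - v"
definition sgn_alg_tensor :: "('a, 'b) alg_tensor \<Rightarrow> ('a, 'b) alg_tensor"
  where "sgn_alg_tensor u = scaleR (inverse (norm u)) u"
definition dist_alg_tensor :: "('a, 'b) alg_tensor \<Rightarrow> ('a, 'b) alg_tensor \<Rightarrow> real"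
  where "dist_alg_tensor u v = norm (u - v)"
definition "(uniformity :: (('a, 'b) alg_tensor \<times> ('a, 'b) alg_tensor) filter)
  = (INF e\<in>{0 <..}. principal {(u, v). dist u v < e})"
definition open_alg_tensor :: "('a, 'b) alg_tensor set \<Rightarrow> bool"
  where "open_alg_tensor S = (\<forall>u\<in>S. \<forall>\<^sub>F (u', v) in uniformity. u' = u \<longrightarrow> v \<in> S)"
instance
proof
  fix u v w :: "('a, 'b) alg_tensor" and r s :: real and c d :: complex
  show "u + v + w = u + (v + w)" by transfer simp
  show "u + v = v + u" by transfer (simp add: tensor_equiv_def add.commute)
  show "0 + u = u" by transfer simp
  have cadd: "c *\<^sub>C (u + v) = c *\<^sub>C u + c *\<^sub>C v" for c and u v :: "('a, 'b) alg_tensor"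
    by transfer (simp add: list_scaleC_def)
  have caddl: "(c + d) *\<^sub>C u = c *\<^sub>C u + d *\<^sub>C u" for c d and u :: "('a, 'b) alg_tensor"
    by transfer (simp add: tensor_equiv_def form_sum_list_scaleC scaleC_add_left)
  have cmul: "c *\<^sub>C d *\<^sub>C u = (c * d) *\<^sub>C u" for c d and u :: "('a, 'b) alg_tensor"
    by transfer (simp add: tensor_equiv_def form_sum_list_scaleC scaleC_scaleC)
  have one: "1 *\<^sub>C u = u" for u :: "('a, 'b) alg_tensor"
    by transfer (simp add: tensor_equiv_def form_sum_list_scaleC)
  have zero: "0 *\<^sub>C u = 0" for u :: "('a, 'b) alg_tensor"
    by transfer (simp add: tensor_equiv_def form_sum_list_scaleC)
  show "- u + u = 0"
    using caddl[of "- 1" 1 u] by (simp add: uminus_alg_tensor_def one zero)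
  show "u - v = u + - v" by (simp add: minus_alg_tensor_def)
  show "r *\<^sub>R (u + v) = r *\<^sub>R u + r *\<^sub>R v" "(r + s) *\<^sub>R u = r *\<^sub>R u + s *\<^sub>R u"
    "r *\<^sub>R s *\<^sub>R u = (r * s) *\<^sub>R u" "1 *\<^sub>R u = u"
    by (simp_all add: scaleR_alg_tensor_def cadd caddl cmul one)
  show "c *\<^sub>C (u + v) = c *\<^sub>C u + c *\<^sub>C v" "(c + d) *\<^sub>C u = c *\<^sub>C u + d *\<^sub>C u"
    "c *\<^sub>C d *\<^sub>C u = (c * d) *\<^sub>C u" "r *\<^sub>R u = complex_of_real r *\<^sub>C u"
    by (simp_all add: scaleR_alg_tensor_def cadd caddl cmul)
  show "norm (u + v) \<le> norm u + norm v" by transfer (rule projective_norm_append)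
  have le: "norm (c *\<^sub>C u) \<le> cmod c * norm u" for c and u :: "('a, 'b) alg_tensor"
    by transfer (rule projective_norm_scaleC_le)
  have n0: "norm (0 :: ('a, 'b) alg_tensor) = 0"
  proof transfer
    show "projective_norm ([] :: ('a \<times> 'b) list) = 0"
      using projective_norm_le_cost[of "[] :: ('a \<times> 'b) list" "[]"] projective_norm_nonneg[of "[] :: ('a \<times> 'b) list"]
      by simp
  qed
  show nc: "norm (c *\<^sub>C u) = cmod c * norm u" for c
  proof (cases "c = 0")
    case False
    have "norm u \<le> cmod (inverse c) * norm (c *\<^sub>C u)"
      using le[of "inverse c" "c *\<^sub>C u"] False by (simp add: cmul one)
    then have "cmod c * norm u \<le> norm (c *\<^sub>C u)"
      using False by (simp add: norm_inverse norm_divide field_simps)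
    with le[of c u] show ?thesis by simp
  qed (simp add: zero n0)
  show "norm (r *\<^sub>R u) = \<bar>r\<bar> * norm u" by (simp add: scaleR_alg_tensor_def nc)
  show "norm u = 0 \<longleftrightarrow> u = 0"
  proof
    show "norm u = 0 \<Longrightarrow> u = 0" by transfer (rule projective_norm_eq_0)
  qed (simp add: n0)
qed (simp_all add: sgn_alg_tensor_def dist_alg_tensor_def uniformity_alg_tensor_def open_alg_tensor_def)
end

section \<open>Completion of a normed space\<close>

definition null_equiv :: "(nat \<Rightarrow> 'a::real_normed_vector) \<Rightarrow> (nat \<Rightarrow> 'a) \<Rightarrow> bool"
  where "null_equiv X Y \<longleftrightarrow> Cauchy X \<and> Cauchy Y \<and> (\<lambda>n. X n - Y n) \<longlonglongrightarrow> 0"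

lemma Cauchy_bounded_linear:
  assumes "bounded_linear f" "Cauchy X" shows "Cauchy (\<lambda>n. f (X n))"
  using bounded_linear.Cauchy[OF assms] .

lemma Cauchy_add':
  fixes X Y :: "nat \<Rightarrow> 'a::real_normed_vector"
  assumes "Cauchy X" "Cauchy Y" shows "Cauchy (\<lambda>n. X n + Y n)"
proof (rule CauchyI)
  fix e :: real assume "e > 0"
  then have e: "e / 2 > 0" by simp
  obtain M N where M: "\<And>m n. m \<ge> M \<Longrightarrow> n \<ge> M \<Longrightarrow> norm (X m - X n) < e / 2"
    and N: "\<And>m n. m \<ge> N \<Longrightarrow> n \<ge> N \<Longrightarrow> norm (Y m - Y n) < e / 2"
    using CauchyD[OF assms(1) e] CauchyD[OF assms(2) e] by blast
  show "\<exists>K. \<forall>m\<ge>K. \<forall>n\<ge>K. norm (X m + Y m - (X n + Y n)) < e"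
  proof (intro exI[of _ "max M N"] allI impI)
    fix m n assume "m \<ge> max M N" "n \<ge> max M N"
    then have "norm (X m - X n) + norm (Y m - Y n) < e" using M[of m n] N[of m n] by simp
    then show "norm (X m + Y m - (X n + Y n)) < e"
      using norm_triangle_ineq[of "X m - X n" "Y m - Y n"] by (simp add: algebra_simps)
  qed
qed

lemma Cauchy_norm: "Cauchy X \<Longrightarrow> Cauchy (\<lambda>n. norm (X n))"
  proof (rule CauchyI)
  fix e :: real assume "Cauchy X" "e > 0"
  then obtain N where "\<And>m n. m \<ge> N \<Longrightarrow> n \<ge> N \<Longrightarrow> norm (X m - X n) < e"
    using CauchyD by blast
  moreover have "norm (norm (X m) - norm (X n)) \<le> norm (X m - X n)" for m n
    using norm_triangle_ineq3 by simp
  ultimately show "\<exists>N. \<forall>m\<ge>N. \<forall>n\<ge>N. norm (norm (X m) - norm (X n)) < e"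
    by (meson le_less_trans)
qed

quotient_type (overloaded) 'a completion =
  "nat \<Rightarrow> 'a::complex_normed_vector" / partial: null_equiv
proof (rule part_equivpI)
  show "\<exists>X::nat \<Rightarrow> 'a. null_equiv X X"
    by (rule exI[of _ "\<lambda>_. 0"]) (simp add: null_equiv_def Cauchy_def)
  show "symp (null_equiv :: (nat \<Rightarrow> 'a) \<Rightarrow> _)"
  proof (rule sympI)
    fix X Y :: "nat \<Rightarrow> 'a" assume "null_equiv X Y"
    then show "null_equiv Y X"
      using tendsto_minus[of "\<lambda>n. X n - Y n" 0 sequentially] by (simp add: null_equiv_def)
  qed
  show "transp (null_equiv :: (nat \<Rightarrow> 'a) \<Rightarrow> _)"
  proof (rule transpI)
    fix X Y Z :: "nat \<Rightarrow> 'a" assume "null_equiv X Y" "null_equiv Y Z"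
    then show "null_equiv X Z"
      using tendsto_add[of "\<lambda>n. X n - Y n" 0 sequentially "\<lambda>n. Y n - Z n" 0]
      by (simp add: null_equiv_def)
  qed
qed

lemma null_equiv_bounded_linear:
  assumes "bounded_linear f" "null_equiv X Y"
  shows "null_equiv (\<lambda>n. f (X n)) (\<lambda>n. f (Y n))"
  using assms bounded_linear.tendsto[OF assms(1), of "\<lambda>n. X n - Y n" 0 sequentially]
  by (simp add: null_equiv_def Cauchy_bounded_linear linear_simps)

lemma null_equiv_add:
  assumes "null_equiv X X'" "null_equiv Y Y'"
  shows "null_equiv (\<lambda>n. X n + Y n) (\<lambda>n. X' n + Y' n)"
  using assms tendsto_add[of "\<lambda>n. X n - X' n" 0 sequentially "\<lambda>n. Y n - Y' n" 0]
  by (simp add: null_equiv_def Cauchy_add' algebra_simps)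

lemma null_equiv_norm:
  assumes "null_equiv X Y"
  shows "lim (\<lambda>n. norm (X n)) = lim (\<lambda>n. norm (Y n))"
proof -
  obtain l where l: "(\<lambda>n. norm (X n)) \<longlonglongrightarrow> l"
    using assms Cauchy_norm unfolding null_equiv_def Cauchy_convergent_iff convergent_def by metis
  have "(\<lambda>n. norm (X n) - norm (Y n)) \<longlonglongrightarrow> 0"
  proof (rule Lim_null_comparison)
    show "\<forall>\<^sub>F n in sequentially. norm (norm (X n) - norm (Y n)) \<le> norm (X n - Y n)"
      using norm_triangle_ineq3 by (auto intro: always_eventually)
    show "(\<lambda>n. norm (X n - Y n)) \<longlonglongrightarrow> 0"
      using assms by (simp add: null_equiv_def tendsto_norm_zero)
  qed
  then have "(\<lambda>n. norm (Y n)) \<longlonglongrightarrow> l"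
    using tendsto_diff[OF l] by fastforce
  with l show ?thesis by (simp add: limI)
qed

lemma null_equiv_refl: "null_equiv X X \<longleftrightarrow> Cauchy X"
  by (simp add: null_equiv_def)

instantiation completion :: (complex_normed_vector) complex_normed_vector
begin
lift_definition norm_completion :: "'a completion \<Rightarrow> real" is "\<lambda>X. lim (\<lambda>n. norm (X n))"
  by (rule null_equiv_norm)
lift_definition zero_completion :: "'a completion" is "\<lambda>_. 0"
  by (simp add: null_equiv_def Cauchy_def)
lift_definition plus_completion :: "'a completion \<Rightarrow> 'a completion \<Rightarrow> 'a completion"
  is "\<lambda>X Y n. X n + Y n" by (rule null_equiv_add)
lift_definition scaleC_completion :: "complex \<Rightarrow> 'a completion \<Rightarrow> 'a completion"
  is "\<lambda>c X n. c *\<^sub>C X n" by (rule null_equiv_bounded_linear[OF bounded_linear_scaleC])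
definition scaleR_completion :: "real \<Rightarrow> 'a completion \<Rightarrow> 'a completion"
  where "scaleR_completion r u = complex_of_real r *\<^sub>C u"
definition uminus_completion :: "'a completion \<Rightarrow> 'a completion"
  where "uminus_completion u = (- 1) *\<^sub>C u"
definition minus_completion :: "'a completion \<Rightarrow> 'a completion \<Rightarrow> 'a completion"
  where "minus_completion u v = u + - v"
definition sgn_completion :: "'a completion \<Rightarrow> 'a completion"
  where "sgn_completion u = scaleR (inverse (norm u)) u"
definition dist_completion :: "'a completion \<Rightarrow> 'a completion \<Rightarrow> real"
  where "dist_completion u v = norm (u - v)"
definition "(uniformity :: ('a completion \<times> 'a completion) filter)
  = (INF e\<in>{0 <..}. principal {(u, v). dist u v < e})"
definition open_completion :: "'a completion set \<Rightarrow> bool"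
  where "open_completion S = (\<forall>u\<in>S. \<forall>\<^sub>F (u', v) in uniformity. u' = u \<longrightarrow> v \<in> S)"
instance
proof
  fix u v w :: "'a completion" and r s :: real and c d :: complex
  show "u + v + w = u + (v + w)" "u + v = v + u" "0 + u = u"
    by (transfer, simp add: null_equiv_def Cauchy_add' add_ac)+
  have cadd: "c *\<^sub>C (u + v) = c *\<^sub>C u + c *\<^sub>C v" for c and u v :: "'a completion"
    by transfer (simp add: scaleC_add_right null_equiv_add null_equiv_bounded_linear[OF bounded_linear_scaleC])
  have caddl: "(c + d) *\<^sub>C u = c *\<^sub>C u + d *\<^sub>C u" for c d and u :: "'a completion"
    by transfer (simp add: scaleC_add_left null_equiv_add null_equiv_bounded_linear[OF bounded_linear_scaleC])
  have cmul: "c *\<^sub>C d *\<^sub>C u = (c * d) *\<^sub>C u" for c d and u :: "'a completion"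
    by transfer (simp add: scaleC_scaleC null_equiv_bounded_linear[OF bounded_linear_scaleC])
  have one: "1 *\<^sub>C u = u" for u :: "'a completion"
    by transfer simp
  have zero: "0 *\<^sub>C u = 0" for u :: "'a completion"
    by transfer (simp add: null_equiv_def Cauchy_def)
  show "- u + u = 0"
    using caddl[of "- 1" 1 u] by (simp add: uminus_completion_def one zero)
  show "u - v = u + - v" by (simp add: minus_completion_def)
  show "r *\<^sub>R (u + v) = r *\<^sub>R u + r *\<^sub>R v" "(r + s) *\<^sub>R u = r *\<^sub>R u + s *\<^sub>R u"
    "r *\<^sub>R s *\<^sub>R u = (r * s) *\<^sub>R u" "1 *\<^sub>R u = u"
    by (simp_all add: scaleR_completion_def cadd caddl cmul one)
  show "c *\<^sub>C (u + v) = c *\<^sub>C u + c *\<^sub>C v" "(c + d) *\<^sub>C u = c *\<^sub>C u + d *\<^sub>C u"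
    "c *\<^sub>C d *\<^sub>C u = (c * d) *\<^sub>C u" "r *\<^sub>R u = complex_of_real r *\<^sub>C u"
    by (simp_all add: scaleR_completion_def cadd caddl cmul)
  have conv: "(\<lambda>n. norm (X n)) \<longlonglongrightarrow> lim (\<lambda>n. norm (X n))" if "null_equiv X X" for X :: "nat \<Rightarrow> 'a"
    using that Cauchy_norm
    unfolding null_equiv_def Cauchy_convergent_iff convergent_LIMSEQ_iff by blast
  show "norm (u + v) \<le> norm u + norm v"
  proof transfer
    fix X Y :: "nat \<Rightarrow> 'a" assume X: "null_equiv X X" and Y: "null_equiv Y Y"
    show "lim (\<lambda>n. norm (X n + Y n)) \<le> lim (\<lambda>n. norm (X n)) + lim (\<lambda>n. norm (Y n))"
      by (rule LIMSEQ_le[OF conv[OF null_equiv_add[OF X Y]] tendsto_add[OF conv[OF X] conv[OF Y]]])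
        (auto intro: norm_triangle_ineq)
  qed
  show nc: "norm (c *\<^sub>C u) = cmod c * norm u" for c
  proof transfer
    fix c and X :: "nat \<Rightarrow> 'a" assume X: "null_equiv X X"
    show "lim (\<lambda>n. norm (c *\<^sub>C X n)) = cmod c * lim (\<lambda>n. norm (X n))"
      unfolding norm_scaleC by (rule limI, rule tendsto_mult[OF tendsto_const conv[OF X]])
  qed
  show "norm (r *\<^sub>R u) = \<bar>r\<bar> * norm u" by (simp add: scaleR_completion_def nc)
  show "norm u = 0 \<longleftrightarrow> u = 0"
  proof transfer
    fix X :: "nat \<Rightarrow> 'a" assume X: "null_equiv X X"
    have "X \<longlonglongrightarrow> 0 \<longleftrightarrow> lim (\<lambda>n. norm (X n)) = 0"
      using conv[OF X] by (metis LIMSEQ_unique tendsto_norm_zero_iff)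
    then show "lim (\<lambda>n. norm (X n)) = 0 \<longleftrightarrow> null_equiv X (\<lambda>_. 0)"
      using X by (auto simp: null_equiv_def Cauchy_def)
  qed
qed (simp_all add: sgn_completion_def dist_completion_def uniformity_completion_def open_completion_def)
end

lift_definition to_completion :: "'a::complex_normed_vector \<Rightarrow> 'a completion" is "\<lambda>x _. x"
  by (simp add: null_equiv_def Cauchy_def)

lemma norm_to_completion [simp]: "norm (to_completion x) = norm x"
  by transfer simp

lemma to_completion_add: "to_completion (x + y) = to_completion x + to_completion y"
  by transfer (simp add: null_equiv_def Cauchy_def)

lemma to_completion_scaleC: "to_completion (c *\<^sub>C x) = c *\<^sub>C to_completion x"
  by transfer (simp add: null_equiv_def Cauchy_def)

lemma to_completion_diff: "to_completion (x - y) = to_completion x - to_completion y"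
proof -
  have "x - y = x + (- 1) *\<^sub>C y" by simp
  then have "to_completion (x - y) = to_completion x + (- 1) *\<^sub>C to_completion y"
    by (metis to_completion_add to_completion_scaleC)
  then show ?thesis by simp
qed

lemma to_completion_tendsto:
  assumes "Cauchy X" shows "(\<lambda>n. to_completion (X n)) \<longlonglongrightarrow> abs_completion X"
proof (rule LIMSEQ_I)
  fix e :: real assume e: "e > 0"
  obtain N where N: "\<And>m n. m \<ge> N \<Longrightarrow> n \<ge> N \<Longrightarrow> norm (X m - X n) < e / 2"
    using CauchyD[OF assms, of "e / 2"] e by auto
  show "\<exists>N. \<forall>n\<ge>N. norm (to_completion (X n) - abs_completion X) < e"
  proof (intro exI[of _ N] allI impI)
    fix n assume n: "n \<ge> N"
    have X: "null_equiv X X" using assms by (simp add: null_equiv_refl)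
    have const: "null_equiv (\<lambda>_. X n) (\<lambda>_. X n)" by (simp add: null_equiv_def Cauchy_def)
    have neg: "null_equiv (\<lambda>k. (- 1) *\<^sub>C X k) (\<lambda>k. (- 1) *\<^sub>C X k)"
      by (rule null_equiv_bounded_linear[OF bounded_linear_scaleC X])
    have "to_completion (X n) - abs_completion X = to_completion (X n) + (- 1) *\<^sub>C abs_completion X"
      by simp
    also have "\<dots> = abs_completion (\<lambda>k. X n + (- 1) *\<^sub>C X k)"
      using X const neg by (simp only: to_completion.abs_eq scaleC_completion.abs_eq plus_completion.abs_eq)
    finally have eq: "norm (to_completion (X n) - abs_completion X) = lim (\<lambda>k. norm (X n - X k))"
      using null_equiv_add[OF const neg] by (simp add: norm_completion.abs_eq)
    have "Cauchy (\<lambda>k. X n - X k)"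
      using null_equiv_add[OF const neg] by (simp add: null_equiv_refl)
    then have "(\<lambda>k. norm (X n - X k)) \<longlonglongrightarrow> lim (\<lambda>k. norm (X n - X k))"
      using Cauchy_norm unfolding Cauchy_convergent_iff convergent_LIMSEQ_iff by blast
    then have "lim (\<lambda>k. norm (X n - X k)) \<le> e / 2"
      by (rule LIMSEQ_le_const2) (use N n in \<open>auto intro!: exI[of _ N] less_imp_le\<close>)
    then show "norm (to_completion (X n) - abs_completion X) < e" using eq e by simp
  qed
qed

lemma completion_limit_exists: "\<exists>X. Cauchy X \<and> u = abs_completion X"
  using Quotient3_abs_rep[OF Quotient3_completion] Quotient3_rep_reflp[OF Quotient3_completion]
  unfolding null_equiv_refl by metis

lemma to_completion_dense:
  assumes "e > 0" obtains x where "norm (to_completion x - u) < e"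
proof -
  obtain X where "Cauchy X" "u = abs_completion X" using completion_limit_exists by blast
  then have "(\<lambda>n. to_completion (X n)) \<longlonglongrightarrow> u" using to_completion_tendsto by simp
  from LIMSEQ_D[OF this assms] show ?thesis using that by blast
qed

instance completion :: (complex_normed_vector) complex_banach
proof
  fix U :: "nat \<Rightarrow> 'a completion"
  assume U: "Cauchy U"
  have "\<exists>x. norm (to_completion x - U n) < inverse (real (Suc n))" for n
    using to_completion_dense[of "inverse (real (Suc n))" "U n"] by auto
  then obtain x where x: "\<And>n. norm (to_completion (x n) - U n) < inverse (real (Suc n))"
    by metis
  have null: "(\<lambda>n. to_completion (x n) - U n) \<longlonglongrightarrow> 0"
    by (rule Lim_null_comparison[OF _ LIMSEQ_inverse_real_of_nat])
      (use x in \<open>auto intro!: always_eventually less_imp_le\<close>)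
  have "Cauchy (\<lambda>n. (to_completion (x n) - U n) + U n)"
    by (rule Cauchy_add'[OF LIMSEQ_imp_Cauchy[OF null] U])
  then have "Cauchy (\<lambda>n. to_completion (x n))" by simp
  then have "Cauchy x"
    unfolding Cauchy_def dist_norm by (simp add: norm_to_completion flip: to_completion_diff)
  from tendsto_diff[OF to_completion_tendsto[OF this] null]
  have "U \<longlonglongrightarrow> abs_completion x" by simp
  then show "convergent U" by (rule convergentI)
qed

section \<open>The projective tensor product of Banach spaces\<close>

type_synonym ('a, 'b) proj_tensor = "('a, 'b) alg_tensor completion"

lift_definition alg_tensor_of ::
  "('a::complex_normed_vector \<times> 'b::complex_normed_vector) list \<Rightarrow> ('a, 'b) alg_tensor" is "\<lambda>ps. ps" .

definition tensor :: "'a::complex_normed_vector \<Rightarrow> 'b::complex_normed_vector \<Rightarrow> ('a, 'b) proj_tensor"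
    (infixr \<open>\<otimes>\<close> 70)
  where "x \<otimes> y = to_completion (alg_tensor_of [(x, y)])"

lemma completion_extend:
  fixes f :: "'a::complex_normed_vector \<Rightarrow> 'c::complex_banach"
  assumes f: "bounded_clinear f"
  obtains g where "bounded_clinear g" "\<And>x. g (to_completion x) = f x"
proof -
  have bl: "bounded_linear f" and fc: "\<And>c x. f (c *\<^sub>C x) = c *\<^sub>C f x"
    using f by (auto simp: bounded_clinear_def)
  obtain K where K: "\<And>x. norm (f x) \<le> norm x * K" using bounded_linear.bounded[OF bl] by blast
  define g where "g u = lim (\<lambda>n. f (rep_completion u n))" for u
  have lim: "(\<lambda>n. f (X n)) \<longlonglongrightarrow> g (abs_completion X)" if X: "Cauchy X" for X
  proof -
    have "null_equiv (rep_completion (abs_completion X)) X"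
      using X Quotient3_rep_abs[OF Quotient3_completion] by (simp add: null_equiv_refl)
    from null_equiv_bounded_linear[OF bl this]
    have C: "Cauchy (\<lambda>n. f (X n))" and d: "(\<lambda>n. f (rep_completion (abs_completion X) n) - f (X n)) \<longlonglongrightarrow> 0"
      by (auto simp: null_equiv_def)
    obtain l where l: "(\<lambda>n. f (X n)) \<longlonglongrightarrow> l"
      using C by (auto simp: Cauchy_convergent_iff convergent_def)
    have "(\<lambda>n. f (rep_completion (abs_completion X) n)) \<longlonglongrightarrow> l"
      using tendsto_add[OF d l] by simp
    then show ?thesis using l by (simp add: g_def limI)
  qed
  show ?thesis
  proof
    show "bounded_clinear g"
    proof (rule bounded_clinear_intro)
      fix u v :: "'a completion" and c
      obtain X Y where X: "Cauchy X" "u = abs_completion X" and Y: "Cauchy Y" "v = abs_completion Y"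
        using completion_limit_exists by metis
      have add: "u + v = abs_completion (\<lambda>n. X n + Y n)"
        using X Y by (simp add: plus_completion.abs_eq null_equiv_refl)
      have scale: "c *\<^sub>C u = abs_completion (\<lambda>n. c *\<^sub>C X n)"
        using X by (simp add: scaleC_completion.abs_eq null_equiv_refl)
      show "g (u + v) = g u + g v"
        using lim[OF Cauchy_add'[OF X(1) Y(1)]] tendsto_add[OF lim[OF X(1)] lim[OF Y(1)]]
        unfolding add X(2)[symmetric] Y(2)[symmetric] linear_simps[OF bl] by (rule LIMSEQ_unique)
      show "g (c *\<^sub>C u) = c *\<^sub>C g u"
        using lim[OF Cauchy_bounded_linear[OF bounded_linear_scaleC X(1)], of c]
          bounded_linear.tendsto[OF bounded_linear_scaleC lim[OF X(1)], of c]
        unfolding scale X(2)[symmetric] fc by (rule LIMSEQ_unique)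
      have "(\<lambda>n. norm (X n)) \<longlonglongrightarrow> norm u"
        using tendsto_norm[OF to_completion_tendsto[OF X(1)]] X(2) by simp
      then show "norm (g u) \<le> norm u * K"
        using tendsto_norm[OF lim[OF X(1)]] K unfolding X(2)
        by (intro LIMSEQ_le[OF _ tendsto_mult_right]) auto
    qed
    show "g (to_completion x) = f x" for x
      using lim[of "\<lambda>_. x"] by (simp add: Cauchy_def to_completion.abs_eq LIMSEQ_const_iff)
  qed
qed

lemma bounded_clinear_cblinfun_apply: "bounded_clinear (cblinfun_apply f)"
  by (simp add: bounded_clinear_def bounded_linear_cblinfun_apply cblinfun_scaleC_arg)

lemma form_sum_tensor:
  "to_completion (alg_tensor_of ps) = form_sum (\<otimes>) ps"
proof (induction ps)
  case Nil
  have "to_completion (alg_tensor_of ([] :: ('a \<times> 'b) list)) = 0 *\<^sub>C to_completion (alg_tensor_of [])"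
    unfolding to_completion_scaleC[symmetric]
    by (rule arg_cong[where f = to_completion]) (transfer, simp add: list_scaleC_def)
  then show ?case by simp
next
  case (Cons p ps)
  obtain x y where p: "p = (x, y)" by (cases p)
  have "alg_tensor_of (p # ps) = alg_tensor_of [(x, y)] + alg_tensor_of ps"
    unfolding p by transfer simp
  with Cons show ?case by (simp add: p tensor_def to_completion_add)
qed

lemma norm_form_sum_tensor: "norm (form_sum (\<otimes>) ps) = projective_norm ps"
  unfolding form_sum_tensor[symmetric] norm_to_completion by transfer (rule refl)

lemma tensor_dense:
  assumes "e > 0" obtains ps where "norm (form_sum (\<otimes>) ps - u) < e"
proof -
  obtain t where t: "norm (to_completion t - u) < e" using to_completion_dense[OF assms] .
  obtain ps where "t = alg_tensor_of ps"
    by (metis Quotient3_abs_rep[OF Quotient3_alg_tensor] alg_tensor_of.abs_eq)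
  then show ?thesis using that t by (simp add: form_sum_tensor)
qed

lemma bounded_cbilinear_tensor:
  "bounded_cbilinear ((\<otimes>) :: 'a::complex_normed_vector \<Rightarrow> 'b::complex_normed_vector \<Rightarrow> _)"
proof -
  have "alg_tensor_of [(x + x', y)] = alg_tensor_of [(x, y)] + alg_tensor_of [(x', y)]"
    "alg_tensor_of [(x, y + y')] = alg_tensor_of [(x, y)] + alg_tensor_of [(x, y')]"
    "alg_tensor_of [(c *\<^sub>C x, y)] = c *\<^sub>C alg_tensor_of [(x, y)]"
    "alg_tensor_of [(x, c *\<^sub>C y)] = c *\<^sub>C alg_tensor_of [(x, y)]"
    for x x' :: 'a and y y' :: 'b and c
    by (transfer, simp add: tensor_equiv_def list_scaleC_def cbilinear_simps)+
  then have "cbilinear ((\<otimes>) :: 'a \<Rightarrow> 'b \<Rightarrow> _)"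
    by (simp add: cbilinear_def clinear_iff tensor_def to_completion_add to_completion_scaleC)
  moreover have "norm (x \<otimes> y) \<le> 1 * norm x * norm y" for x :: 'a and y :: 'b
    using projective_norm_le_cost[of "[(x, y)]" "[(x, y)]"]
    unfolding tensor_def norm_to_completion by transfer simp
  ultimately show ?thesis unfolding bounded_cbilinear_def by blast
qed

lemma cblinfun_form_sum:
  "cblinfun_apply L (form_sum B ps) = form_sum (\<lambda>x y. cblinfun_apply L (B x y)) ps"
  by (induction ps) (auto simp: cblinfun.add_right cblinfun.zero_right)

lemma tensor_lift_ex1:
  fixes B :: "'a::complex_banach \<Rightarrow> 'b::complex_banach \<Rightarrow> 'c::complex_banach"
  assumes B: "bounded_cbilinear B"
  shows "\<exists>!L :: ('a, 'b) proj_tensor \<Rightarrow>\<^sub>C\<^sub>L 'c. \<forall>x y. cblinfun_apply L (x \<otimes> y) = B x y"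
proof -
  obtain K where cb: "cbilinear B" and K: "\<And>x y. norm (B x y) \<le> K * norm x * norm y"
    using B by (auto simp: bounded_cbilinear_def)
  define K' where "K' = max K 0"
  have K': "norm (B x y) \<le> K' * norm x * norm y" for x y
    by (rule order_trans[OF K]) (simp add: K'_def mult_right_mono)
  have wd: "form_sum B ps = form_sum B qs" if "tensor_equiv ps qs" for ps qs
  proof (rule ccontr)
    assume "form_sum B ps \<noteq> form_sum B qs"
    then obtain \<phi> :: "'c cdual" where "\<phi> (form_sum B ps - form_sum B qs) \<noteq> 0"
      using cdual_separates[of "form_sum B ps - form_sum B qs"] by auto
    moreover have "cbilinear (\<lambda>x y. \<phi> (B x y))"
      by (simp add: cbilinear_def clinear_iff cbilinear_simps[OF cb] cblinfun.add_right
          cblinfun_scaleC_arg)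
    then have "form_sum (\<lambda>x y. \<phi> (B x y)) ps = form_sum (\<lambda>x y. \<phi> (B x y)) qs"
      using that by (simp add: tensor_equiv_def)
    ultimately show False by (simp add: cblinfun.diff_right cblinfun_form_sum)
  qed
  define f where "f u = form_sum B (rep_alg_tensor u)" for u
  have f: "f (abs_alg_tensor ps) = form_sum B ps" for ps
    unfolding f_def by (rule wd) (rule Quotient3_rep_abs[OF Quotient3_alg_tensor], simp)
  have "bounded_clinear f"
  proof (rule bounded_clinear_intro)
    fix u v :: "('a, 'b) alg_tensor" and c
    obtain ps qs where u: "u = abs_alg_tensor ps" and v: "v = abs_alg_tensor qs"
      by (metis Quotient3_abs_rep[OF Quotient3_alg_tensor])
    show "f (u + v) = f u + f v" by (simp add: u v plus_alg_tensor.abs_eq f)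
    show "f (c *\<^sub>C u) = c *\<^sub>C f u"
      by (simp add: u scaleC_alg_tensor.abs_eq f form_sum_list_scaleC[OF cb])
    show "norm (f u) \<le> norm u * K'"
    proof (rule field_le_epsilon)
      fix e :: real assume e: "e > 0"
      have K0: "K' \<ge> 0" by (simp add: K'_def)
      have e': "e / (K' + 1) > 0" using e K0 by simp
      obtain rs where rs: "tensor_equiv ps rs" "tensor_cost rs < projective_norm ps + e / (K' + 1)"
        using projective_norm_approx[OF e'] .
      have "norm (f u) \<le> K' * tensor_cost rs"
        using form_sum_bound[OF K', of rs] wd[OF rs(1)] by (simp add: u f)
      also have "\<dots> \<le> K' * (projective_norm ps + e / (K' + 1))"
        using rs(2) K0 by (intro mult_left_mono) auto
      also have "\<dots> \<le> norm u * K' + e"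
      proof -
        have "K' * (e / (K' + 1)) \<le> e" using K0 e by (simp add: pos_divide_le_eq algebra_simps)
        then show ?thesis by (simp add: u norm_alg_tensor.abs_eq algebra_simps)
      qed
      finally show "norm (f u) \<le> norm u * K' + e" .
    qed
  qed
  then obtain g where g: "bounded_clinear g" "\<And>u. g (to_completion u) = f u"
    using completion_extend by blast
  show ?thesis
  proof (rule ex1I[of _ "CBlinfun g"])
    show g_tensor: "\<forall>x y. cblinfun_apply (CBlinfun g) (x \<otimes> y) = B x y"
      by (simp add: CBlinfun_apply[OF g(1)] tensor_def g(2) alg_tensor_of.abs_eq f)
    fix L :: "('a, 'b) proj_tensor \<Rightarrow>\<^sub>C\<^sub>L 'c"
    assume L: "\<forall>x y. cblinfun_apply L (x \<otimes> y) = B x y"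
    let ?D = "L - CBlinfun g"
    have "form_sum (\<lambda>x y. ?D (x \<otimes> y)) ps = 0" for ps
      by (induction ps) (auto simp: cblinfun_apply_diff L g_tensor)
    then have D: "?D (form_sum (\<otimes>) ps) = 0" for ps by (simp add: cblinfun_form_sum)
    have "?D u = 0" for u
    proof -
      have "norm (?D u) \<le> 0 + e" if e: "e > 0" for e
      proof -
        have e': "e / (norm ?D + 1) > 0" using e by (simp add: add_nonneg_pos)
        obtain ps where ps: "norm (form_sum (\<otimes>) ps - u) < e / (norm ?D + 1)"
          using tensor_dense[OF e'] .
        have "norm (?D u) = norm (?D (form_sum (\<otimes>) ps - u))"
          unfolding cblinfun.diff_right D by simp
        also have "\<dots> \<le> norm ?D * (e / (norm ?D + 1))"
          using ps by (intro order_trans[OF norm_cblinfun] mult_left_mono) auto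
          also have "\<dots> \<le> e"
        proof -
          have "0 < norm ?D + 1" by (intro add_nonneg_pos) auto
          moreover have "norm ?D * e \<le> e * (norm ?D + 1)" using e by (simp add: algebra_simps)
          ultimately show ?thesis by (simp add: pos_divide_le_eq)
        qed
        finally show ?thesis by simp
      qed
      then have "norm (?D u) \<le> 0" by (rule field_le_epsilon)
      then show ?thesis by simp
    qed
    then show "L = CBlinfun g" by (intro cblinfun_eqI) (simp add: cblinfun_apply_diff)
  qed
qed

definition tensor_lift ::
  "('a::complex_banach \<Rightarrow> 'b::complex_banach \<Rightarrow> 'c::complex_banach) \<Rightarrow>
    ('a, 'b) proj_tensor \<Rightarrow>\<^sub>C\<^sub>L 'c"
  where "tensor_lift B = (THE L. \<forall>x y. cblinfun_apply L (x \<otimes> y) = B x y)"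

lemma tensor_lift_tensor:
  assumes "bounded_cbilinear B"
  shows "cblinfun_apply (tensor_lift B) (x \<otimes> y) = B x y"
  using theI'[OF tensor_lift_ex1[OF assms]] unfolding tensor_lift_def by blast

section \<open>Nuclear and integral operators, and the operator trace\<close>

definition rank_one ::
  "'b::complex_normed_vector \<Rightarrow> 'a::complex_normed_vector cdual \<Rightarrow> 'a \<Rightarrow>\<^sub>C\<^sub>L 'b"
  where "rank_one x f = CBlinfun (\<lambda>\<xi>. f \<xi> *\<^sub>C x)"

lemma rank_one_apply: "cblinfun_apply (rank_one x f) \<xi> = f \<xi> *\<^sub>C x"
proof -
  have "bounded_clinear (\<lambda>\<xi>. f \<xi> *\<^sub>C x)"
  proof (rule bounded_clinear_intro)
    show "norm (f \<xi> *\<^sub>C x) \<le> norm \<xi> * (norm f * norm x)" for \<xi>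
      using mult_right_mono[OF norm_cblinfun[of f \<xi>], of "norm x"]
      by (simp add: norm_scaleC algebra_simps)
  qed (simp_all add: cblinfun.add_right scaleC_add_left cblinfun_scaleC_arg scaleC_complex_def
      scaleC_scaleC)
  then show ?thesis by (simp add: rank_one_def CBlinfun_apply)
qed

lemma bounded_cbilinear_rank_one:
  "bounded_cbilinear
    (rank_one :: 'b::complex_normed_vector \<Rightarrow> 'a::complex_normed_vector cdual \<Rightarrow> _)"
proof -
  have "cbilinear (rank_one :: 'b \<Rightarrow> 'a cdual \<Rightarrow> _)"
    by (auto simp: cbilinear_def clinear_iff rank_one_apply cblinfun_apply_add cblinfun_apply_scaleC
        scaleC_add_right scaleC_add_left scaleC_scaleC scaleC_complex_def mult.commute
        intro!: cblinfun_eqI)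
  moreover have "norm (rank_one x f) \<le> 1 * norm x * norm f" for x :: 'b and f :: "'a cdual"
  proof (rule norm_cblinfun_bound)
    show "norm (cblinfun_apply (rank_one x f) \<xi>) \<le> 1 * norm x * norm f * norm \<xi>" for \<xi>
      using mult_right_mono[OF norm_cblinfun[of f \<xi>], of "norm x"]
      by (simp add: rank_one_apply norm_scaleC algebra_simps)
  qed simp
  ultimately show ?thesis unfolding bounded_cbilinear_def by blast
qed

definition operator_trace ::
  "('a::complex_banach, 'a cdual) proj_tensor \<Rightarrow>\<^sub>C\<^sub>L ('a \<Rightarrow>\<^sub>C\<^sub>L 'a)"
  where "operator_trace = tensor_lift rank_one"

lemma operator_trace_tensor: "operator_trace (x \<otimes> f) \<xi> = f \<xi> *\<^sub>C x"
  by (simp add: operator_trace_def tensor_lift_tensor[OF bounded_cbilinear_rank_one] rank_one_apply)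

definition nuclear_operators ::
  "('a::complex_normed_vector \<Rightarrow>\<^sub>C\<^sub>L 'b::complex_normed_vector) set"
  where "nuclear_operators = {T. \<exists>(f :: nat \<Rightarrow> 'a cdual) (x :: nat \<Rightarrow> 'b).
    summable (\<lambda>n. norm (f n) * norm (x n)) \<and> (\<forall>\<xi>. (\<lambda>n. cblinfun_apply (f n) \<xi> *\<^sub>C x n) sums cblinfun_apply T \<xi>)}"

definition kernel :: "('a::complex_normed_vector \<Rightarrow>\<^sub>C\<^sub>L 'b::complex_normed_vector) \<Rightarrow> 'a set"
  where "kernel T = {x. cblinfun_apply T x = 0}"

definition injective_norm ::
  "('a::complex_normed_vector \<times> 'b::complex_normed_vector) list \<Rightarrow> real"
  where "injective_norm ps = Sup {cmod (form_sum (\<lambda>x y. cblinfun_apply \<phi> x * cblinfun_apply \<psi> y) ps) |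
    (\<phi> :: 'a cdual) (\<psi> :: 'b cdual). norm \<phi> \<le> 1 \<and> norm \<psi> \<le> 1}"

text \<open>
  \<open>T\<close> is integral iff \<open>(x, g) \<mapsto> g (T x)\<close> extends to a bounded functional on the injective
  tensor product of the domain and the dual of the codomain.
\<close>

definition integral_operators ::
  "('a::complex_normed_vector \<Rightarrow>\<^sub>C\<^sub>L 'b::complex_normed_vector) set"
  where "integral_operators = {T. \<exists>C. \<forall>ps :: ('a \<times> 'b cdual) list.
    cmod (form_sum (\<lambda>x g. cblinfun_apply g (cblinfun_apply T x)) ps) \<le> C * injective_norm ps}"

section \<open>Self-induced and weakly amenable Banach algebras\<close>

text \<open>
  For a right action \<open>ra\<close> and a left action \<open>la\<close>, \<open>module_tensor ra la\<close> is the balanced projective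
  tensor product, as the set of cosets of \<open>balanced_subspace ra la\<close>.
\<close>

definition balanced_subspace ::
  "('e::complex_banach \<Rightarrow> 'a \<Rightarrow> 'e) \<Rightarrow> ('a \<Rightarrow> 'f::complex_banach \<Rightarrow> 'f) \<Rightarrow> ('e, 'f) proj_tensor set"
  where "balanced_subspace ra la =
    closure (complex_vector.span {ra e a \<otimes> f - e \<otimes> la a f | e a f. True})"

definition quotient_space :: "'a::complex_banach set \<Rightarrow> 'a set set"
  where "quotient_space N = range (\<lambda>u. (+) u ` N)"

definition quotient_norm :: "'a::complex_banach set \<Rightarrow> real"
  where "quotient_norm q = Inf (norm ` q)"

definition module_tensor ::
  "('e::complex_banach \<Rightarrow> 'a \<Rightarrow> 'e) \<Rightarrow> ('a \<Rightarrow> 'f::complex_banach \<Rightarrow> 'f) \<Rightarrow>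
    ('e, 'f) proj_tensor set set"
  where "module_tensor ra la = quotient_space (balanced_subspace ra la)"

text \<open>The value on a coset of the map that \<open>L\<close> induces on the quotient by a subspace of its kernel.\<close>

definition induced_map ::
  "('a::complex_banach \<Rightarrow>\<^sub>C\<^sub>L 'b::complex_banach) \<Rightarrow> 'a set \<Rightarrow> 'b"
  where "induced_map L q = the_elem (cblinfun_apply L ` q)"

definition multiplication_map ::
  "('a::complex_banach_algebra, 'a) proj_tensor \<Rightarrow>\<^sub>C\<^sub>L 'a"
  where "multiplication_map = tensor_lift (*)"

text \<open>The induced map is linear, so it is an isomorphism iff it is bijective and bounded both ways.\<close>

definition self_induced :: "'a::complex_banach_algebra itself \<Rightarrow> bool"
  where "self_induced _ \<longleftrightarrow>
    (let Q = module_tensor (*) (*); m = induced_map (multiplication_map :: ('a, 'a) proj_tensor \<Rightarrow>\<^sub>C\<^sub>L 'a)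
     in bij_betw m Q UNIV \<and>
        (\<exists>C. \<forall>q\<in>Q. norm (m q) \<le> C * quotient_norm q) \<and>
        (\<exists>C. \<forall>q\<in>Q. quotient_norm q \<le> C * norm (m q)))"

lemma bounded_cbilinear_times: "bounded_cbilinear ((*) :: 'a::complex_banach_algebra \<Rightarrow> 'a \<Rightarrow> 'a)"
  unfolding bounded_cbilinear_def cbilinear_def clinear_iff
  by (auto simp: algebra_simps mult_scaleC_left mult_scaleC_right norm_mult_ineq intro!: exI[of _ 1])

lemma multiplication_map_tensor: "multiplication_map (a \<otimes> b) = a * b"
  by (simp add: multiplication_map_def tensor_lift_tensor[OF bounded_cbilinear_times])

lemma balanced_subspace_le_kernel:
  "balanced_subspace (*) (*) \<subseteq> kernel (multiplication_map :: ('a::complex_banach_algebra, 'a) proj_tensor \<Rightarrow>\<^sub>C\<^sub>L 'a)"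
proof -
  have "closed (kernel (multiplication_map :: ('a, 'a) proj_tensor \<Rightarrow>\<^sub>C\<^sub>L 'a))"
    unfolding kernel_def
    by (intro closed_Collect_eq continuous_intros linear_continuous_on bounded_linear_cblinfun_apply)
  moreover have "complex_vector.span {(a * b) \<otimes> c - a \<otimes> (b * c) | a b c :: 'a. True}
      \<subseteq> kernel multiplication_map"
  proof (rule complex_vector.span_minimal)
    show "{(a * b) \<otimes> c - a \<otimes> (b * c) | a b c :: 'a. True} \<subseteq> kernel multiplication_map"
      by (auto simp: kernel_def cblinfun.diff_right multiplication_map_tensor mult.assoc)
    show "complex_vector.subspace (kernel (multiplication_map :: ('a, 'a) proj_tensor \<Rightarrow>\<^sub>C\<^sub>L 'a))"
      by (auto simp: complex_vector.subspace_def kernel_def cblinfun.zero_right cblinfun.add_right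
          cblinfun_scaleC_arg)
  qed
  ultimately show ?thesis unfolding balanced_subspace_def by (intro closure_minimal)
qed

lemma induced_map_coset:
  assumes "N \<subseteq> kernel L" "0 \<in> N"
  shows "induced_map L ((+) u ` N) = L u"
proof -
  have "cblinfun_apply L ` (+) u ` N = {L u}"
    using assms by (force simp: kernel_def cblinfun.add_right)
  then show ?thesis by (simp add: induced_map_def)
qed

definition dual_lact :: "'a::complex_banach_algebra \<Rightarrow> 'a cdual \<Rightarrow> 'a cdual"
  where "dual_lact a \<phi> = CBlinfun (\<lambda>b. \<phi> (b * a))"

definition dual_ract :: "'a::complex_banach_algebra cdual \<Rightarrow> 'a \<Rightarrow> 'a cdual"
  where "dual_ract \<phi> a = CBlinfun (\<lambda>b. \<phi> (a * b))"

lemma dual_lact_apply: "dual_lact a \<phi> b = \<phi> (b * a)"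
  and dual_ract_apply: "dual_ract \<phi> a b = \<phi> (a * b)"
proof -
  have bound: "norm (\<phi> c) \<le> norm b * (norm \<phi> * norm a)" if "norm c \<le> norm a * norm b" for b c
    using order_trans[OF norm_cblinfun[of \<phi> c] mult_left_mono[OF that norm_ge_zero[of \<phi>]]]
    by (simp add: algebra_simps)
  have "bounded_clinear (\<lambda>b. \<phi> (b * a))" "bounded_clinear (\<lambda>b. \<phi> (a * b))"
    by (rule bounded_clinear_intro[where K = "norm \<phi> * norm a"];
        simp add: algebra_simps cblinfun.add_right mult_scaleC_left mult_scaleC_right
          cblinfun_scaleC_arg bound[unfolded mult.commute[of "norm \<phi>"]] norm_mult_ineq
          norm_mult_ineq[THEN order_trans])+
  then show "dual_lact a \<phi> b = \<phi> (b * a)" "dual_ract \<phi> a b = \<phi> (a * b)"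
    by (simp_all add: dual_lact_def dual_ract_def CBlinfun_apply)
qed

definition derivation :: "('a::complex_banach_algebra \<Rightarrow>\<^sub>C\<^sub>L 'a cdual) \<Rightarrow> bool"
  where "derivation D \<longleftrightarrow> (\<forall>a b. D (a * b) = dual_lact a (D b) + dual_ract (D a) b)"

definition inner_derivation :: "('a::complex_banach_algebra \<Rightarrow>\<^sub>C\<^sub>L 'a cdual) \<Rightarrow> bool"
  where "inner_derivation D \<longleftrightarrow> (\<exists>\<phi>. \<forall>a. D a = dual_lact a \<phi> - dual_ract \<phi> a)"

definition weakly_amenable :: "'a::complex_banach_algebra itself \<Rightarrow> bool"
  where "weakly_amenable _ \<longleftrightarrow>
    (\<forall>D :: 'a \<Rightarrow>\<^sub>C\<^sub>L 'a cdual. derivation D \<longrightarrow> inner_derivation D)"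

end

theory Submission
  imports Defs
begin

text \<open>
  Write \<open>A\<close> for the algebra of approximable operators and \<open>P = X \<otimes> X\<^sup>*\<close> for the projective tensor product,
  whose dual is the space of operators on \<open>X\<^sup>*\<close>. If \<open>A\<close> is not self-induced, some balanced bilinear
  functional \<open>\<beta>\<close> on \<open>A\<close> is not of the form \<open>\<psi> (a * b)\<close>. The map \<open>a \<mapsto> \<beta> a \<sqdot> - \<beta> \<sqdot> a\<close> is a derivation; if it is
  inner, then subtracting a functional of the product makes \<open>\<beta>\<close> symmetric, hence a nonzero multiple of the
  trace of \<open>a * b\<close>. Boundedness of this trace form makes multiplication bounded as a map from \<open>A \<times> A\<close>
  to \<open>P\<close>, so that every functional on \<open>P\<close> gives a balanced functional on \<open>A\<close> and hence equals
  \<open>\<psi> \<circ> Tr + \<mu> tr\<close>. By duality \<open>P\<close> is isomorphic to \<open>A \<oplus> \<complex>\<close> via \<open>(Tr, tr)\<close>, which is (a) and (b).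

  Conversely, if the kernel of \<open>Tr\<close> is spanned by \<open>k\<close> and \<open>Tr\<close> is onto, then \<open>tr k \<noteq> 0\<close>, for otherwise
  \<open>tr\<close> would be bounded in the operator norm and \<open>Tr\<close> injective. So again every functional on
  \<open>P\<close> is \<open>\<psi> \<circ> Tr + \<mu> tr\<close>. Derivations of \<open>A\<close> come from functionals on \<open>P\<close>, where \<open>tr\<close> contributes nothing;
  and operators on \<open>X\<close> and \<open>X\<^sup>*\<close> are functionals on \<open>P\<close>, where \<open>\<psi>\<close> corresponds to an integral operator and
  \<open>tr\<close> to the identity. A multiple of the identity of a subspace that is a restriction of an integral
  operator forces the subspace to be finite dimensional, whence indecomposability.
\<close>

section \<open>The Hahn--Banach theorem\<close>

text \<open>The obstacle is that \<open>Tr\<close> may have a kernel, so neither the trace nor a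
  general functional on P descends to A. Functionals on P are therefore written as operators
  \<open>T\<close> on the dual of X that act on the second factors of a tensor. Such a
  \<open>T\<close> need not be an adjoint, but replacing each \<open>y \<otimes> g\<close> by
  \<open>y \<otimes> T g\<close> multiplies the operator norm by at most \<open>norm T\<close>,
  because the adjoint of the new operator is \<open>T\<close> after the adjoint of the old one.
  Hence an estimate of the single functional \<open>tr\<close> by operator norms turns into an
  estimate of the whole projective norm. This is why one bounded trace form lets the multiplication
  of A take values in P. The vector spanning the kernel is a limit of tensors of trace 1 whose
  operator norms tend to 0. They exist because failure of self-inducedness makes \<open>tr\<close>
  unbounded in the operator norm, and they converge because the projective norm is dominated by the
  norms of the two traces together. For (d), projections on the dual of X need not be adjoints
  either; finite dimension is obtained there by counting orthonormal families of functionals on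
  finite sets of evaluation points.\<close>

lemma norm_sublinear_dominates_linear:
  fixes p0 :: "'a::real_normed_vector \<Rightarrow> real"
  assumes "norm_sublinear p0"
  obtains p where "bounded_linear p" "\<And>x. p x \<le> p0 x" "\<And>x. \<bar>p x\<bar> \<le> norm x"
proof -
  obtain p where p: "norm_sublinear p" "p \<le> p0"
    and min: "\<And>q. norm_sublinear q \<Longrightarrow> q \<le> p \<Longrightarrow> q = p"
    using norm_sublinear_minimal[OF assms] by blast
  have add: "p (u + v) = p u + p v" for u v
  proof (rule antisym)
    show "p (u + v) \<le> p u + p v" using p by (simp add: norm_sublinear_def)
    note s = norm_sublinear_step[OF p(1), where y = v]
    have "(\<lambda>x. INF t\<in>{0..}. p (x + t *\<^sub>R v) - t * p v) = p"
      using s(1,2) by (intro min) (auto simp: le_fun_def)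
    then show "p u + p v \<le> p (u + v)" using s(3)[of u] by (simp add: fun_eq_iff)
  qed
  have neg: "p (- x) = - p x" for x
    using add[of x "- x"] norm_sublinear_zero[OF p(1)] by simp
  have scale: "p (r *\<^sub>R x) = r * p x" for r x
  proof (cases "r \<ge> 0")
    case False
    then have "p ((- r) *\<^sub>R x) = - r * p x" by (intro norm_sublinear_scale[OF p(1)]) simp
    then show ?thesis using neg[of "r *\<^sub>R x"] by simp
  qed (simp add: norm_sublinear_scale[OF p(1)])
  have bound: "\<bar>p x\<bar> \<le> norm x" for x
    using p(1) norm_sublinear_lower[OF p(1), of x] unfolding norm_sublinear_def by (smt (verit))
  then have "bounded_linear p"
    by (intro bounded_linear_intro[where K = 1]) (simp_all add: add scale)
  then show ?thesis using that p(2) bound by (simp add: le_fun_def)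
qed

text \<open>The infimal convolution of the prescribed functional with the norm is sublinear and is
  at most \<open>r\<close> at \<open>y\<close> for every \<open>(y, r)\<close> in \<open>G\<close>.
  A linear \<open>p\<close> below it has \<open>p y \<le> r\<close>, and the same at
  \<open>(- y, - r)\<close> gives equality.\<close>

lemma norm_dominated_extension:
  fixes G :: "('a::real_normed_vector \<times> real) set"
  assumes G: "subspace G" and le: "\<And>y r. (y, r) \<in> G \<Longrightarrow> r \<le> norm y"
  obtains p where "bounded_linear p" "\<And>x. \<bar>p x\<bar> \<le> norm x" "\<And>y r. (y, r) \<in> G \<Longrightarrow> p y = r"
proof -
  define q where "q x = (INF g\<in>G. snd g + norm (x - fst g))" for x
  have neg: "(- y, - r) \<in> G" if "(y, r) \<in> G" for y r
    using subspace_neg[OF G that] by simp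
  have lower: "- norm x \<le> snd g + norm (x - fst g)" if "g \<in> G" for g x
    using le[OF neg[of "fst g" "snd g"]] that norm_triangle_ineq2[of "fst g" x]
    by (simp add: norm_minus_commute)
  have bdd: "bdd_below ((\<lambda>g. snd g + norm (x - fst g)) ` G)" for x
    using lower by (intro bdd_belowI2[where m = "- norm x"])
  have upper: "q x \<le> snd g + norm (x - fst g)" if "g \<in> G" for x g
    unfolding q_def using that by (intro cINF_lower bdd)
  have z: "0 \<in> G" using G by (rule subspace_0)
  then have greatest: "a \<le> q x" if "\<And>g. g \<in> G \<Longrightarrow> a \<le> snd g + norm (x - fst g)" for a x
    unfolding q_def using that by (intro cINF_greatest) auto
  have "norm_sublinear q"
    unfolding norm_sublinear_def
  proof (intro conjI allI impI)
    fix x y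
    have two: "q (x + y) \<le> (snd g + norm (x - fst g)) + (snd h + norm (y - fst h))"
      if "g \<in> G" "h \<in> G" for g h
      using upper[OF subspace_add[OF G that], of "x + y"]
        norm_triangle_ineq[of "x - fst g" "y - fst h"] by (simp add: algebra_simps)
    have "q (x + y) - (snd h + norm (y - fst h)) \<le> q x" if "h \<in> G" for h
      using two[OF _ that] by (intro greatest) (simp add: algebra_simps)
    then have "q (x + y) - q x \<le> q y" by (intro greatest) (simp add: algebra_simps)
    then show "q (x + y) \<le> q x + q y" by simp
  next
    fix s :: real and x assume s: "s > 0"
    have "inverse s * q (s *\<^sub>R x) \<le> snd g + norm (x - fst g)" if "g \<in> G" for g
    proof -
      have "q (s *\<^sub>R x) \<le> s * snd g + norm (s *\<^sub>R x - s *\<^sub>R fst g)"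
        using upper[OF subspace_scale[OF G that, of s], of "s *\<^sub>R x"] by simp
      also have "\<dots> = s * (snd g + norm (x - fst g))"
        using s by (simp add: algebra_simps flip: scaleR_diff_right)
      finally show ?thesis using s by (simp add: field_simps)
    qed
    then have "inverse s * q (s *\<^sub>R x) \<le> q x" by (rule greatest)
    then show "q (s *\<^sub>R x) \<le> s * q x" using s by (simp add: field_simps)
  next
    show "q x \<le> norm x" for x using upper[OF z, of x] by simp
  qed
  then obtain p where p: "bounded_linear p" "\<And>x. p x \<le> q x" "\<And>x. \<bar>p x\<bar> \<le> norm x"
    by (rule norm_sublinear_dominates_linear) blast
  have ub: "p y \<le> r" if "(y, r) \<in> G" for y r
    using p(2)[of y] upper[OF that, of y] by simp
  have "p y = r" if "(y, r) \<in> G" for y r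
    using ub[OF that] ub[OF neg[OF that]] bounded_linear.linear[OF p(1)] by (simp add: linear_neg)
  with p show ?thesis by (intro that)
qed

text \<open>The constant stays sharp: rotating \<open>x\<close> by a unimodular number makes the
  complex value real, hence equal to a value of \<open>p\<close>, so that no factor 2 arises from
  bounding real and imaginary parts separately.\<close>

lemma complexify_functional:
  fixes p :: "'a::complex_normed_vector \<Rightarrow> real"
  assumes p: "bounded_linear p" and K: "\<And>x. \<bar>p x\<bar> \<le> K * norm x"
  obtains \<phi> :: "'a cdual" where "\<And>x. Re (\<phi> x) = p x" "\<And>x. cmod (\<phi> x) \<le> K * norm x"
proof -
  interpret p: bounded_linear p by fact
  define g where "g x = Complex (p x) (- p (\<i> *\<^sub>C x))" for x
  have add: "g (x + x') = g x + g x'" for x x'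
    by (simp add: g_def p.add scaleC_add_right complex_eq_iff)
  have mult: "c *\<^sub>C x = Re c *\<^sub>R x + Im c *\<^sub>R (\<i> *\<^sub>C x)" for c and x :: 'a
    by (simp add: scaleR_eq_scaleC scaleC_scaleC flip: scaleC_add_left)
      (metis complex_eq mult.commute)
  have scale: "g (c *\<^sub>C x) = c *\<^sub>C g x" for c x
  proof -
    have "\<i> *\<^sub>C c *\<^sub>C x = Re c *\<^sub>R (\<i> *\<^sub>C x) - Im c *\<^sub>R x"
      using mult[of "\<i> * c" x] by (simp add: scaleC_scaleC)
    then have "p (\<i> *\<^sub>C c *\<^sub>C x) = Re c * p (\<i> *\<^sub>C x) - Im c * p x"
      by (simp add: p.diff p.scaleR)
    moreover have "p (c *\<^sub>C x) = Re c * p x + Im c * p (\<i> *\<^sub>C x)"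
      by (subst mult) (simp add: p.add p.scaleR)
    ultimately show ?thesis by (simp add: g_def scaleC_complex_def complex_eq_iff)
  qed
  have bound: "cmod (g x) \<le> K * norm x" for x
  proof (cases "g x = 0")
    case True
    then show ?thesis using K[of x] by simp
  next
    case False
    define c where "c = cnj (g x) / cmod (g x)"
    have "g (c *\<^sub>C x) = cmod (g x)"
      using False complex_norm_square[of "g x"]
      by (simp add: scale scaleC_complex_def c_def field_simps power2_eq_square)
    then have "cmod (g x) = p (c *\<^sub>C x)" by (metis g_def Re_complex_of_real complex.sel(1))
    also have "\<dots> \<le> K * norm (c *\<^sub>C x)" using K[of "c *\<^sub>C x"] by simp
    also have "norm (c *\<^sub>C x) = norm x" using False by (simp add: norm_scaleC c_def norm_divide)
    finally show ?thesis .
  qed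
  have "bounded_clinear g"
    by (rule bounded_clinear_intro[where K = K])
      (use bound in \<open>simp_all add: add scale mult.commute\<close>)
  then show ?thesis
    using bound by (intro that[of "CBlinfun g"]) (simp_all add: CBlinfun_apply g_def)
qed

text \<open>
  Partially defined linear maps are represented by their graphs; single-valuedness follows from a
  norm bound.
\<close>

definition linear_graph :: "('a::complex_normed_vector \<times> 'b::complex_normed_vector) set \<Rightarrow> bool"
  where "linear_graph G \<longleftrightarrow> (0, 0) \<in> G \<and>
    (\<forall>a v b w. (a, v) \<in> G \<longrightarrow> (b, w) \<in> G \<longrightarrow> (a + b, v + w) \<in> G) \<and>
    (\<forall>c a v. (a, v) \<in> G \<longrightarrow> (c *\<^sub>C a, c *\<^sub>C v) \<in> G)"

lemma linear_graph_diff: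
  assumes "linear_graph G" "(a, v) \<in> G" "(b, w) \<in> G"
  shows "(a - b, v - w) \<in> G"
proof -
  have "((-1) *\<^sub>C b, (-1) *\<^sub>C w) \<in> G" using assms unfolding linear_graph_def by blast
  then have "(a + (-1) *\<^sub>C b, v + (-1) *\<^sub>C w) \<in> G" using assms unfolding linear_graph_def by blast
  then show ?thesis by simp
qed

text \<open>The real parts, divided by \<open>K\<close>, are extended below the norm; invariance of
  \<open>G\<close> under multiplication by \<open>\<i>\<close> then settles the imaginary parts of
  the complexified extension. The absolute value in the conclusion accounts for
  \<open>K \<le> 0\<close>, where all prescribed values vanish.\<close>

theorem hahn_banach_graph:
  fixes G :: "('a::complex_normed_vector \<times> complex) set"
  assumes G: "linear_graph G" and bound: "\<And>y c. (y, c) \<in> G \<Longrightarrow> cmod c \<le> K * norm y"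
  obtains \<phi> :: "'a cdual" where "\<And>y c. (y, c) \<in> G \<Longrightarrow> \<phi> y = c" "\<And>x. cmod (\<phi> x) \<le> \<bar>K\<bar> * norm x"
proof (cases "K > 0")
  case False
  have "c = 0" if "(y, c) \<in> G" for y c
    using bound[OF that] False mult_nonpos_nonneg[of K "norm y"] by (smt (verit) norm_ge_zero norm_le_zero_iff)
  then show ?thesis by (intro that[of 0]) auto
next
  case K: True
  define G' where "G' = {(y, Re c / K) | y c. (y, c) \<in> G}"
  have sub: "subspace G'"
    unfolding subspace_def
  proof (intro conjI ballI allI)
    show "0 \<in> G'" using G unfolding G'_def linear_graph_def by (force simp: zero_prod_def)
    show "x + y \<in> G'" if xy: "x \<in> G'" "y \<in> G'" for x y
    proof -
      obtain a c b d where "x = (a, Re c / K)" "(a, c) \<in> G" "y = (b, Re d / K)" "(b, d) \<in> G"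
        using xy unfolding G'_def by auto
      then show ?thesis
        using G unfolding G'_def linear_graph_def
        by (auto simp: add_divide_distrib intro!: exI[of _ "c + d"])
    qed
    show "r *\<^sub>R x \<in> G'" if x: "x \<in> G'" for r x
    proof -
      obtain a c where "x = (a, Re c / K)" "(a, c) \<in> G" using x unfolding G'_def by auto
      then have "(complex_of_real r *\<^sub>C a, complex_of_real r *\<^sub>C c) \<in> G"
        using G unfolding linear_graph_def by blast
      then show ?thesis
        using \<open>x = _\<close> unfolding G'_def
        by (auto simp: scaleR_eq_scaleC scaleC_complex_def intro!: exI[of _ "complex_of_real r * c"])
    qed
  qed
  have le: "r \<le> norm y" if "(y, r) \<in> G'" for y r
  proof -
    obtain c where c: "(y, c) \<in> G" "r = Re c / K" using \<open>(y, r) \<in> G'\<close> unfolding G'_def by auto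
    have "Re c \<le> K * norm y" using bound[OF c(1)] complex_Re_le_cmod[of c] by linarith
    then show ?thesis using K unfolding c(2) by (simp add: pos_divide_le_eq mult.commute)
  qed
  obtain p where p: "bounded_linear p" "\<And>x. \<bar>p x\<bar> \<le> norm x"
    "\<And>y r. (y, r) \<in> G' \<Longrightarrow> p y = r"
    using norm_dominated_extension[OF sub le] by metis
  have "bounded_linear (\<lambda>x. K * p x)" using p(1) by (rule bounded_linear_const_mult)
  moreover have "\<bar>K * p x\<bar> \<le> K * norm x" for x using p(2)[of x] K by (simp add: abs_mult)
  ultimately obtain \<phi> :: "'a cdual" where \<phi>: "\<And>x. Re (\<phi> x) = K * p x" "\<And>x. cmod (\<phi> x) \<le> K * norm x"
    by (rule complexify_functional) blast
  have Re: "Re (\<phi> y) = Re c" if "(y, c) \<in> G" for y c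
  proof -
    have "(y, Re c / K) \<in> G'" unfolding G'_def using that by blast
    from p(3)[OF this] show ?thesis using K by (simp add: \<phi>(1))
  qed
  have "\<phi> y = c" if "(y, c) \<in> G" for y c
  proof (rule complex_eqI)
    have "(\<i> *\<^sub>C y, \<i> *\<^sub>C c) \<in> G" using G that unfolding linear_graph_def by blast
    from Re[OF this] show "Im (\<phi> y) = Im c" by (simp add: cblinfun_scaleC_arg scaleC_complex_def)
  qed (rule Re[OF that])
  then show ?thesis using K \<phi>(2) by (intro that[of \<phi>]) auto
qed

text \<open>The bound makes \<open>L u \<mapsto> \<phi> u\<close> well defined and bounded on the
  range of \<open>L\<close>; as this range may fail to be dense, the extension comes from
  Hahn-Banach and not from continuity.\<close>

lemma functional_factors_through:
  fixes L :: "'a::complex_normed_vector \<Rightarrow>\<^sub>C\<^sub>L 'b::complex_normed_vector" and \<phi> :: "'a cdual"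
  assumes bound: "\<And>u. cmod (\<phi> u) \<le> C * norm (L u)"
  shows "\<exists>\<psi> :: 'b cdual. \<phi> = \<psi> o\<^sub>C\<^sub>L L"
proof -
  define G where "G = range (\<lambda>u. (L u, \<phi> u))"
  have lin: "linear_graph G"
    unfolding linear_graph_def
  proof (intro conjI allI impI)
    show "(0, 0) \<in> G" unfolding G_def by (rule range_eqI[of _ _ 0]) (simp add: cblinfun.zero_right)
    fix a v b w c assume "(a, v) \<in> G"
    then obtain u where u: "a = L u" "v = \<phi> u" unfolding G_def by blast
    show "(c *\<^sub>C a, c *\<^sub>C v) \<in> G"
      unfolding G_def by (rule range_eqI[of _ _ "c *\<^sub>C u"]) (simp add: u cblinfun_scaleC_arg)
    assume "(b, w) \<in> G"
    then obtain u' where u': "b = L u'" "w = \<phi> u'" unfolding G_def by blast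
    show "(a + b, v + w) \<in> G"
      unfolding G_def by (rule range_eqI[of _ _ "u + u'"]) (simp add: u u' cblinfun.add_right)
  qed
  have b: "cmod c \<le> C * norm a" if "(a, c) \<in> G" for a c using that bound by (auto simp: G_def)
  obtain \<psi> :: "'b cdual" where \<psi>: "\<And>a c. (a, c) \<in> G \<Longrightarrow> \<psi> a = c"
    using hahn_banach_graph[OF lin b] by metis
  have "\<psi> (L u) = \<phi> u" for u by (rule \<psi>) (simp add: G_def)
  then have "\<phi> = \<psi> o\<^sub>C\<^sub>L L" by (intro cblinfun_eqI) simp
  then show ?thesis by blast
qed

lemma functional_distance:
  fixes u :: "'a::complex_normed_vector"
  assumes N: "complex_vector.subspace N" and d: "\<And>n. n \<in> N \<Longrightarrow> d \<le> norm (u - n)" "d \<ge> 0"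
  obtains \<phi> :: "'a cdual" where "norm \<phi> \<le> 1" "\<And>n. n \<in> N \<Longrightarrow> \<phi> n = 0" "\<phi> u = d"
proof -
  define G where "G = {(n + t *\<^sub>C u, t * d) | n t. n \<in> N}"
  have lin: "linear_graph G"
    unfolding linear_graph_def
  proof (intro conjI allI impI)
    show "(0, 0) \<in> G"
      unfolding G_def using complex_vector.subspace_0[OF N] by (auto intro!: exI[of _ 0])
    fix a v b w c assume "(a, v) \<in> G"
    then obtain n t where nt: "a = n + t *\<^sub>C u" "v = t * d" "n \<in> N" unfolding G_def by auto
    show "(c *\<^sub>C a, c *\<^sub>C v) \<in> G"
      unfolding G_def using nt complex_vector.subspace_scale[OF N nt(3), of c]
      by (auto simp: scaleC_add_right scaleC_scaleC scaleC_complex_def intro!: exI[of _ "c *\<^sub>C n"] exI[of _ "c * t"])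
    assume "(b, w) \<in> G"
    then obtain m s where ms: "b = m + s *\<^sub>C u" "w = s * d" "m \<in> N" unfolding G_def by auto
    show "(a + b, v + w) \<in> G"
      unfolding G_def using nt ms complex_vector.subspace_add[OF N nt(3) ms(3)]
      by (auto simp: scaleC_add_left algebra_simps intro!: exI[of _ "n + m"] exI[of _ "t + s"])
  qed
  have bound: "cmod c \<le> 1 * norm y" if "(y, c) \<in> G" for y c
  proof -
    obtain n t where nt: "y = n + t *\<^sub>C u" "c = t * d" "n \<in> N" using \<open>(y, c) \<in> G\<close> unfolding G_def by auto
    show ?thesis
    proof (cases "t = 0")
      case False
      have "d \<le> norm (u - (- inverse t) *\<^sub>C n)"
        by (intro d complex_vector.subspace_scale[OF N nt(3)])
      then have "cmod t * d \<le> norm (t *\<^sub>C (u - (- inverse t) *\<^sub>C n))"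
        by (simp add: norm_scaleC mult_left_mono)
      also have "t *\<^sub>C (u - (- inverse t) *\<^sub>C n) = y"
        using False by (simp add: nt(1) scaleC_add_right scaleC_scaleC)
      finally show ?thesis using d(2) by (simp add: nt(2) norm_mult)
    qed (simp add: nt)
  qed
  obtain \<phi> :: "'a cdual" where \<phi>: "\<And>y c. (y, c) \<in> G \<Longrightarrow> \<phi> y = c" "\<And>x. cmod (\<phi> x) \<le> \<bar>1\<bar> * norm x"
    using hahn_banach_graph[OF lin bound] by metis
  show ?thesis
  proof (rule that[of \<phi>])
    show "\<phi> n = 0" if "n \<in> N" for n
      using that \<phi>(1)[of n 0] unfolding G_def by force
    show "\<phi> u = d"
      using complex_vector.subspace_0[OF N] by (intro \<phi>(1)) (auto simp: G_def intro!: exI[of _ 0] exI[of _ 1])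
    show "norm \<phi> \<le> 1" by (rule norm_cblinfun_bound) (use \<phi>(2) in simp_all)
  qed
qed

lemma norming_functional:
  fixes u :: "'a::complex_normed_vector"
  obtains \<phi> :: "'a cdual" where "norm \<phi> \<le> 1" "\<phi> u = norm u"
  by (rule functional_distance[of "{0}" "norm u" u])
    (auto simp: complex_vector.subspace_def)

lemma norm_le_functionals:
  fixes u :: "'a::complex_normed_vector"
  assumes "\<And>\<phi> :: 'a cdual. norm \<phi> \<le> 1 \<Longrightarrow> cmod (cblinfun_apply \<phi> u) \<le> B"
  shows "norm u \<le> B"
  by (rule norming_functional[of u]) (use assms in force)

lemma functional_vanishing_on_subspace:
  fixes u :: "'a::complex_normed_vector"
  assumes N: "complex_vector.subspace N" "closed N" and u: "u \<notin> N"
  obtains \<phi> :: "'a cdual" where "\<And>n. n \<in> N \<Longrightarrow> \<phi> n = 0" "\<phi> u \<noteq> 0"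
proof -
  obtain e where e: "e > 0" "ball u e \<subseteq> - N"
    using N(2) u by (metis ComplI open_Compl open_contains_ball)
  have "e \<le> norm (u - n)" if "n \<in> N" for n
    using e(2) that by (metis ComplD dist_norm in_mono linorder_not_less mem_ball)
  then obtain \<phi> :: "'a cdual" where "\<And>n. n \<in> N \<Longrightarrow> \<phi> n = 0" "\<phi> u = e"
    using functional_distance[OF N(1), of e u] e(1) by (metis less_imp_le)
  with e(1) show ?thesis by (intro that) auto
qed

text \<open>The closure of \<open>G\<close> is the graph of the extension: the bound survives limits
  and makes it single valued, while density and completeness of the codomain make it total.\<close>

lemma linear_graph_extension:
  fixes G :: "('a::complex_normed_vector \<times> 'b::complex_banach) set"
  assumes G: "linear_graph G" and bound: "\<And>a v. (a, v) \<in> G \<Longrightarrow> norm v \<le> K * norm a"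
    and dense: "\<And>a e. e > 0 \<Longrightarrow> \<exists>b v. (b, v) \<in> G \<and> norm (b - a) < e"
  obtains W :: "'a \<Rightarrow>\<^sub>C\<^sub>L 'b" where "\<And>a v. (a, v) \<in> G \<Longrightarrow> W a = v"
proof -
  define H where "H = closure G"
  have Hseq: "(a, v) \<in> H \<longleftrightarrow> (\<exists>b w. (\<forall>n::nat. (b n, w n) \<in> G) \<and> b \<longlonglongrightarrow> a \<and> w \<longlonglongrightarrow> v)" for a v
  proof
    assume "(a, v) \<in> H"
    then obtain x where x: "\<And>n::nat. x n \<in> G" "x \<longlonglongrightarrow> (a, v)"
      unfolding H_def closure_sequential by blast
    then show "\<exists>b w. (\<forall>n::nat. (b n, w n) \<in> G) \<and> b \<longlonglongrightarrow> a \<and> w \<longlonglongrightarrow> v"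
      using tendsto_fst[OF x(2)] tendsto_snd[OF x(2)]
      by (intro exI[of _ "\<lambda>n. fst (x n)"] exI[of _ "\<lambda>n. snd (x n)"]) simp
  next
    assume "\<exists>b w. (\<forall>n::nat. (b n, w n) \<in> G) \<and> b \<longlonglongrightarrow> a \<and> w \<longlonglongrightarrow> v"
    then obtain b w where "\<forall>n::nat. (b n, w n) \<in> G" "b \<longlonglongrightarrow> a" "w \<longlonglongrightarrow> v" by blast
    then show "(a, v) \<in> H"
      unfolding H_def closure_sequential by (intro exI[of _ "\<lambda>n. (b n, w n)"]) (simp add: tendsto_Pair)
  qed
  have GH: "G \<subseteq> H" by (simp add: H_def closure_subset)
  have Hadd: "(a + a', v + v') \<in> H" if h: "(a, v) \<in> H" "(a', v') \<in> H" for a v a' v'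
  proof -
    obtain b w b' w' where "\<forall>n::nat. (b n, w n) \<in> G" "b \<longlonglongrightarrow> a" "w \<longlonglongrightarrow> v"
      "\<forall>n::nat. (b' n, w' n) \<in> G" "b' \<longlonglongrightarrow> a'" "w' \<longlonglongrightarrow> v'"
      using h unfolding Hseq by blast
    then show ?thesis
      using G unfolding Hseq linear_graph_def
      by (intro exI[of _ "\<lambda>n. b n + b' n"] exI[of _ "\<lambda>n. w n + w' n"]) (simp add: tendsto_add)
  qed
  have Hscale: "(c *\<^sub>C a, c *\<^sub>C v) \<in> H" if h: "(a, v) \<in> H" for c a v
  proof -
    obtain b w where "\<forall>n::nat. (b n, w n) \<in> G" "b \<longlonglongrightarrow> a" "w \<longlonglongrightarrow> v"
      using h unfolding Hseq by blast
    then show ?thesis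
      using G unfolding Hseq linear_graph_def
      by (intro exI[of _ "\<lambda>n. c *\<^sub>C b n"] exI[of _ "\<lambda>n. c *\<^sub>C w n"])
        (simp add: bounded_linear.tendsto[OF bounded_linear_scaleC])
  qed
  have Hlin: "linear_graph H"
    using GH G Hadd Hscale unfolding linear_graph_def by blast
  have Hbound: "norm v \<le> K * norm a" if av: "(a, v) \<in> H" for a v
  proof -
    obtain b w where w: "\<forall>n::nat. (b n, w n) \<in> G" "b \<longlonglongrightarrow> a" "w \<longlonglongrightarrow> v"
      using av unfolding Hseq by blast
    show ?thesis
      by (rule LIMSEQ_le[OF tendsto_norm[OF w(3)] tendsto_mult_left[OF tendsto_norm[OF w(2)]]])
        (use w(1) bound in blast)
  qed
  have ex: "\<exists>v. (a, v) \<in> H" for a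
  proof -
    have "\<forall>n. \<exists>b v. (b, v) \<in> G \<and> norm (b - a) < inverse (real (Suc n))"
      by (intro allI dense) simp
    then obtain b w where bw: "\<And>n. (b n, w n) \<in> G" "\<And>n. norm (b n - a) < inverse (real (Suc n))" by metis
    have "(\<lambda>n. b n - a) \<longlonglongrightarrow> 0"
      by (rule Lim_null_comparison[OF _ LIMSEQ_inverse_real_of_nat])
        (use bw(2) in \<open>auto intro!: always_eventually less_imp_le\<close>)
    then have ba: "b \<longlonglongrightarrow> a" by (simp add: LIM_zero_cancel)
    have "Cauchy w"
    proof (rule CauchyI)
      fix e :: real assume e: "e > 0"
      define e' where "e' = e / (\<bar>K\<bar> + 1)"
      have e': "e' > 0" using e by (simp add: e'_def add_nonneg_pos)
      obtain M where M: "\<And>m n. m \<ge> M \<Longrightarrow> n \<ge> M \<Longrightarrow> norm (b m - b n) < e'"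
        using CauchyD[OF LIMSEQ_imp_Cauchy[OF ba] e'] by blast
      show "\<exists>M. \<forall>m\<ge>M. \<forall>n\<ge>M. norm (w m - w n) < e"
      proof (intro exI[of _ M] allI impI)
        fix m n assume mn: "m \<ge> M" "n \<ge> M"
        have "norm (w m - w n) \<le> K * norm (b m - b n)"
          by (intro bound linear_graph_diff[OF G] bw)
        also have "\<dots> \<le> \<bar>K\<bar> * norm (b m - b n)" by (simp add: mult_right_mono)
        also have "\<dots> \<le> \<bar>K\<bar> * e'" using M[OF mn] by (simp add: mult_left_mono)
        also have "\<dots> < e" using e by (simp add: e'_def field_simps add_nonneg_pos)
        finally show "norm (w m - w n) < e" .
      qed
    qed
    then obtain v where "w \<longlonglongrightarrow> v" by (auto simp: Cauchy_convergent_iff convergent_def)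
    then show ?thesis using bw(1) ba unfolding Hseq by blast
  qed
  have uniq: "v = w" if "(a, v) \<in> H" "(a, w) \<in> H" for a v w
    using Hbound[OF linear_graph_diff[OF Hlin that]] by simp
  define g where "g a = (THE v. (a, v) \<in> H)" for a
  have g: "(a, g a) \<in> H" for a
    unfolding g_def using theI'[of "\<lambda>v. (a, v) \<in> H"] ex uniq by blast
  have "bounded_clinear g"
  proof (rule bounded_clinear_intro)
    show "g (x + y) = g x + g y" for x y by (rule uniq[OF g Hadd[OF g g]])
    show "g (c *\<^sub>C x) = c *\<^sub>C g x" for c x by (rule uniq[OF g Hscale[OF g]])
    show "norm (g x) \<le> norm x * K" for x using Hbound[OF g[of x]] by (simp add: mult.commute)
  qed
  then show ?thesis
    using GH uniq[OF g] by (intro that[of "CBlinfun g"]) (auto simp: CBlinfun_apply)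
qed

section \<open>The open mapping theorem\<close>

text \<open>Baire category in the closed image, followed by successive approximation. Allowing a
  closed subspace \<open>S\<close> as domain covers the addition map on a product
  \<open>Y \<times> Z\<close> of closed subspaces.\<close>

theorem open_mapping_subspace:
  fixes T :: "'a::banach \<Rightarrow> 'b::banach"
  assumes T: "bounded_linear T" and S: "subspace S" "closed S" and R: "closed (T ` S)"
  shows "\<exists>C>0. \<forall>r\<in>T ` S. \<exists>u\<in>S. T u = r \<and> norm u \<le> C * norm r"
proof -
  interpret T: bounded_linear T by fact
  have subR: "subspace (T ` S)" using S(1) T.linear linear_subspace_image by blast
  define F where "F n = (T ` S) \<inter> closure (T ` (S \<inter> cball 0 (real n)))" for n
  have "T ` S \<subseteq> (\<Union>n. F n)"
  proof
    fix r assume r: "r \<in> T ` S"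
    then obtain u where u: "u \<in> S" "r = T u" by blast
    obtain n where "norm u \<le> real n" using real_arch_simple by blast
    then have "r \<in> T ` (S \<inter> cball 0 (real n))" using u by auto
    then have "r \<in> F n" unfolding F_def using r by (intro IntI subsetD[OF closure_subset])
    then show "r \<in> (\<Union>n. F n)" by blast
  qed
  then have Un: "(\<Union>n. F n) = T ` S" by (auto simp: F_def)
  have "\<exists>n. top_of_set (T ` S) interior_of F n \<noteq> {}"
  proof (rule ccontr)
    assume "\<not> ?thesis"
    moreover have "closedin (top_of_set (T ` S)) (F n)" for n
      unfolding F_def by (auto simp: closedin_closed)
    moreover have "completely_metrizable_space (top_of_set (T ` S))"
      using R by (simp add: completely_metrizable_space_closedin completely_metrizable_space_euclidean)
    ultimately have "top_of_set (T ` S) interior_of (\<Union>(range F)) = {}"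
      by (intro Baire_category_alt) auto
    then have "top_of_set (T ` S) interior_of (T ` S) = {}" using Un by simp
    moreover have "top_of_set (T ` S) interior_of (T ` S) = T ` S"
      using interior_of_topspace[of "top_of_set (T ` S)"] by simp
    ultimately show False using subspace_0[OF S(1)] by blast
  qed
  then obtain n U r0 where U: "openin (top_of_set (T ` S)) U" "r0 \<in> U" "U \<subseteq> F n"
    unfolding interior_of_def by blast
  then obtain e where e: "e > 0" "ball r0 e \<inter> T ` S \<subseteq> U" by (meson openin_contains_ball)
  have r0: "r0 \<in> T ` S" using U by (auto simp: F_def)
  \<comment> \<open>Subtracting an approximate preimage of the centre \<open>r0\<close> from one of
    \<open>r0 + r\<close> moves the ball to the origin; hence the radius
    \<open>2 * real n\<close>.\<close>
  have approx0: "\<exists>u\<in>S. norm u \<le> 2 * real n \<and> norm (T u - r) < \<delta>"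
    if r: "r \<in> T ` S" "norm r < e" and \<delta>: "\<delta> > 0" for r \<delta>
  proof -
    have "r0 + r \<in> ball r0 e \<inter> T ` S" using r r0 subspace_add[OF subR] by (simp add: dist_norm)
    then have "r0 + r \<in> F n" using e(2) U(3) by blast
    then have "r0 + r \<in> closure (T ` (S \<inter> cball 0 (real n)))" by (simp add: F_def)
    then obtain u where u: "u \<in> S" "norm u \<le> n" "norm (T u - (r0 + r)) < \<delta> / 2"
      using \<delta> unfolding closure_approachable dist_norm by (force dest: spec[of _ "\<delta> / 2"])
    have "r0 \<in> closure (T ` (S \<inter> cball 0 (real n)))" using U by (auto simp: F_def)
    then obtain v where v: "v \<in> S" "norm v \<le> n" "norm (T v - r0) < \<delta> / 2"
      using \<delta> unfolding closure_approachable dist_norm by (force dest: spec[of _ "\<delta> / 2"])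
    have "norm (T (u - v) - r) \<le> norm (T u - (r0 + r)) + norm (T v - r0)"
      using norm_triangle_ineq4[of "T u - (r0 + r)" "T v - r0"] by (simp add: T.diff algebra_simps)
    moreover have "norm (u - v) \<le> 2 * real n"
      using norm_triangle_ineq4[of u v] u v by simp
    ultimately show ?thesis
      using u v by (intro bexI[of _ "u - v"]) (auto intro: subspace_diff[OF S(1)])
  qed
  \<comment> \<open>Rescaling \<open>r\<close> to norm \<open>e / 2\<close> multiplies the bound
    \<open>2 * real n\<close> by \<open>2 * norm r / e\<close>; the summand 1 keeps \<open>M\<close>
    positive.\<close>
  define M where "M = 4 * real n / e + 1"
  have M: "M > 0" using e by (simp add: M_def add_nonneg_pos)
  have approx: "\<exists>u\<in>S. norm u \<le> M * norm r \<and> norm (r - T u) \<le> norm r / 2" if r: "r \<in> T ` S" for r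
  proof (cases "r = 0")
    case True
    then show ?thesis using subspace_0[OF S(1)] by (intro bexI[of _ 0]) (auto simp: T.zero)
  next
    case False
    define s where "s = e / (2 * norm r)"
    have s: "s > 0" using False e by (simp add: s_def)
    have "norm (s *\<^sub>R r) = e / 2" using False e by (simp add: s_def)
    then obtain u where u: "u \<in> S" "norm u \<le> 2 * real n" "norm (T u - s *\<^sub>R r) < e / 4"
      using approx0[of "s *\<^sub>R r" "e / 4"] e subspace_scale[OF subR r] by auto
    show ?thesis
    proof (intro bexI[of _ "inverse s *\<^sub>R u"] conjI)
      have "norm (inverse s *\<^sub>R u) \<le> inverse s * (2 * real n)"
        using u(2) s by (simp add: mult_left_mono)
      also have "\<dots> = 4 * real n / e * norm r" using False e by (simp add: s_def)
      also have "\<dots> \<le> M * norm r" by (simp add: M_def algebra_simps)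
      finally show "norm (inverse s *\<^sub>R u) \<le> M * norm r" .
      have "r - T (inverse s *\<^sub>R u) = inverse s *\<^sub>R (s *\<^sub>R r - T u)"
        using s by (simp add: T.scaleR scaleR_diff_right)
      then have "norm (r - T (inverse s *\<^sub>R u)) = inverse s * norm (T u - s *\<^sub>R r)"
        using s by (simp add: norm_minus_commute)
      also have "\<dots> \<le> inverse s * (e / 4)" using u(3) s by (simp add: mult_left_mono)
      also have "\<dots> = norm r / 2" using False e by (simp add: s_def)
      finally show "norm (r - T (inverse s *\<^sub>R u)) \<le> norm r / 2" .
      show "inverse s *\<^sub>R u \<in> S" using u(1) by (rule subspace_scale[OF S(1)])
    qed
  qed
  obtain w where w: "\<And>r. r \<in> T ` S \<Longrightarrow> w r \<in> S" "\<And>r. r \<in> T ` S \<Longrightarrow> norm (w r) \<le> M * norm r"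
    "\<And>r. r \<in> T ` S \<Longrightarrow> norm (r - T (w r)) \<le> norm r / 2"
    using approx by metis
  have "\<exists>u\<in>S. T u = r \<and> norm u \<le> (2 * M) * norm r" if r: "r \<in> T ` S" for r
  proof -
    \<comment> \<open>\<open>rs k\<close> is what is left of \<open>r\<close> after \<open>k\<close>
      corrections. Its norm is at least halved each time, so the corrections \<open>w (rs k)\<close>
      form an absolutely convergent series, and its sum is an exact preimage.\<close>
    define rs where "rs k = ((\<lambda>r. r - T (w r)) ^^ k) r" for k
    have rs0: "rs 0 = r" and rsS: "rs (Suc k) = rs k - T (w (rs k))" for k
      by (simp_all add: rs_def)
    have rsR: "rs k \<in> T ` S" for k
      by (induction k) (auto simp: rs0 rsS r intro!: subspace_diff[OF subR] w(1))
    have rsn: "norm (rs k) \<le> norm r * (1/2) ^ k" for k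
    proof (induction k)
      case (Suc k)
      then show ?case using w(3)[OF rsR[of k]] by (simp add: rsS)
    qed (simp add: rs0)
    define b where "b k = (M * norm r) * (1/2) ^ k" for k
    have wn: "norm (w (rs k)) \<le> b k" for k
      using order_trans[OF w(2)[OF rsR] mult_left_mono[OF rsn less_imp_le[OF M]]]
      by (simp add: mult.assoc b_def)
    have geo: "b sums ((M * norm r) * 2)"
      using sums_mult[OF geometric_sums[of "1/2 :: real"], of "M * norm r"] by (simp add: b_def[abs_def])
    have sumn: "summable (\<lambda>k. norm (w (rs k)))"
    proof (rule summable_comparison_test'[OF sums_summable[OF geo]])
      show "norm (norm (w (rs k))) \<le> b k" for k using wn[of k] by simp
    qed
    then have sumw: "(\<lambda>k. w (rs k)) sums (\<Sum>k. w (rs k))"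
      by (rule summable_sums[OF summable_norm_cancel])
    have part: "T (\<Sum>i<k. w (rs i)) = r - rs k" for k
      by (induction k) (simp_all add: rs0 rsS T.add T.zero)
    have "(\<lambda>k. norm r * (1/2) ^ k) \<longlonglongrightarrow> norm r * 0"
      by (intro tendsto_mult_left LIMSEQ_power_zero) simp
    then have "rs \<longlonglongrightarrow> 0"
      by (intro Lim_null_comparison[of rs "\<lambda>k. norm r * (1/2) ^ k"]) (use rsn in auto)
    then have "(\<lambda>k. T (\<Sum>i<k. w (rs i))) \<longlonglongrightarrow> r - 0"
      unfolding part by (intro tendsto_diff tendsto_const)
    moreover have "(\<lambda>k. T (\<Sum>i<k. w (rs i))) \<longlonglongrightarrow> T (\<Sum>k. w (rs k))"
      using sumw unfolding sums_def by (rule T.tendsto)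
    ultimately have "T (\<Sum>k. w (rs k)) = r" using LIMSEQ_unique by fastforce
    moreover have "(\<Sum>k. w (rs k)) \<in> S"
    proof (rule closed_sequentially[OF S(2)])
      show "(\<lambda>k. \<Sum>i<k. w (rs i)) \<longlonglongrightarrow> (\<Sum>k. w (rs k))" using sumw by (simp add: sums_def)
      show "(\<Sum>i<k. w (rs i)) \<in> S" for k by (intro subspace_sum[OF S(1)] w(1) rsR)
    qed
    moreover have "norm (\<Sum>k. w (rs k)) \<le> (2 * M) * norm r"
    proof -
      have "norm (\<Sum>k. w (rs k)) \<le> (\<Sum>k. norm (w (rs k)))" by (rule summable_norm[OF sumn])
      also have "\<dots> \<le> (\<Sum>k. b k)"
        by (rule suminf_le[OF wn sumn sums_summable[OF geo]])
      also have "\<dots> = (2 * M) * norm r" using sums_unique[OF geo] by simp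
      finally show ?thesis .
    qed
    ultimately show ?thesis by blast
  qed
  then show ?thesis using M by (intro exI[of _ "2 * M"]) auto
qed

section \<open>Finite-dimensional tools\<close>

lemma separating_functional_one:
  fixes w :: "'a::complex_normed_vector"
  assumes "w \<noteq> 0"
  obtains \<phi> :: "'a cdual" where "\<phi> w = 1"
proof -
  obtain \<psi> :: "'a cdual" where "\<psi> w \<noteq> 0" using cdual_separates[OF assms] .
  then show ?thesis
    by (intro that[of "inverse (\<psi> w) *\<^sub>C \<psi>"]) (simp add: cblinfun_apply_scaleC scaleC_complex_def)
qed

text \<open>If \<open>q\<close> fixes \<open>B\<close> but not \<open>b\<close>, the rank-one term
  \<open>y \<mapsto> \<phi> (y - q y) *\<^sub>C (b - q b)\<close> with
  \<open>\<phi> (b - q b) = 1\<close> repairs the value at \<open>b\<close> and vanishes on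
  \<open>B\<close>.\<close>

lemma span_fixed_by_rank_one_sum:
  fixes B :: "'a::complex_normed_vector set"
  assumes "finite B"
  shows "\<exists>ps :: ('a \<times> 'a cdual) list. \<forall>y\<in>complex_vector.span B. form_sum rank_one ps y = y"
  using assms
proof (induction B)
  case empty
  show ?case by (rule exI[of _ "[]"]) simp
next
  case (insert b B)
  then obtain ps :: "('a \<times> 'a cdual) list"
    where ps: "\<forall>y\<in>complex_vector.span B. form_sum rank_one ps y = y" by blast
  define q where "q = form_sum rank_one ps"
  have ext: "\<exists>ps :: ('a \<times> 'a cdual) list. \<forall>y\<in>complex_vector.span (insert b B). form_sum rank_one ps y = y"
    if rs: "\<And>y. y \<in> insert b B \<Longrightarrow> form_sum rank_one rs y = y" for rs :: "('a \<times> 'a cdual) list"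
  proof (intro exI ballI)
    fix y assume y: "y \<in> complex_vector.span (insert b B)"
    have "complex_vector.subspace {y. form_sum rank_one rs y = y}"
      by (auto simp: complex_vector.subspace_def cblinfun.add_right cblinfun_scaleC_arg
          cblinfun.zero_right)
    moreover have "insert b B \<subseteq> {y. form_sum rank_one rs y = y}" using rs by auto
    ultimately have "complex_vector.span (insert b B) \<subseteq> {y. form_sum rank_one rs y = y}"
      by (intro complex_vector.span_minimal)
    with y show "form_sum rank_one rs y = y" by auto
  qed
  have qB: "q y = y" if "y \<in> B" for y using ps that by (simp add: q_def complex_vector.span_base)
  show ?case
  proof (cases "q b = b")
    case True
    then have "form_sum rank_one ps y = y" if "y \<in> insert b B" for y
      using that qB[of y] by (cases "y = b") (auto simp: q_def)
    then show ?thesis by (rule ext)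
  next
    case False
    then have "b - q b \<noteq> 0" by simp
    then obtain \<phi> :: "'a cdual" where \<phi>: "\<phi> (b - q b) = 1"
      by (rule separating_functional_one)
    define rs where "rs = (b - q b, \<phi> o\<^sub>C\<^sub>L (cblinfun_id - q)) # ps"
    have "form_sum rank_one rs y = \<phi> (y - q y) *\<^sub>C (b - q b) + q y" for y
      by (simp add: rs_def cblinfun_apply_add rank_one_apply cblinfun_apply_diff flip: q_def)
    then have "form_sum rank_one rs y = y" if "y \<in> insert b B" for y
      using that \<phi> qB[of y] by (cases "y = b") (auto simp: cblinfun.zero_right)
    then show ?thesis by (rule ext)
  qed
qed

text \<open>\<open>T\<close> equals \<open>q\<close> after \<open>T\<close> for a sum
  \<open>q\<close> of rank-one operators that fixes the range of \<open>T\<close>.\<close>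

lemma finite_rank_as_rank_one_sum:
  fixes T :: "'a::complex_normed_vector \<Rightarrow>\<^sub>C\<^sub>L 'b::complex_normed_vector"
  assumes "finite_rank T"
  obtains ps where "T = form_sum rank_one ps"
proof -
  obtain B where B: "finite B" "range T \<subseteq> complex_vector.span B"
    using assms unfolding finite_rank_def finite_cdim_def by blast
  obtain ps :: "('b \<times> 'b cdual) list"
    where ps: "\<forall>y\<in>complex_vector.span B. form_sum rank_one ps y = y"
    using span_fixed_by_rank_one_sum[OF B(1)] by blast
  have "form_sum rank_one (map (\<lambda>(x, f). (x, f o\<^sub>C\<^sub>L T)) qs) \<xi> = form_sum rank_one qs (T \<xi>)"
    for qs :: "('b \<times> 'b cdual) list" and \<xi>
    by (induction qs) (auto simp: cblinfun_apply_add rank_one_apply)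
  then have "T = form_sum rank_one (map (\<lambda>(x, f). (x, f o\<^sub>C\<^sub>L T)) ps)"
    using ps B(2) by (intro cblinfun_eqI) (simp add: image_subset_iff)
  then show ?thesis by (rule that)
qed

lemma finite_rank_rank_one: "finite_rank (rank_one x f)"
  unfolding finite_rank_def finite_cdim_def
  by (rule exI[of _ "{x}"])
    (auto simp: rank_one_apply intro: complex_vector.span_scale complex_vector.span_base)

text \<open>A norm-controlled choice of representatives of \<open>V\<close> modulo the common kernel
  of \<open>G\<close>, inside one finite-dimensional subspace. A new functional \<open>g\<close>
  either vanishes wherever the old ones do, and then the old lift already matches it, or some
  \<open>w\<close> in their common kernel has \<open>g w = 1\<close> and corrects the value.\<close>

lemma finite_functionals_lift:
  fixes V :: "'a::complex_normed_vector set" and G :: "'a cdual set"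
  assumes V: "complex_vector.subspace V" and G: "finite G"
  shows "\<exists>B M. finite B \<and> B \<subseteq> V \<and> M \<ge> 0 \<and> (\<forall>y\<in>V. \<exists>b\<in>complex_vector.span B.
    (\<forall>g\<in>G. g b = g y) \<and> norm b \<le> M * (\<Sum>g\<in>G. cmod (cblinfun_apply g y)))"
  using G
proof (induction G)
  case empty
  show ?case by (rule exI[of _ "{}"], rule exI[of _ 0]) auto
next
  case (insert g G)
  then obtain B M where B: "finite B" "B \<subseteq> V" "M \<ge> 0" and
    lift: "\<And>y. y \<in> V \<Longrightarrow> \<exists>b\<in>complex_vector.span B. (\<forall>g\<in>G. g b = g y) \<and> norm b \<le> M * (\<Sum>g\<in>G. cmod (cblinfun_apply g y))"
    by blast
  show ?case
  proof (cases "\<exists>w\<in>V. (\<forall>g\<in>G. g w = 0) \<and> g w \<noteq> 0")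
    case False
    have "\<exists>b\<in>complex_vector.span B. (\<forall>g\<in>insert g G. g b = g y)
      \<and> norm b \<le> M * (\<Sum>g\<in>insert g G. cmod (cblinfun_apply g y))" if y: "y \<in> V" for y
    proof -
      obtain b where b: "b \<in> complex_vector.span B" "\<forall>g\<in>G. g b = g y" "norm b \<le> M * (\<Sum>g\<in>G. cmod (cblinfun_apply g y))"
        using lift[OF y] by blast
      have "b \<in> V" using b(1) B(2) V complex_vector.span_minimal by blast
      then have "y - b \<in> V" using V y by (simp add: complex_vector.subspace_diff)
      then have "g (y - b) = 0" using False b(2) by (auto simp: cblinfun.diff_right)
      moreover have "M * (\<Sum>g\<in>G. cmod (cblinfun_apply g y)) \<le> M * (\<Sum>g\<in>insert g G. cmod (cblinfun_apply g y))"
        using B(3) insert.hyps by (intro mult_left_mono) auto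
      ultimately show ?thesis using b by (intro bexI[of _ b]) (auto simp: cblinfun.diff_right)
    qed
    then show ?thesis using B by blast
  next
    case True
    then obtain w0 where w0: "w0 \<in> V" "\<forall>g\<in>G. g w0 = 0" "g w0 \<noteq> 0" by blast
    define w where "w = inverse (g w0) *\<^sub>C w0"
    have w: "w \<in> V" "\<forall>g\<in>G. g w = 0" "g w = 1"
      using w0 V by (auto simp: w_def cblinfun_scaleC_arg scaleC_complex_def complex_vector.subspace_scale)
    \<comment> \<open>The correction costs \<open>cmod (g y - g b) * norm w\<close>, where
      \<open>g b\<close> is estimated by \<open>norm g * norm b\<close> and charged to the old
      constant \<open>M\<close>.\<close>
    define M' where "M' = M * (1 + norm g * norm w) + norm w"
    have "\<exists>b\<in>complex_vector.span (insert w B). (\<forall>g\<in>insert g G. g b = g y)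
      \<and> norm b \<le> M' * (\<Sum>g\<in>insert g G. cmod (cblinfun_apply g y))" if y: "y \<in> V" for y
    proof -
      obtain b where b: "b \<in> complex_vector.span B" "\<forall>g\<in>G. g b = g y" "norm b \<le> M * (\<Sum>g\<in>G. cmod (cblinfun_apply g y))"
        using lift[OF y] by blast
      define S where "S = (\<Sum>g\<in>G. cmod (cblinfun_apply g y))"
      have S: "S \<ge> 0" by (simp add: S_def sum_nonneg)
      define b' where "b' = b + (g y - g b) *\<^sub>C w"
      have "norm b' \<le> norm b + cmod (g y - g b) * norm w"
        unfolding b'_def by (metis norm_triangle_ineq norm_scaleC)
      also have "\<dots> \<le> norm b + (cmod (cblinfun_apply g y) + norm g * norm b) * norm w"
        using norm_triangle_ineq4[of "g y" "g b"] norm_cblinfun[of g b]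
        by (intro add_left_mono mult_right_mono) auto
      also have "\<dots> = norm b * (1 + norm g * norm w) + cmod (cblinfun_apply g y) * norm w"
        by (simp add: algebra_simps)
      also have "\<dots> \<le> (M * S) * (1 + norm g * norm w) + cmod (cblinfun_apply g y) * norm w"
        using b(3) by (intro add_right_mono mult_right_mono) (auto simp: S_def add_nonneg_nonneg)
      also have "\<dots> \<le> M' * (S + cmod (cblinfun_apply g y))"
      proof -
        have "0 \<le> M * cmod (cblinfun_apply g y) * (1 + norm g * norm w)" "0 \<le> norm w * S"
          using S B(3) by (auto simp: add_nonneg_nonneg)
        then show ?thesis by (simp add: M'_def algebra_simps)
      qed
      also have "S + cmod (cblinfun_apply g y) = (\<Sum>g\<in>insert g G. cmod (cblinfun_apply g y))"
        using insert.hyps by (simp add: S_def)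
      finally have "norm b' \<le> M' * (\<Sum>g\<in>insert g G. cmod (cblinfun_apply g y))" .
      moreover have "\<forall>g\<in>insert g G. g b' = g y"
        using b(2) w by (simp add: b'_def cblinfun.add_right cblinfun_scaleC_arg scaleC_complex_def)
      moreover have "b' \<in> complex_vector.span (insert w B)"
      proof -
        have "b \<in> complex_vector.span (insert w B)"
          using b(1) complex_vector.span_mono[of B "insert w B"] by blast
        then show ?thesis
          unfolding b'_def
          by (simp add: complex_vector.span_add complex_vector.span_scale complex_vector.span_base)
      qed
      ultimately show ?thesis by blast
    qed
    moreover have "M' \<ge> 0" using B(3) by (simp add: M'_def add_nonneg_nonneg)
    ultimately show ?thesis using B w(1) by (intro exI[of _ "insert w B"] exI[of _ M']) auto
  qed
qed

lemma finite_cdim_if_separated: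
  fixes V :: "'a::complex_normed_vector set" and G :: "'a cdual set"
  assumes V: "complex_vector.subspace V" and G: "finite G"
    and sep: "\<And>y. y \<in> V \<Longrightarrow> (\<And>g. g \<in> G \<Longrightarrow> g y = 0) \<Longrightarrow> y = 0"
  shows "finite_cdim V"
proof -
  obtain B M where B: "finite B" "B \<subseteq> V" and
    lift: "\<forall>y\<in>V. \<exists>b\<in>complex_vector.span B.
      (\<forall>g\<in>G. g b = g y) \<and> norm b \<le> M * (\<Sum>g\<in>G. cmod (cblinfun_apply g y))"
    using finite_functionals_lift[OF V G] by (elim exE conjE) (rule that)
  have "y \<in> complex_vector.span B" if y: "y \<in> V" for y
  proof -
    obtain b where b: "b \<in> complex_vector.span B" "\<forall>g\<in>G. g b = g y" using lift y by blast
    have "b \<in> V" using b(1) B(2) V complex_vector.span_minimal by blast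
    then have "y - b = 0" using b(2) V y by (intro sep) (simp_all add: complex_vector.subspace_diff cblinfun.diff_right)
    then show ?thesis using b(1) by simp
  qed
  then show ?thesis unfolding finite_cdim_def using B(1) by (intro exI[of _ B] conjI subsetI)
qed

section \<open>Finite nets in the unit ball\<close>

lemma norm_cblinfun_unit_ball:
  fixes f :: "'a::complex_normed_vector \<Rightarrow>\<^sub>C\<^sub>L 'b::complex_normed_vector"
  assumes "\<And>x. norm x \<le> 1 \<Longrightarrow> norm (f x) \<le> b"
  shows "norm f \<le> b"
proof (rule norm_cblinfun_bound)
  show "0 \<le> b" using assms[of 0] by (simp add: cblinfun.zero_right)
  show "norm (f x) \<le> b * norm x" for x
  proof (cases "x = 0")
    case False
    have "norm (f (inverse (norm x) *\<^sub>R x)) \<le> b" using False by (intro assms) simp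
    then show ?thesis using False by (simp add: cblinfun.scaleR_right field_simps)
  qed (simp add: cblinfun.zero_right)
qed

text \<open>The unit ball may be far from compact, but its points can be sorted by the grid cells of
  the finitely many values \<open>g \<xi>\<close>, and one point is kept for each occupied
  cell.\<close>

lemma finite_net_functionals:
  fixes G :: "'a::complex_normed_vector cdual set"
  assumes G: "finite G" and \<delta>: "\<delta> > 0"
  obtains \<Xi> where "finite \<Xi>" "\<Xi> \<subseteq> cball 0 1"
    "\<And>\<xi>. norm \<xi> \<le> 1 \<Longrightarrow> \<exists>\<xi>'\<in>\<Xi>. \<forall>g\<in>G. cmod (cblinfun_apply g (\<xi> - \<xi>')) \<le> \<delta>"
proof -
  \<comment> \<open>Within a cell the real and the imaginary part each vary by at most
    \<open>d\<close>, and the modulus is at most their sum.\<close>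
  define d where "d = \<delta> / 2"
  have d: "d > 0" using \<delta> by (simp add: d_def)
  define c where "c \<xi> = (\<lambda>g\<in>G. (\<lfloor>Re (cblinfun_apply g \<xi>) / d\<rfloor>, \<lfloor>Im (cblinfun_apply g \<xi>) / d\<rfloor>))" for \<xi>
  define N where "N g = \<lceil>norm g / d\<rceil> + 1" for g :: "'a cdual"
  have fl: "\<lfloor>r / d\<rfloor> \<in> {- N g .. N g}" if r: "\<bar>r\<bar> \<le> norm g" for r and g :: "'a cdual"
  proof -
    have "- (norm g / d) \<le> r / d" "r / d \<le> norm g / d"
      using r d divide_right_mono[of "- norm g" r d] by (simp_all add: divide_right_mono)
    then show ?thesis unfolding N_def atLeastAtMost_iff by linarith
  qed
  have "c ` cball 0 1 \<subseteq> PiE G (\<lambda>g. {- N g .. N g} \<times> {- N g .. N g})"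
  proof
    fix y assume "y \<in> c ` cball 0 1"
    then obtain \<xi> where \<xi>: "norm \<xi> \<le> 1" "y = c \<xi>" by auto
    have "cmod (g \<xi>) \<le> norm g" for g :: "'a cdual"
      using norm_cblinfun[of g \<xi>] mult_left_mono[OF \<xi>(1), of "norm g"] by simp
    then have "\<bar>Re (g \<xi>)\<bar> \<le> norm g" "\<bar>Im (g \<xi>)\<bar> \<le> norm g" for g :: "'a cdual"
      using abs_Re_le_cmod[of "g \<xi>"] abs_Im_le_cmod[of "g \<xi>"] order_trans by blast+
    then show "y \<in> PiE G (\<lambda>g. {- N g .. N g} \<times> {- N g .. N g})"
      unfolding \<xi>(2) c_def restrict_PiE_iff by (intro ballI SigmaI fl) auto
  qed
  moreover have "finite (PiE G (\<lambda>g. {- N g .. N g} \<times> {- N g .. N g}))"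
    using G by (intro finite_PiE) auto
  ultimately have fin: "finite (c ` cball 0 1)" by (rule finite_subset)
  obtain \<Xi> where \<Xi>: "\<Xi> \<subseteq> cball 0 1" "finite \<Xi>" "c ` cball 0 1 = c ` \<Xi>"
    using finite_subset_image[OF fin order_refl] by blast
  show ?thesis
  proof (rule that[OF \<Xi>(2,1)])
    fix \<xi> :: 'a assume "norm \<xi> \<le> 1"
    then have "c \<xi> \<in> c ` cball 0 1" by auto
    then have "c \<xi> \<in> c ` \<Xi>" using \<Xi>(3) by simp
    then obtain \<xi>' where \<xi>': "\<xi>' \<in> \<Xi>" "c \<xi> = c \<xi>'" by blast
    have "cmod (cblinfun_apply g (\<xi> - \<xi>')) \<le> \<delta>" if g: "g \<in> G" for g
    proof -
      have "\<lfloor>Re (g \<xi>) / d\<rfloor> = \<lfloor>Re (g \<xi>') / d\<rfloor>" "\<lfloor>Im (g \<xi>) / d\<rfloor> = \<lfloor>Im (g \<xi>') / d\<rfloor>"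
        using fun_cong[OF \<xi>'(2), of g] g by (simp_all add: c_def)
      then have "\<bar>Re (g \<xi>) / d - Re (g \<xi>') / d\<bar> \<le> 1" "\<bar>Im (g \<xi>) / d - Im (g \<xi>') / d\<bar> \<le> 1"
        by linarith+
      then have "\<bar>Re (g \<xi>) - Re (g \<xi>')\<bar> \<le> d" "\<bar>Im (g \<xi>) - Im (g \<xi>')\<bar> \<le> d"
        using d by (simp_all add: field_simps flip: diff_divide_distrib)
      then show ?thesis
        using cmod_le[of "g (\<xi> - \<xi>')"] by (simp add: cblinfun.diff_right d_def)
    qed
    then show "\<exists>\<xi>'\<in>\<Xi>. \<forall>g\<in>G. cmod (cblinfun_apply g (\<xi> - \<xi>')) \<le> \<delta>" using \<xi>'(1) by blast
  qed
qed

text \<open>For a net point \<open>\<xi>'\<close> near \<open>\<xi>\<close>, the difference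
  \<open>\<xi> - \<xi>'\<close> is a vector \<open>\<eta>\<close> of norm at most 1/2 plus a vector
  on which \<open>G\<close>, hence \<open>a\<close>, vanishes. The error \<open>norm a / 2\<close>
  is absorbed on the left, which gives the factor 2.\<close>

lemma finite_norming_net:
  fixes G :: "'a::complex_normed_vector cdual set"
  assumes G: "finite G"
  obtains \<Xi> where "finite \<Xi>" "\<Xi> \<subseteq> cball 0 1"
    "\<And>(a :: 'a \<Rightarrow>\<^sub>C\<^sub>L 'b::complex_normed_vector) c.
      (\<And>\<xi>. (\<And>g. g \<in> G \<Longrightarrow> g \<xi> = 0) \<Longrightarrow> cblinfun_apply a \<xi> = 0) \<Longrightarrow>
      (\<And>\<xi>. \<xi> \<in> \<Xi> \<Longrightarrow> norm (cblinfun_apply a \<xi>) \<le> c) \<Longrightarrow> norm a \<le> 2 * c"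
proof -
  obtain B M where M: "M \<ge> 0" and
    lift: "\<forall>y\<in>UNIV. \<exists>b\<in>complex_vector.span B.
      (\<forall>g\<in>G. g b = g y) \<and> norm b \<le> M * (\<Sum>g\<in>G. cmod (cblinfun_apply g y))"
    using finite_functionals_lift[OF complex_vector.subspace_UNIV G] by (elim exE conjE) (rule that)
  \<comment> \<open>Chosen so that \<open>M * (card G * \<delta>) \<le> 1 / 2\<close>; the summand 1
    keeps the denominator positive.\<close>
  define \<delta> where "\<delta> = 1 / (2 * (M * card G + 1))"
  have Mc: "M * card G \<ge> 0" using M by simp
  then have \<delta>: "\<delta> > 0" by (simp add: \<delta>_def)
  have M\<delta>: "M * (card G * \<delta>) \<le> 1 / 2"
    using Mc by (simp add: \<delta>_def field_simps)
  obtain \<Xi> where \<Xi>: "finite \<Xi>" "\<Xi> \<subseteq> cball 0 1"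
    "\<And>\<xi>. norm \<xi> \<le> 1 \<Longrightarrow> \<exists>\<xi>'\<in>\<Xi>. \<forall>g\<in>G. cmod (cblinfun_apply g (\<xi> - \<xi>')) \<le> \<delta>"
    using finite_net_functionals[OF G \<delta>] by metis
  show ?thesis
  proof (rule that[OF \<Xi>(1,2)])
    fix a :: "'a \<Rightarrow>\<^sub>C\<^sub>L 'b" and c
    assume a: "\<And>\<xi>. (\<And>g. g \<in> G \<Longrightarrow> g \<xi> = 0) \<Longrightarrow> a \<xi> = 0" and c: "\<And>\<xi>. \<xi> \<in> \<Xi> \<Longrightarrow> norm (a \<xi>) \<le> c"
    have "norm a \<le> c + norm a / 2"
    proof (rule norm_cblinfun_unit_ball)
      fix \<xi> :: 'a assume "norm \<xi> \<le> 1"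
      then obtain \<xi>' where \<xi>': "\<xi>' \<in> \<Xi>" "\<forall>g\<in>G. cmod (cblinfun_apply g (\<xi> - \<xi>')) \<le> \<delta>" using \<Xi>(3) by blast
      obtain \<eta> where \<eta>: "\<forall>g\<in>G. g \<eta> = g (\<xi> - \<xi>')" "norm \<eta> \<le> M * (\<Sum>g\<in>G. cmod (cblinfun_apply g (\<xi> - \<xi>')))"
        using lift by blast
      have "(\<Sum>g\<in>G. cmod (cblinfun_apply g (\<xi> - \<xi>'))) \<le> card G * \<delta>"
        using sum_bounded_above[of G "\<lambda>g. cmod (cblinfun_apply g (\<xi> - \<xi>'))" \<delta>] \<xi>'(2) by simp
      then have "norm \<eta> \<le> M * (card G * \<delta>)"
        by (intro order_trans[OF \<eta>(2)] mult_left_mono M)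
      then have n: "norm \<eta> \<le> 1 / 2" using M\<delta> by linarith
      have "a (\<xi> - \<xi>' - \<eta>) = 0" using \<eta>(1) by (intro a) (simp add: cblinfun.diff_right)
      then have "a \<xi> = a \<xi>' + a \<eta>" by (simp add: cblinfun.diff_right diff_eq_eq add.commute)
      then have "norm (a \<xi>) \<le> norm (a \<xi>') + norm (a \<eta>)" by (simp add: norm_triangle_ineq)
      moreover have "norm (a \<eta>) \<le> norm a * (1 / 2)"
        using norm_cblinfun[of a \<eta>] mult_left_mono[OF n, of "norm a"] by simp
      ultimately show "norm (a \<xi>) \<le> c + norm a / 2" using c[OF \<xi>'(1)] by simp
    qed
    then show "norm a \<le> 2 * c" by simp
  qed
qed

text \<open>Gram-Schmidt for a Hermitian form that is known to be definite only on the span of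
  \<open>I\<close>, as is the case for the finite weighted sums of evaluations to which it is
  applied.\<close>

lemma orthonormal_family:
  fixes ip :: "'a::complex_normed_vector \<Rightarrow> 'a \<Rightarrow> complex"
  assumes add: "\<And>x y z. ip (x + y) z = ip x z + ip y z"
    and scale: "\<And>c x z. ip (c *\<^sub>C x) z = c * ip x z"
    and herm: "\<And>x y. ip y x = cnj (ip x y)"
    and pos: "\<And>x. x \<in> complex_vector.span I \<Longrightarrow> x \<noteq> 0 \<Longrightarrow> Re (ip x x) > 0"
    and I: "finite I" "complex_vector.independent I"
  shows "k \<le> card I \<Longrightarrow> \<exists>e :: nat \<Rightarrow> 'a. (\<forall>i<k. e i \<in> complex_vector.span I) \<and>
    (\<forall>i<k. \<forall>j<k. ip (e i) (e j) = (if i = j then 1 else 0))"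
proof (induction k)
  case (Suc k)
  then obtain e :: "nat \<Rightarrow> 'a" where e: "\<And>i. i < k \<Longrightarrow> e i \<in> complex_vector.span I"
    and on: "\<And>i j. i < k \<Longrightarrow> j < k \<Longrightarrow> ip (e i) (e j) = (if i = j then 1 else 0)"
    by (metis Suc_leD)
  have "card (e ` {..<k}) \<le> k" using card_image_le[of "{..<k}" e] by simp
  then have "\<not> I \<subseteq> complex_vector.span (e ` {..<k})"
    using complex_vector.independent_span_bound[of "e ` {..<k}" I] I Suc.prems by auto
  then obtain f where f: "f \<in> I" "f \<notin> complex_vector.span (e ` {..<k})" by blast
  have ip_sum: "ip (\<Sum>i\<in>A. c i *\<^sub>C e i) z = (\<Sum>i\<in>A. c i * ip (e i) z)" for A c z
  proof (induction A rule: infinite_finite_induct)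
    case (infinite A) then show ?case using scale[of 0 0 z] by simp
  next
    case empty then show ?case using scale[of 0 0 z] by simp
  qed (simp add: add scale)
  have ip_diff: "ip (x - y) z = ip x z - ip y z" for x y z
    using add[of "x - y" y z] by simp
  define s where "s = (\<Sum>i<k. ip f (e i) *\<^sub>C e i)"
  define g where "g = f - s"
  have s_span: "s \<in> complex_vector.span (e ` {..<k})"
    unfolding s_def
    by (intro complex_vector.span_sum complex_vector.span_scale complex_vector.span_base) auto
  then have g0: "g \<noteq> 0" using f(2) by (auto simp: g_def)
  have sI: "s \<in> complex_vector.span I"
    unfolding s_def by (intro complex_vector.span_sum complex_vector.span_scale) (use e in auto)
  then have gI: "g \<in> complex_vector.span I"
    unfolding g_def using f(1) sI by (simp add: complex_vector.span_diff complex_vector.span_base)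
  have orth: "ip g (e j) = 0" if j: "j < k" for j
  proof -
    have "ip s (e j) = (\<Sum>i<k. if i = j then ip f (e i) else 0)"
      unfolding s_def ip_sum using j on by (intro sum.cong) auto
    also have "\<dots> = ip f (e j)" using j by simp
    finally show ?thesis by (simp add: g_def ip_diff)
  qed
  have orth': "ip (e j) g = 0" if j: "j < k" for j using herm[of "e j" g] orth[OF j] by simp
  have gg: "Re (ip g g) > 0" by (rule pos[OF gI g0])
  have "ip g g = cnj (ip g g)" by (rule herm)
  then have im: "ip g g = complex_of_real (Re (ip g g))"
    by (metis Reals_cnj_iff of_real_Re)
  define r where "r = inverse (sqrt (Re (ip g g)))"
  define h where "h = complex_of_real r *\<^sub>C g"
  have ip_right: "ip x (complex_of_real c *\<^sub>C y) = c * ip x y" for x y c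
  proof -
    have "ip x (complex_of_real c *\<^sub>C y) = cnj (ip (complex_of_real c *\<^sub>C y) x)" by (rule herm)
    also have "\<dots> = c * cnj (ip y x)" by (simp add: scale)
    also have "cnj (ip y x) = ip x y" by (rule herm[symmetric])
    finally show ?thesis .
  qed
  have "r * r = inverse (Re (ip g g))" using gg by (simp add: r_def flip: inverse_mult_distrib)
  then have "r * (r * Re (ip g g)) = 1" using gg by (simp flip: mult.assoc)
  moreover have "ip h h = complex_of_real (r * (r * Re (ip g g)))"
    unfolding h_def scale ip_right by (subst im) simp
  ultimately have hh: "ip h h = 1" by simp
  show ?case
  proof (intro exI[of _ "e(k := h)"] conjI allI impI)
    show "(e(k := h)) i \<in> complex_vector.span I" if "i < Suc k" for i
      using that e gI by (auto simp: h_def less_Suc_eq intro: complex_vector.span_scale)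
    show "ip ((e(k := h)) i) ((e(k := h)) j) = (if i = j then 1 else 0)"
      if "i < Suc k" "j < Suc k" for i j
      using that on hh orth orth' by (auto simp: less_Suc_eq h_def scale ip_right)
  qed
qed simp

text \<open>
  The hypothesis says that the identity of \<open>V\<close> is locally nuclear with uniformly bounded nuclear
  norm. The Hilbert norm with square \<open>\<Sum>j. norm (h j) * (cmod (f (\<xi> j)))\<^sup>2\<close> is then equivalent to the
  norm of \<open>V\<close>, and every orthonormal family has at most \<open>K\<^sup>2\<close> elements.
\<close>

lemma finite_cdim_if_uniformly_nuclear:
  fixes V :: "'a::complex_normed_vector cdual set"
  assumes loc: "\<And>I. finite I \<Longrightarrow> I \<subseteq> V \<Longrightarrow> \<exists>(m::nat) (\<xi> :: nat \<Rightarrow> 'a) (h :: nat \<Rightarrow> 'a cdual).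
    (\<forall>j<m. norm (\<xi> j) \<le> 1) \<and> (\<Sum>j<m. norm (h j)) \<le> K \<and>
    (\<forall>f\<in>I. f = (\<Sum>j<m. cblinfun_apply f (\<xi> j) *\<^sub>C h j))"
  shows "finite_cdim V"
proof (rule ccontr)
  assume infin: "\<not> finite_cdim V"
  obtain B where B: "B \<subseteq> V" "complex_vector.independent B" "V \<subseteq> complex_vector.span B"
    using complex_vector.maximal_independent_subset by blast
  have "infinite B" using infin B(3) unfolding finite_cdim_def by blast
  moreover obtain n :: nat where n: "real n > K * K" using reals_Archimedean2 by blast
  ultimately obtain I where I: "I \<subseteq> B" "finite I" "card I = n"
    using infinite_arbitrarily_large by blast
  have indep: "complex_vector.independent I" using B(2) I(1) complex_vector.independent_mono by blast
  obtain m :: nat and \<xi> :: "nat \<Rightarrow> 'a" and h :: "nat \<Rightarrow> 'a cdual"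
    where \<xi>: "\<And>j. j < m \<Longrightarrow> norm (\<xi> j) \<le> 1" and hK: "(\<Sum>j<m. norm (h j)) \<le> K"
      and rep0: "\<And>f. f \<in> I \<Longrightarrow> f = (\<Sum>j<m. cblinfun_apply f (\<xi> j) *\<^sub>C h j)"
    using loc[of I] I B(1) by blast
  have K0: "K \<ge> 0" using hK sum_nonneg[of "{..<m}" "\<lambda>j. norm (h j)"] by simp
  define U where "U = {f. f = (\<Sum>j<m. cblinfun_apply f (\<xi> j) *\<^sub>C h j)}"
  have "complex_vector.subspace U"
    unfolding complex_vector.subspace_def
  proof (intro conjI ballI allI)
    show "0 \<in> U" by (simp add: U_def)
    show "x + y \<in> U" if "x \<in> U" "y \<in> U" for x y
      using that by (simp add: U_def cblinfun_apply_add scaleC_add_left sum.distrib)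
    show "c *\<^sub>C x \<in> U" if "x \<in> U" for c x
    proof -
      have "c *\<^sub>C x = c *\<^sub>C (\<Sum>j<m. x (\<xi> j) *\<^sub>C h j)" using that by (simp add: U_def)
      also have "\<dots> = (\<Sum>j<m. (c *\<^sub>C x) (\<xi> j) *\<^sub>C h j)"
        by (simp add: complex_vector.scale_sum_right cblinfun_apply_scaleC scaleC_complex_def scaleC_scaleC)
      finally show ?thesis by (simp add: U_def)
    qed
  qed
  moreover have "I \<subseteq> U" using rep0 by (auto simp: U_def)
  ultimately have "complex_vector.span I \<subseteq> U" by (intro complex_vector.span_minimal)
  then have rep: "f = (\<Sum>j<m. f (\<xi> j) *\<^sub>C h j)" if "f \<in> complex_vector.span I" for f
    using that by (auto simp: U_def)
  define ip where "ip f g = (\<Sum>j<m. complex_of_real (norm (h j)) * cblinfun_apply f (\<xi> j) * cnj (cblinfun_apply g (\<xi> j)))"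
    for f g :: "'a cdual"
  have sq: "z * cnj z = complex_of_real ((cmod z)\<^sup>2)" for z
    by (simp add: complex_norm_square[symmetric])
  have ip_self: "ip f f = complex_of_real (\<Sum>j<m. norm (h j) * (cmod (f (\<xi> j)))\<^sup>2)" for f
    unfolding ip_def of_real_sum mult.assoc sq by (intro sum.cong) simp_all
  \<comment> \<open>Cauchy-Schwarz for the representation of \<open>f\<close>, each weight
    \<open>norm (h j)\<close> being split into two square roots. This also makes the form definite
    on the span.\<close>
  have norm_le: "(norm f)\<^sup>2 \<le> K * Re (ip f f)" if f: "f \<in> complex_vector.span I" for f
  proof -
    have "norm f \<le> (\<Sum>j<m. norm (f (\<xi> j) *\<^sub>C h j))" by (subst rep[OF f]) (rule norm_sum)
    also have "\<dots> = (\<Sum>j<m. sqrt (norm (h j)) * (sqrt (norm (h j)) * cmod (f (\<xi> j))))"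
      by (intro sum.cong) (auto simp: norm_scaleC simp flip: mult.assoc)
    also have "\<dots> \<le> L2_set (\<lambda>j. sqrt (norm (h j))) {..<m} * L2_set (\<lambda>j. sqrt (norm (h j)) * cmod (f (\<xi> j))) {..<m}"
      using L2_set_mult_ineq[of "\<lambda>j. sqrt (norm (h j))" "\<lambda>j. sqrt (norm (h j)) * cmod (f (\<xi> j))" "{..<m}"] by simp
    finally have "(norm f)\<^sup>2 \<le> (L2_set (\<lambda>j. sqrt (norm (h j))) {..<m} * L2_set (\<lambda>j. sqrt (norm (h j)) * cmod (f (\<xi> j))) {..<m})\<^sup>2"
      by (rule power_mono) simp
    also have "\<dots> = (\<Sum>j<m. norm (h j)) * Re (ip f f)"
      unfolding power_mult_distrib L2_set_def by (simp add: sum_nonneg ip_self power_mult_distrib)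
    also have "\<dots> \<le> K * Re (ip f f)"
      using hK by (intro mult_right_mono) (auto simp: ip_self sum_nonneg)
    finally show ?thesis .
  qed
  have "\<exists>e :: nat \<Rightarrow> 'a cdual. (\<forall>i<n. e i \<in> complex_vector.span I) \<and>
    (\<forall>i<n. \<forall>j<n. ip (e i) (e j) = (if i = j then 1 else 0))"
  proof (rule orthonormal_family[OF _ _ _ _ I(2) indep])
    show "ip (x + y) z = ip x z + ip y z" for x y z
      by (simp add: ip_def cblinfun_apply_add algebra_simps sum.distrib)
    show "ip (c *\<^sub>C x) z = c * ip x z" for c x z
      by (simp add: ip_def cblinfun_apply_scaleC scaleC_complex_def sum_distrib_left mult_ac)
    show "ip y x = cnj (ip x y)" for x y
      by (simp add: ip_def mult_ac)
    show "Re (ip x x) > 0" if "x \<in> complex_vector.span I" "x \<noteq> 0" for x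
    proof -
      have "0 < (norm x)\<^sup>2" using that(2) by simp
      then have "0 < K * Re (ip x x)" using norm_le[OF that(1)] by linarith
      then show ?thesis using K0 by (simp add: zero_less_mult_iff)
    qed
  qed (simp add: I(3))
  then obtain e :: "nat \<Rightarrow> 'a cdual" where e: "\<And>i. i < n \<Longrightarrow> e i \<in> complex_vector.span I"
    and on: "\<And>i j. i < n \<Longrightarrow> j < n \<Longrightarrow> ip (e i) (e j) = (if i = j then 1 else 0)" by blast
  \<comment> \<open>Evaluation at \<open>\<xi> j\<close> has squared Hilbert norm at most
    \<open>K\<close>: the combination \<open>f\<close> of the \<open>e i\<close> with the conjugate
    values as coefficients takes the value \<open>s\<close> at \<open>\<xi> j\<close> and has
    squared Hilbert norm \<open>s\<close>, so that \<open>s * s \<le> K * s\<close>.\<close>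
  have pointwise: "(\<Sum>i<n. (cmod (e i (\<xi> j)))\<^sup>2) \<le> K" if j: "j < m" for j
  proof -
    define s where "s = (\<Sum>i<n. (cmod (e i (\<xi> j)))\<^sup>2)"
    have s0: "s \<ge> 0" by (simp add: s_def sum_nonneg)
    define c where "c i = cnj (cblinfun_apply (e i) (\<xi> j))" for i
    define f where "f = (\<Sum>i<n. c i *\<^sub>C e i)"
    have fI: "f \<in> complex_vector.span I"
      unfolding f_def by (intro complex_vector.span_sum complex_vector.span_scale) (use e in auto)
    have app: "f x = (\<Sum>i<n. c i * e i x)" for x
      unfolding f_def by (induction n) (auto simp: cblinfun_apply_add cblinfun_apply_scaleC scaleC_complex_def)
    have cc: "(\<Sum>i<n. c i * cnj (c i)) = complex_of_real s"
      unfolding s_def of_real_sum sq by (simp add: c_def)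
    have ip_left: "ip f g = (\<Sum>i<n. c i * ip (e i) g)" for g
      unfolding ip_def app sum_distrib_left sum_distrib_right
      by (subst sum.swap) (simp add: mult_ac)
    have ip_right: "ip g f = (\<Sum>i<n. cnj (c i) * ip g (e i))" for g
      unfolding ip_def app sum_distrib_left sum_distrib_right cnj_sum
      by (subst sum.swap) (simp add: mult_ac)
    have "ip f f = (\<Sum>i<n. c i * cnj (c i))"
      unfolding ip_left
    proof (intro sum.cong refl arg_cong2[where f = "(*)"])
      fix i assume i: "i \<in> {..<n}"
      have "ip (e i) f = (\<Sum>k<n. if k = i then cnj (c i) else 0)"
        unfolding ip_right using i on by (intro sum.cong) auto
      then show "ip (e i) f = cnj (c i)" using i by simp
    qed
    then have ff: "Re (ip f f) = s" using cc by simp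
    have "f (\<xi> j) = (\<Sum>i<n. c i * cnj (c i))" unfolding app by (simp add: c_def)
    then have "s = cmod (f (\<xi> j))" using s0 cc by simp
    also have "\<dots> \<le> norm f * norm (\<xi> j)" by (rule norm_cblinfun)
    also have "\<dots> \<le> norm f" using \<xi>[OF j] mult_left_mono[of "norm (\<xi> j)" 1 "norm f"] by simp
    finally have "s * s \<le> (norm f)\<^sup>2" using s0 by (simp add: power2_eq_square mult_mono)
    also have "\<dots> \<le> K * s" using norm_le[OF fI] ff by simp
    finally show ?thesis
      using s0 K0 unfolding s_def[symmetric] by (cases "s = 0") (auto simp: mult_le_cancel_right)
  qed
  \<comment> \<open>A Hilbert-Schmidt count: after exchanging the sums, the pointwise bound
    \<open>K\<close> is weighted by the \<open>norm (h j)\<close>, whose total is at most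
    \<open>K\<close> again.\<close>
  have "real n = (\<Sum>i<n. Re (ip (e i) (e i)))" by (simp add: on)
  also have "\<dots> = (\<Sum>j<m. norm (h j) * (\<Sum>i<n. (cmod (e i (\<xi> j)))\<^sup>2))"
    unfolding ip_self Re_complex_of_real sum_distrib_left by (rule sum.swap)
  also have "\<dots> \<le> (\<Sum>j<m. norm (h j) * K)"
    by (intro sum_mono mult_left_mono pointwise) auto
  also have "\<dots> \<le> K * K" using hK K0 by (simp add: mult_right_mono flip: sum_distrib_right)
  finally show False using n by simp
qed

section \<open>Elementary approximable operators\<close>

type_synonym 'a trace_tensor = "('a, 'a cdual) proj_tensor"

lemmas tensor_bilinear = cbilinear_simps[OF conjunct1[OF bounded_cbilinear_tensor[unfolded bounded_cbilinear_def]]]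

definition elem_op :: "'a::complex_banach \<Rightarrow> 'a cdual \<Rightarrow> 'a approx_op"
  where "elem_op x f = Abs_approx_op (rank_one x f)"

lemma op_of_elem_op [simp]: "op_of_approx (elem_op x f) = rank_one x f"
proof -
  have "rank_one x f \<in> approximable_operators"
    unfolding approximable_operators_def
    by (rule subsetD[OF closure_subset]) (simp add: finite_rank_rank_one)
  then show ?thesis by (simp add: elem_op_def Abs_approx_op_inverse)
qed

lemma approx_op_eqI:
  assumes "\<And>\<xi>. op_of_approx a \<xi> = op_of_approx b \<xi>"
  shows "a = b"
  using cblinfun_eqI[of "op_of_approx a" "op_of_approx b"] assms by (simp add: op_of_approx_inject)

lemma elem_op_mult:
  "elem_op x f * elem_op y g = f y *\<^sub>C elem_op x g"
  "a * elem_op y g = elem_op (op_of_approx a y) g"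
  "elem_op x f * a = elem_op x (f o\<^sub>C\<^sub>L op_of_approx a)"
  by (auto intro!: approx_op_eqI simp: times_approx_op.rep_eq scaleC_approx_op.rep_eq rank_one_apply
      cblinfun_apply_scaleC cblinfun_scaleC_arg scaleC_scaleC scaleC_complex_def mult.commute)

lemma bounded_cbilinear_elem_op: "bounded_cbilinear elem_op"
proof -
  have "norm (elem_op x f) \<le> 1 * norm x * norm f" for x :: 'a and f
    unfolding norm_approx_op.rep_eq op_of_elem_op
  proof (rule norm_cblinfun_bound)
    show "norm (rank_one x f \<xi>) \<le> 1 * norm x * norm f * norm \<xi>" for \<xi>
      using mult_right_mono[OF norm_cblinfun[of f \<xi>], of "norm x"]
      by (simp add: rank_one_apply norm_scaleC mult_ac)
  qed simp
  moreover have "cbilinear (elem_op :: 'a \<Rightarrow> _)"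
    unfolding cbilinear_def clinear_iff
    by (auto intro!: approx_op_eqI simp: plus_approx_op.rep_eq scaleC_approx_op.rep_eq rank_one_apply
        cblinfun_apply_add cblinfun_apply_scaleC scaleC_add_left scaleC_add_right scaleC_scaleC
        scaleC_complex_def mult.commute)
  ultimately show ?thesis unfolding bounded_cbilinear_def by blast
qed

lemma op_of_form_sum_elem_op: "op_of_approx (form_sum elem_op ps) = form_sum rank_one ps"
  by (induction ps) (auto simp: zero_approx_op.rep_eq plus_approx_op.rep_eq)

lemma elem_op_dense:
  fixes a :: "'a::complex_banach approx_op"
  assumes "e > 0"
  obtains ps where "norm (form_sum elem_op ps - a) < e"
proof -
  have "op_of_approx a \<in> closure {T. finite_rank T}"
    using op_of_approx[of a] by (simp add: approximable_operators_def)
  then obtain F where F: "finite_rank F" "dist F (op_of_approx a) < e"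
    using assms unfolding closure_approachable by blast
  obtain ps where "F = form_sum rank_one ps" using finite_rank_as_rank_one_sum[OF F(1)] .
  then show ?thesis
    using that[of ps] F(2)
    by (simp add: norm_approx_op.rep_eq minus_approx_op.rep_eq op_of_form_sum_elem_op dist_norm)
qed

lemma closed_property_dense:
  fixes a :: "'a::real_normed_vector"
  assumes "closed {a. P a}" "\<And>e. e > 0 \<Longrightarrow> \<exists>b. P b \<and> norm (b - a) < e"
  shows "P a"
proof -
  have "a \<in> closure {a. P a}" unfolding closure_approachable dist_norm using assms(2) by blast
  then show ?thesis using assms(1) by (simp add: closure_closed)
qed

lemma approx_op_dense_induct:
  fixes a :: "'a::complex_banach approx_op"
  assumes "closed {a. P a}" "\<And>ps. P (form_sum elem_op ps)"
  shows "P a"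
  by (rule closed_property_dense[OF assms(1)]) (metis elem_op_dense assms(2))

lemma proj_tensor_dense_induct:
  assumes "closed {u. P u}" "\<And>ps. P (form_sum (\<otimes>) ps)"
  shows "P u"
  by (rule closed_property_dense[OF assms(1)]) (metis tensor_dense assms(2))

lemma continuous_on_cblinfun_apply:
  "continuous_on S g \<Longrightarrow> continuous_on S (\<lambda>x. cblinfun_apply f (g x))"
  by (rule bounded_linear.continuous_on[OF bounded_linear_cblinfun_apply])

lemma approx_cblinfun_eqI:
  fixes L M :: "'a::complex_banach approx_op \<Rightarrow>\<^sub>C\<^sub>L 'b::complex_normed_vector"
  assumes "\<And>x f. L (elem_op x f) = M (elem_op x f)"
  shows "L = M"
proof (rule cblinfun_eqI)
  have eq: "form_sum (\<lambda>x f. L (elem_op x f)) ps = form_sum (\<lambda>x f. M (elem_op x f)) ps" for ps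
    using assms by (induction ps) auto
  show "L a = M a" for a
    by (rule approx_op_dense_induct[where P = "\<lambda>a. L a = M a"])
      (auto intro!: closed_Collect_eq continuous_on_cblinfun_apply simp: cblinfun_form_sum eq)
qed

lemma proj_tensor_cblinfun_eqI:
  fixes L M :: "('a::complex_normed_vector, 'b::complex_normed_vector) proj_tensor \<Rightarrow>\<^sub>C\<^sub>L 'c::complex_normed_vector"
  assumes "\<And>x y. L (x \<otimes> y) = M (x \<otimes> y)"
  shows "L = M"
proof (rule cblinfun_eqI)
  have eq: "form_sum (\<lambda>x y. L (x \<otimes> y)) ps = form_sum (\<lambda>x y. M (x \<otimes> y)) ps" for ps
    using assms by (induction ps) auto
  show "L u = M u" for u
    by (rule proj_tensor_dense_induct[where P = "\<lambda>u. L u = M u"])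
      (auto intro!: closed_Collect_eq continuous_on_cblinfun_apply simp: cblinfun_form_sum eq)
qed

section \<open>Operator trace, scalar trace and the dual of the projective tensor product\<close>

definition approx_inclusion :: "'a::complex_banach approx_op \<Rightarrow>\<^sub>C\<^sub>L ('a \<Rightarrow>\<^sub>C\<^sub>L 'a)"
  where "approx_inclusion = CBlinfun op_of_approx"

lemma approx_inclusion_apply: "approx_inclusion a = op_of_approx a"
proof -
  have "bounded_clinear (op_of_approx :: 'a approx_op \<Rightarrow> _)"
    by (rule bounded_clinear_intro[where K = 1])
      (simp_all add: plus_approx_op.rep_eq scaleC_approx_op.rep_eq norm_approx_op.rep_eq)
  then show ?thesis by (simp add: approx_inclusion_def CBlinfun_apply)
qed

text \<open>\<open>Tr\<close> with values in the algebra type instead of the space of all operators,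
  so that condition (a) becomes surjectivity.\<close>

definition approx_trace :: "'a::complex_banach trace_tensor \<Rightarrow>\<^sub>C\<^sub>L 'a approx_op"
  where "approx_trace = tensor_lift elem_op"

lemma approx_trace_tensor: "approx_trace (x \<otimes> f) = elem_op x f"
  by (simp add: approx_trace_def tensor_lift_tensor[OF bounded_cbilinear_elem_op])

lemma approx_trace_form_sum: "approx_trace (form_sum (\<otimes>) ps) = form_sum elem_op ps"
  by (simp add: cblinfun_form_sum approx_trace_tensor)

lemma op_of_approx_trace: "op_of_approx (approx_trace u) = operator_trace u"
proof -
  have "approx_inclusion o\<^sub>C\<^sub>L approx_trace = (operator_trace :: 'a trace_tensor \<Rightarrow>\<^sub>C\<^sub>L _)"
    by (intro proj_tensor_cblinfun_eqI cblinfun_eqI)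
      (simp add: approx_inclusion_apply approx_trace_tensor operator_trace_tensor rank_one_apply)
  then show ?thesis by (metis approx_inclusion_apply cblinfun_compose_apply)
qed

lemma kernel_operator_trace: "kernel operator_trace = kernel approx_trace"
proof -
  have "operator_trace u = 0 \<longleftrightarrow> approx_trace u = 0" for u :: "'a trace_tensor"
    by (metis op_of_approx_inject op_of_approx_trace zero_approx_op.rep_eq)
  then show ?thesis by (simp add: kernel_def)
qed

lemma bounded_cbilinear_functional_apply:
  "bounded_cbilinear (\<lambda>x f. cblinfun_apply (f :: 'a::complex_normed_vector cdual) x)"
  unfolding bounded_cbilinear_def cbilinear_def clinear_iff
  using norm_cblinfun
  by (auto simp: cblinfun.add_right cblinfun_apply_add cblinfun_scaleC_arg cblinfun_apply_scaleC
      mult.commute intro!: exI[of _ 1])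

definition scalar_trace :: "'a::complex_banach trace_tensor \<Rightarrow>\<^sub>C\<^sub>L complex"
  where "scalar_trace = tensor_lift (\<lambda>x f. cblinfun_apply f x)"

lemma scalar_trace_tensor: "scalar_trace (x \<otimes> f) = f x"
  by (simp add: scalar_trace_def tensor_lift_tensor[OF bounded_cbilinear_functional_apply])

lemma norm_tensor_le: "norm (x \<otimes> y) \<le> norm x * norm y"
  using projective_norm_le_cost[of "[(x, y)]" "[(x, y)]"] norm_form_sum_tensor[of "[(x, y)]"] by simp

lemma bounded_cbilinear_compose:
  assumes "bounded_cbilinear B"
  shows "bounded_cbilinear (\<lambda>x y. B (cblinfun_apply S x) (cblinfun_apply T y))"
proof -
  obtain K where B: "cbilinear B" and K: "\<And>x y. norm (B x y) \<le> K * norm x * norm y"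
    using assms unfolding bounded_cbilinear_def by blast
  have "norm (B (S x) (T y)) \<le> (\<bar>K\<bar> * norm S * norm T) * norm x * norm y" for x y
  proof -
    have "norm (B (S x) (T y)) \<le> \<bar>K\<bar> * (norm (S x) * norm (T y))"
      using K[of "S x" "T y"] mult_right_mono[OF abs_ge_self[of K], of "norm (S x) * norm (T y)"]
      by (simp add: mult.assoc)
    also have "\<dots> \<le> \<bar>K\<bar> * ((norm S * norm x) * (norm T * norm y))"
      by (intro mult_left_mono mult_mono norm_cblinfun) auto
    finally show ?thesis by (simp add: mult_ac)
  qed
  moreover have "cbilinear (\<lambda>x y. B (S x) (T y))"
    using B by (simp add: cbilinear_def clinear_iff cblinfun.add_right cblinfun_scaleC_arg)
  ultimately show ?thesis unfolding bounded_cbilinear_def by blast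
qed

text \<open>The duality between \<open>X \<otimes> X\<^sup>*\<close> and the operators on \<open>X\<^sup>*\<close>.\<close>

definition tensor_functional ::
  "('a::complex_banach cdual \<Rightarrow>\<^sub>C\<^sub>L 'a cdual) \<Rightarrow> 'a trace_tensor \<Rightarrow>\<^sub>C\<^sub>L complex"
  where "tensor_functional T = tensor_lift (\<lambda>x f. cblinfun_apply (T f) x)"

lemma tensor_functional_tensor: "tensor_functional T (x \<otimes> f) = T f x"
proof -
  have "bounded_cbilinear (\<lambda>x f. cblinfun_apply (T f) x)"
    using bounded_cbilinear_compose[OF bounded_cbilinear_functional_apply, of T cblinfun_id] by simp
  then show ?thesis by (simp add: tensor_functional_def tensor_lift_tensor)
qed

lemma tensor_functional_ex:
  fixes \<phi> :: "'a::complex_banach trace_tensor cdual"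
  obtains T where "\<phi> = tensor_functional T" "norm T \<le> norm \<phi>"
proof -
  have b: "cmod (\<phi> (x \<otimes> f)) \<le> norm x * (norm \<phi> * norm f)" for x f
    using norm_cblinfun[of \<phi> "x \<otimes> f"] mult_left_mono[OF norm_tensor_le[of x f], of "norm \<phi>"]
    by (simp add: mult_ac)
  have bl: "bounded_clinear (\<lambda>x. \<phi> (x \<otimes> f))" for f
    by (rule bounded_clinear_intro[where K = "norm \<phi> * norm f"])
      (auto simp: tensor_bilinear cblinfun.add_right cblinfun_scaleC_arg b)
  define t where "t f = CBlinfun (\<lambda>x. \<phi> (x \<otimes> f))" for f
  have t: "t f x = \<phi> (x \<otimes> f)" for f x by (simp add: t_def CBlinfun_apply[OF bl])
  have tb: "norm (t f) \<le> norm f * norm \<phi>" for f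
    by (rule norm_cblinfun_bound) (use b in \<open>auto simp: t mult_ac\<close>)
  have "bounded_clinear t"
    by (rule bounded_clinear_intro[where K = "norm \<phi>"])
      (auto intro!: cblinfun_eqI simp: t tensor_bilinear cblinfun.add_right cblinfun_scaleC_arg cblinfun_apply_add
        cblinfun_apply_scaleC tb)
  then have T: "CBlinfun t f = t f" for f by (simp add: CBlinfun_apply)
  show ?thesis
  proof (rule that[of "CBlinfun t"])
    show "\<phi> = tensor_functional (CBlinfun t)"
      by (rule proj_tensor_cblinfun_eqI) (simp add: tensor_functional_tensor T t)
    show "norm (CBlinfun t) \<le> norm \<phi>"
      by (rule norm_cblinfun_bound) (use tb in \<open>simp_all add: T mult.commute\<close>)
  qed
qed

text \<open>All functionals on P are reduced to one, the scalar trace, at the price of applying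
  \<open>T\<close> to the second factors.\<close>

lemma tensor_functional_form_sum:
  "tensor_functional T (form_sum (\<otimes>) ps) = scalar_trace (form_sum (\<otimes>) (map (\<lambda>(y, g). (y, T g)) ps))"
  by (induction ps) (auto simp: cblinfun.zero_right cblinfun.add_right tensor_functional_tensor scalar_trace_tensor)

lemma functional_compose_simps:
  fixes h :: "'b::complex_normed_vector cdual"
  shows "h o\<^sub>C\<^sub>L 0 = 0" "h o\<^sub>C\<^sub>L (a + b) = (h o\<^sub>C\<^sub>L a) + (h o\<^sub>C\<^sub>L b)"
    "h o\<^sub>C\<^sub>L rank_one x f = h x *\<^sub>C f"
  by (intro cblinfun_eqI; simp add: cblinfun.zero_right cblinfun_apply_add cblinfun.add_right
      rank_one_apply cblinfun_scaleC_arg cblinfun_apply_scaleC scaleC_complex_def mult.commute)+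

text \<open>With \<open>a\<close> the original and \<open>b\<close> the twisted operator,
  \<open>h o\<^sub>C\<^sub>L b\<close> equals \<open>T (h o\<^sub>C\<^sub>L a)\<close>: the adjoint
  of \<open>b\<close> is \<open>T\<close> after the adjoint of \<open>a\<close>. The norm of
  \<open>b\<close> is then read off by functionals \<open>h\<close> of norm at most 1. This covers
  every bounded \<open>T\<close>, weak-star continuous or not.\<close>

lemma norm_form_sum_twist:
  fixes T :: "'a::complex_banach cdual \<Rightarrow>\<^sub>C\<^sub>L 'a cdual"
  shows "norm (form_sum elem_op (map (\<lambda>(y, g). (y, T g)) ps)) \<le> norm T * norm (form_sum elem_op ps)"
  unfolding norm_approx_op.rep_eq op_of_form_sum_elem_op
proof (rule norm_cblinfun_bound)
  define a where "a = form_sum rank_one ps"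
  define b where "b = form_sum rank_one (map (\<lambda>(y, g). (y, T g)) ps)"
  show "norm (b \<xi>) \<le> norm T * norm a * norm \<xi>" for \<xi>
  proof (rule norm_le_functionals)
    fix h :: "'a cdual" assume hn: "norm h \<le> 1"
    have "h (b \<xi>) = T (h o\<^sub>C\<^sub>L a) \<xi>"
      unfolding a_def b_def
      by (induction ps) (auto simp: functional_compose_simps cblinfun.zero_right cblinfun.add_right
          cblinfun_apply_add rank_one_apply cblinfun_scaleC_arg cblinfun_apply_scaleC scaleC_complex_def
          mult.commute)
    also have "cmod \<dots> \<le> norm (T (h o\<^sub>C\<^sub>L a)) * norm \<xi>" by (rule norm_cblinfun)
    also have "\<dots> \<le> (norm T * norm a) * norm \<xi>"
    proof (rule mult_right_mono)
      have "norm (h o\<^sub>C\<^sub>L a) \<le> 1 * norm a"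
        by (rule order_trans[OF norm_cblinfun_compose]) (rule mult_right_mono[OF hn norm_ge_zero])
      then show "norm (T (h o\<^sub>C\<^sub>L a)) \<le> norm T * norm a"
        by (intro order_trans[OF norm_cblinfun] mult_left_mono) auto
    qed simp
    finally show "cmod (h (b \<xi>)) \<le> norm T * norm a * norm \<xi>" .
  qed
qed simp

section \<open>Nuclear operators and the injective norm\<close>

lemma form_sum_tensor_cong:
  assumes "tensor_equiv ps qs"
  shows "form_sum (\<otimes>) ps = form_sum (\<otimes>) qs"
proof -
  have "alg_tensor_of ps = alg_tensor_of qs" using assms by transfer
  then show ?thesis by (simp flip: form_sum_tensor)
qed

lemma tensor_approximation:
  assumes e: "e > 0"
  obtains ps where "norm (u - form_sum (\<otimes>) ps) < e" "tensor_cost ps \<le> norm u + e"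
proof -
  have e3: "e / 3 > 0" using e by simp
  obtain qs where qs: "norm (form_sum (\<otimes>) qs - u) < e / 3" using tensor_dense[OF e3] .
  obtain ps where ps: "tensor_equiv qs ps" "tensor_cost ps < projective_norm qs + e / 3"
    using projective_norm_approx[OF e3] .
  have "projective_norm qs \<le> norm u + e / 3"
    using norm_form_sum_tensor[of qs] qs norm_triangle_ineq2[of "form_sum (\<otimes>) qs" u] by simp
  moreover have "norm (u - form_sum (\<otimes>) ps) < e / 3"
    using qs form_sum_tensor_cong[OF ps(1)] by (simp add: norm_minus_commute)
  ultimately show ?thesis using ps(2) e by (intro that[of ps]) auto
qed

text \<open>Grothendieck's representation of a tensor. Finite tensors approximate the successive
  remainders with geometric error; their costs are summable because the norms of the remainders are.
  The double family so obtained is enumerated as one sequence.\<close>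

lemma tensor_series:
  fixes u :: "('a::complex_normed_vector, 'b::complex_normed_vector) proj_tensor"
  obtains x y where "summable (\<lambda>n::nat. norm (x n) * norm (y n))" "(\<lambda>n. x n \<otimes> y n) sums u"
proof -
  define e :: "nat \<Rightarrow> real" where "e k = (1 / 2) ^ k" for k
  have e: "e k > 0" for k by (simp add: e_def)
  have e_sum: "summable e" unfolding e_def by (rule summable_geometric) simp
  define next_ps where "next_ps k v = (SOME ps. norm (v - form_sum (\<otimes>) ps) < e k \<and> tensor_cost ps \<le> norm v + e k)"
    for k and v :: "('a, 'b) proj_tensor"
  have next_ps: "norm (v - form_sum (\<otimes>) (next_ps k v)) < e k" "tensor_cost (next_ps k v) \<le> norm v + e k" for k v
  proof -
    have "\<exists>ps. norm (v - form_sum (\<otimes>) ps) < e k \<and> tensor_cost ps \<le> norm v + e k"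
      using tensor_approximation[OF e[of k], of v] by metis
    from someI_ex[OF this] show "norm (v - form_sum (\<otimes>) (next_ps k v)) < e k"
      "tensor_cost (next_ps k v) \<le> norm v + e k" by (simp_all add: next_ps_def)
  qed
  define v where "v = rec_nat u (\<lambda>k w. w - form_sum (\<otimes>) (next_ps k w))"
  have v0: "v 0 = u" and vS: "v (Suc k) = v k - form_sum (\<otimes>) (next_ps k (v k))" for k
    by (simp_all add: v_def)
  define ps where "ps k = next_ps k (v k)" for k
  have vn: "norm (v (Suc k)) \<le> e k" for k
    unfolding vS by (rule less_imp_le[OF next_ps(1)])
  have "summable (\<lambda>k. norm (v (Suc k)))"
    by (rule summable_comparison_test'[OF e_sum, where N = 0]) (simp add: vn)
  then have v_sum: "summable (\<lambda>k. norm (v k))"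
    using summable_Suc_iff[of "\<lambda>k. norm (v k)"] by blast
  have cost_sum: "summable (\<lambda>k. tensor_cost (ps k))"
    by (rule summable_comparison_test'[OF summable_add[OF v_sum e_sum], where N = 0])
      (simp add: ps_def next_ps(2))
  have "(\<Sum>k<n. form_sum (\<otimes>) (ps k)) = u - v n" for n
    by (induction n) (simp_all add: v0 vS ps_def)
  moreover have "v \<longlonglongrightarrow> 0" using summable_LIMSEQ_zero[OF v_sum] by (rule tendsto_norm_zero_cancel)
  then have "(\<lambda>n. u - v n) \<longlonglongrightarrow> u - 0" by (intro tendsto_diff tendsto_const)
  ultimately have ps_sums: "(\<lambda>k. form_sum (\<otimes>) (ps k)) sums u" by (simp add: sums_def)
  \<comment> \<open>The list \<open>ps k\<close> becomes row \<open>k\<close> of an infinite matrix,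
    filled up with zeros, which add neither cost nor tensor.\<close>
  define X where "X p = (if snd p < length (ps (fst p)) then fst (ps (fst p) ! snd p) else 0)" for p
  define Y where "Y p = (if snd p < length (ps (fst p)) then snd (ps (fst p) ! snd p) else 0)" for p
  have form_sum_nth: "form_sum B (ps k) = (\<Sum>i<length (ps k). B (X (k, i)) (Y (k, i)))"
    for k and B :: "'a \<Rightarrow> 'b \<Rightarrow> 'c::comm_monoid_add"
    unfolding form_sum_def sum_list_sum_nth by (simp add: X_def Y_def atLeast0LessThan case_prod_beta)
  have cost_nth: "tensor_cost (ps k) = (\<Sum>i<length (ps k). norm (X (k, i)) * norm (Y (k, i)))" for k
    unfolding tensor_cost_def sum_list_sum_nth by (simp add: X_def Y_def atLeast0LessThan case_prod_beta)
  have inner: "((\<lambda>i. norm (X (k, i)) * norm (Y (k, i))) has_sum tensor_cost (ps k)) UNIV" for k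
    by (rule has_sum_finite_neutralI[of "{..<length (ps k)}"]) (auto simp: cost_nth X_def)
  have inner': "((\<lambda>i. X (k, i) \<otimes> Y (k, i)) has_sum form_sum (\<otimes>) (ps k)) UNIV" for k
    by (rule has_sum_finite_neutralI[of "{..<length (ps k)}"]) (auto simp: form_sum_nth X_def tensor_bilinear)
  have "(\<lambda>p. norm (norm (X p) * norm (Y p))) summable_on Sigma UNIV (\<lambda>_. UNIV)"
  proof (rule iffD2[OF Infinite_Sum.abs_summable_on_Sigma_iff], intro conjI ballI)
    show "(\<lambda>i. norm (norm (X (k, i)) * norm (Y (k, i)))) summable_on UNIV" for k
      using has_sum_imp_summable[OF inner[of k]] by (simp add: abs_mult)
    have "(\<Sum>\<^sub>\<infinity>i. norm (norm (X (k, i)) * norm (Y (k, i)))) = tensor_cost (ps k)" for k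
      using infsumI[OF inner[of k]] by (simp add: abs_mult)
    then show "(\<lambda>k. norm (\<Sum>\<^sub>\<infinity>i. norm (norm (X (k, i)) * norm (Y (k, i))))) summable_on UNIV"
      using cost_sum by (simp add: summable_on_UNIV_nonneg_real_iff)
  qed
  then have N: "(\<lambda>p. norm (X p) * norm (Y p)) summable_on UNIV"
    by (simp add: abs_mult)
  then have Nd: "(\<lambda>n. norm (X (prod_decode n)) * norm (Y (prod_decode n))) summable_on UNIV"
    using summable_on_reindex_bij_betw[OF bij_prod_decode, of "\<lambda>p. norm (X p) * norm (Y p)"] by simp
  have "(\<lambda>p. norm (X p \<otimes> Y p)) summable_on UNIV"
    by (rule summable_on_comparison_test[OF N]) (auto simp: norm_tensor_le)
  then have "(\<lambda>p. X p \<otimes> Y p) summable_on UNIV" by (rule abs_summable_summable)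
  then obtain s where s: "((\<lambda>p. X p \<otimes> Y p) has_sum s) (Sigma UNIV (\<lambda>_. UNIV))"
    unfolding summable_on_def by auto
  \<comment> \<open>Absolute convergence lets the double sum be taken row by row, which identifies
    it as \<open>u\<close>, and afterwards in the order of \<open>prod_decode\<close>.\<close>
  have "((\<lambda>k. form_sum (\<otimes>) (ps k)) has_sum s) UNIV"
    by (rule has_sum_SigmaD[OF s]) (rule inner')
  then have "s = u" using has_sum_imp_sums ps_sums sums_unique2 by blast
  then have "((\<lambda>n. X (prod_decode n) \<otimes> Y (prod_decode n)) has_sum u) UNIV"
    using s has_sum_reindex_bij_betw[OF bij_prod_decode, of "\<lambda>p. X p \<otimes> Y p" u] by simp
  then have "(\<lambda>n. X (prod_decode n) \<otimes> Y (prod_decode n)) sums u" by (rule has_sum_imp_sums)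
  moreover have "summable (\<lambda>n. norm (X (prod_decode n)) * norm (Y (prod_decode n)))"
    using Nd by (rule summable_on_imp_summable)
  ultimately show ?thesis by (intro that[of "\<lambda>n. X (prod_decode n)" "\<lambda>n. Y (prod_decode n)"])
qed

text \<open>The norm condition lifts a pointwise convergent nuclear series to an absolutely
  convergent series of tensors; conversely every tensor is such a series.\<close>

lemma nuclear_operators_eq_range:
  "(nuclear_operators :: ('a::complex_banach \<Rightarrow>\<^sub>C\<^sub>L 'a) set) = range operator_trace"
proof (intro set_eqI iffI)
  fix T :: "'a \<Rightarrow>\<^sub>C\<^sub>L 'a"
  have series: "(\<lambda>n. cblinfun_apply (f n) \<xi> *\<^sub>C x n) sums operator_trace u \<xi>"
    if "(\<lambda>n. x n \<otimes> f n) sums u" for x :: "nat \<Rightarrow> 'a" and f u \<xi>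
    using bounded_linear.sums[OF cblinfun.bounded_linear_left[of \<xi>]
        bounded_linear.sums[OF bounded_linear_cblinfun_apply[of operator_trace] that]]
    by (simp add: operator_trace_tensor)
  {
    assume "T \<in> nuclear_operators"
    then obtain f :: "nat \<Rightarrow> 'a cdual" and x :: "nat \<Rightarrow> 'a"
      where fx: "summable (\<lambda>n. norm (f n) * norm (x n))" "\<And>\<xi>. (\<lambda>n. f n \<xi> *\<^sub>C x n) sums T \<xi>"
      unfolding nuclear_operators_def by blast
    have "summable (\<lambda>n. norm (x n \<otimes> f n))"
      by (rule summable_comparison_test'[OF fx(1), where N = 0])
        (use norm_tensor_le in \<open>simp add: mult.commute\<close>)
    then have "(\<lambda>n. x n \<otimes> f n) sums (\<Sum>n. x n \<otimes> f n)"
      by (rule summable_sums[OF summable_norm_cancel])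
    from series[OF this] have "T \<xi> = operator_trace (\<Sum>n. x n \<otimes> f n) \<xi>" for \<xi>
      using fx(2) sums_unique2 by blast
    then show "T \<in> range operator_trace" using cblinfun_eqI by blast
  next
    assume "T \<in> range operator_trace"
    then obtain u where u: "T = operator_trace u" by blast
    obtain x f where "summable (\<lambda>n::nat. norm (x n) * norm (f n))" "(\<lambda>n. x n \<otimes> f n) sums u"
      using tensor_series[of u] by blast
    then show "T \<in> nuclear_operators"
      unfolding nuclear_operators_def u using series
      by (intro CollectI exI[of _ f] exI[of _ x]) (auto simp: mult.commute)
  }
qed

section \<open>Injective norm and integral operators\<close>

definition eval_functional :: "'a::complex_normed_vector \<Rightarrow> 'a cdual cdual"
  where "eval_functional x = CBlinfun (\<lambda>f. cblinfun_apply f x)"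

lemma eval_functional_apply: "eval_functional x f = f x"
  and norm_eval_functional: "norm (eval_functional x) \<le> norm x"
proof -
  have "bounded_clinear (\<lambda>f::'a cdual. cblinfun_apply f x)"
    by (rule bounded_clinear_intro[where K = "norm x"])
      (simp_all add: cblinfun_apply_add cblinfun_apply_scaleC norm_cblinfun)
  then show *: "eval_functional x f = f x" for f by (simp add: eval_functional_def CBlinfun_apply)
  show "norm (eval_functional x) \<le> norm x"
    by (rule norm_cblinfun_bound)
      (use norm_cblinfun in \<open>simp_all add: * mult.commute[of "norm x"]\<close>)
qed

lemma form_sum_functionals:
  fixes \<phi> :: "'a::complex_normed_vector cdual" and \<psi> :: "'b::complex_normed_vector cdual cdual"
  shows "form_sum (\<lambda>x g. \<phi> x * \<psi> g) ps = \<psi> (\<phi> o\<^sub>C\<^sub>L form_sum rank_one ps)"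
  by (induction ps) (auto simp: functional_compose_simps cblinfun.zero_right cblinfun.add_right
      cblinfun_scaleC_arg scaleC_complex_def)

text \<open>A pair of functionals evaluates the list to
  \<open>\<psi> (\<phi> o\<^sub>C\<^sub>L a)\<close>, which is at most \<open>norm a\<close>;
  evaluations at points of the unit ball, taken as \<open>\<psi>\<close>, already recover
  \<open>norm a\<close>. Integrality thereby means boundedness of a trace form in the operator
  norm.\<close>

lemma injective_norm_eq:
  fixes ps :: "('a::complex_normed_vector \<times> 'a cdual) list"
  shows "injective_norm ps = norm (form_sum rank_one ps :: 'a \<Rightarrow>\<^sub>C\<^sub>L 'a)"
proof -
  define S where "S = {cmod (form_sum (\<lambda>x y. cblinfun_apply \<phi> x * cblinfun_apply \<psi> y) ps) |
    (\<phi> :: 'a cdual) (\<psi> :: 'a cdual cdual). norm \<phi> \<le> 1 \<and> norm \<psi> \<le> 1}"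
  define a where "a = (form_sum rank_one ps :: 'a \<Rightarrow>\<^sub>C\<^sub>L 'a)"
  have le: "cmod (form_sum (\<lambda>x y. \<phi> x * \<psi> y) ps) \<le> norm a"
    if "norm \<phi> \<le> 1" "norm \<psi> \<le> 1" for \<phi> :: "'a cdual" and \<psi> :: "'a cdual cdual"
  proof -
    have "cmod (\<psi> (\<phi> o\<^sub>C\<^sub>L a)) \<le> norm \<psi> * (norm \<phi> * norm a)"
      by (intro order_trans[OF norm_cblinfun] mult_left_mono norm_cblinfun_compose norm_ge_zero)
    also have "\<dots> \<le> 1 * (1 * norm a)"
      using that by (intro mult_mono) auto
    finally show ?thesis by (simp add: form_sum_functionals a_def)
  qed
  have bdd: "bdd_above S" unfolding S_def by (rule bdd_aboveI[of _ "norm a"]) (use le in auto)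
  have mem: "cmod (form_sum (\<lambda>x y. \<phi> x * \<psi> y) ps) \<in> S"
    if "norm \<phi> \<le> 1" "norm \<psi> \<le> 1" for \<phi> :: "'a cdual" and \<psi> :: "'a cdual cdual"
    unfolding S_def using that by blast
  have "Sup S \<le> norm a"
    by (rule cSup_least) (use mem[of 0 0] le in \<open>auto simp: S_def\<close>)
  moreover have "norm a \<le> Sup S"
  proof (rule norm_cblinfun_unit_ball, rule norm_le_functionals)
    fix \<xi> :: 'a and h :: "'a cdual" assume \<xi>: "norm \<xi> \<le> 1" and h: "norm h \<le> 1"
    note h
    moreover have "norm (eval_functional \<xi>) \<le> 1" using norm_eval_functional[of \<xi>] \<xi> by linarith
    ultimately have "cmod (form_sum (\<lambda>x y. h x * eval_functional \<xi> y) ps) \<in> S" by (rule mem)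
    then have "cmod (form_sum (\<lambda>x y. h x * eval_functional \<xi> y) ps) \<le> Sup S"
      using bdd by (rule cSup_upper)
    then show "cmod (h (a \<xi>)) \<le> Sup S"
      unfolding form_sum_functionals by (simp add: eval_functional_apply a_def)
  qed
  ultimately show ?thesis unfolding injective_norm_def S_def a_def by (rule antisym)
qed

lemma integral_operator_iff:
  "T \<in> integral_operators \<longleftrightarrow> (\<exists>C. \<forall>ps :: ('a::complex_normed_vector \<times> 'a cdual) list.
    cmod (form_sum (\<lambda>x g. cblinfun_apply g (cblinfun_apply T x)) ps) \<le> C * norm (form_sum rank_one ps :: 'a \<Rightarrow>\<^sub>C\<^sub>L 'a))"
  unfolding integral_operators_def injective_norm_eq by blast

lemma subspace_integral_operators:
  "complex_vector.subspace (integral_operators :: ('a::complex_normed_vector \<Rightarrow>\<^sub>C\<^sub>L 'a) set)"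
  unfolding complex_vector.subspace_def
proof (intro conjI ballI allI)
  have "form_sum (\<lambda>x g. cblinfun_apply g (cblinfun_apply 0 x)) ps = 0" for ps :: "('a \<times> 'a cdual) list"
    by (induction ps) (auto simp: cblinfun.zero_right)
  then show "0 \<in> (integral_operators :: ('a \<Rightarrow>\<^sub>C\<^sub>L 'a) set)"
    unfolding integral_operator_iff by (intro exI[of _ 0]) simp
next
  fix S T :: "'a \<Rightarrow>\<^sub>C\<^sub>L 'a" and c
  assume S: "S \<in> integral_operators"
  then obtain C where C: "\<And>ps. cmod (form_sum (\<lambda>x g. cblinfun_apply g (S x)) ps) \<le> C * norm (form_sum rank_one ps :: 'a \<Rightarrow>\<^sub>C\<^sub>L 'a)"
    unfolding integral_operator_iff by blast
  have "form_sum (\<lambda>x g. cblinfun_apply g ((c *\<^sub>C S) x)) ps = c * form_sum (\<lambda>x g. cblinfun_apply g (S x)) ps" for ps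
    by (induction ps) (auto simp: cblinfun_apply_scaleC cblinfun_scaleC_arg scaleC_complex_def algebra_simps)
  then show "c *\<^sub>C S \<in> integral_operators"
    unfolding integral_operator_iff
    by (intro exI[of _ "cmod c * C"]) (simp add: norm_mult C mult.assoc mult_left_mono)
  assume "T \<in> integral_operators"
  then obtain D where D: "\<And>ps. cmod (form_sum (\<lambda>x g. cblinfun_apply g (T x)) ps) \<le> D * norm (form_sum rank_one ps :: 'a \<Rightarrow>\<^sub>C\<^sub>L 'a)"
    unfolding integral_operator_iff by blast
  have "form_sum (\<lambda>x g. cblinfun_apply g ((S + T) x)) ps
    = form_sum (\<lambda>x g. cblinfun_apply g (S x)) ps + form_sum (\<lambda>x g. cblinfun_apply g (T x)) ps"
    for ps :: "('a \<times> 'a cdual) list"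
    by (induction ps) (auto simp: cblinfun_apply_add cblinfun.add_right)
  then have "cmod (form_sum (\<lambda>x g. cblinfun_apply g ((S + T) x)) ps) \<le> (C + D) * norm (form_sum rank_one ps :: 'a \<Rightarrow>\<^sub>C\<^sub>L 'a)" for ps
    using norm_triangle_mono[OF C[of ps] D[of ps]] by (simp add: algebra_simps)
  then show "S + T \<in> integral_operators" unfolding integral_operator_iff by blast
qed

text \<open>Every functional on P of norm at most 1 comes from some \<open>T\<close> with
  \<open>norm T \<le> 1\<close>, so a bound on the traces of all twists bounds the projective norm
  by Hahn-Banach.\<close>

lemma projective_norm_le_twists:
  fixes ps :: "('a::complex_banach \<times> 'a cdual) list"
  assumes "\<And>T :: 'a cdual \<Rightarrow>\<^sub>C\<^sub>L 'a cdual. norm T \<le> 1 \<Longrightarrow>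
    cmod (scalar_trace (form_sum (\<otimes>) (map (\<lambda>(y, g). (y, cblinfun_apply T g)) ps))) \<le> B"
  shows "norm (form_sum (\<otimes>) ps) \<le> B"
proof (rule norm_le_functionals)
  fix \<phi> :: "'a trace_tensor cdual"
  assume "norm \<phi> \<le> 1"
  moreover obtain T where "\<phi> = tensor_functional T" "norm T \<le> norm \<phi>" by (rule tensor_functional_ex)
  ultimately show "cmod (\<phi> (form_sum (\<otimes>) ps)) \<le> B"
    using assms[of T] by (simp add: tensor_functional_form_sum)
qed

text \<open>A trace that is bounded in the operator norm makes the projective norm and the operator norm equivalent.\<close>

lemma trace_bounded_imp_injective:
  assumes bound: "\<And>ps :: ('a \<times> 'a cdual) list.
      cmod (scalar_trace (form_sum (\<otimes>) ps)) \<le> C * norm (form_sum elem_op ps)"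
    and u: "approx_trace (u :: 'a::complex_banach trace_tensor) = 0"
  shows "u = 0"
proof -
  have eq: "norm (form_sum (\<otimes>) ps) \<le> \<bar>C\<bar> * norm (form_sum elem_op ps)" for ps :: "('a \<times> 'a cdual) list"
  proof (rule projective_norm_le_twists)
    fix T :: "'a cdual \<Rightarrow>\<^sub>C\<^sub>L 'a cdual" assume T: "norm T \<le> 1"
    define rs where "rs = map (\<lambda>(y, g). (y, T g)) ps"
    have "norm (form_sum elem_op rs) \<le> 1 * norm (form_sum elem_op ps)"
      unfolding rs_def by (intro order_trans[OF norm_form_sum_twist] mult_right_mono T norm_ge_zero)
    then have "\<bar>C\<bar> * norm (form_sum elem_op rs) \<le> \<bar>C\<bar> * norm (form_sum elem_op ps)"
      by (intro mult_left_mono) auto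
    moreover have "C * norm (form_sum elem_op rs) \<le> \<bar>C\<bar> * norm (form_sum elem_op rs)"
      by (intro mult_right_mono) auto
    ultimately show "cmod (scalar_trace (form_sum (\<otimes>) rs)) \<le> \<bar>C\<bar> * norm (form_sum elem_op ps)"
      using bound[of rs] by linarith
  qed
  have "norm u \<le> \<bar>C\<bar> * norm (approx_trace u)" for u :: "'a trace_tensor"
    by (rule proj_tensor_dense_induct[where P = "\<lambda>u. norm u \<le> \<bar>C\<bar> * norm (approx_trace u)"])
      (auto intro!: closed_Collect_le continuous_on_cblinfun_apply continuous_on_norm continuous_on_mult
        simp: approx_trace_form_sum eq)
  from this[of u] show ?thesis using u by simp
qed

section \<open>Bounded bilinear maps\<close>

lemma bounded_cbilinear_flip:
  "bounded_cbilinear B \<Longrightarrow> bounded_cbilinear (\<lambda>x y. B y x)"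
  unfolding bounded_cbilinear_def cbilinear_def by (metis mult.commute mult.left_commute)

lemma bounded_cbilinear_add:
  assumes "bounded_cbilinear B" "bounded_cbilinear B'"
  shows "bounded_cbilinear (\<lambda>x y. B x y + B' x y)"
proof -
  obtain K K' where K: "\<And>x y. norm (B x y) \<le> K * norm x * norm y" "\<And>x y. norm (B' x y) \<le> K' * norm x * norm y"
    using assms unfolding bounded_cbilinear_def by blast
  have "norm (B x y + B' x y) \<le> (K + K') * norm x * norm y" for x y
    using norm_triangle_mono[OF K(1)[of x y] K(2)[of x y]] by (simp add: algebra_simps)
  moreover have "cbilinear (\<lambda>x y. B x y + B' x y)"
    using assms unfolding bounded_cbilinear_def cbilinear_def clinear_iff
    by (simp add: scaleC_add_right)
  ultimately show ?thesis unfolding bounded_cbilinear_def by blast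
qed

lemma bounded_cbilinear_post:
  assumes "bounded_cbilinear B"
  shows "bounded_cbilinear (\<lambda>x y. cblinfun_apply L (B x y))"
proof -
  obtain K where K: "\<And>x y. norm (B x y) \<le> K * norm x * norm y"
    using assms unfolding bounded_cbilinear_def by blast
  have "norm (L (B x y)) \<le> (norm L * K) * norm x * norm y" for x y
    using norm_cblinfun[of L "B x y"] mult_left_mono[OF K[of x y] norm_ge_zero[of L]]
    by (simp add: mult.assoc)
  moreover have "cbilinear (\<lambda>x y. L (B x y))"
    using assms unfolding bounded_cbilinear_def cbilinear_def clinear_iff
    by (simp add: cblinfun.add_right cblinfun_scaleC_arg)
  ultimately show ?thesis unfolding bounded_cbilinear_def by blast
qed

lemma bounded_cbilinear_apply: "bounded_cbilinear (\<lambda>x y. cblinfun_apply (cblinfun_apply D x) y)"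
proof -
  have "norm (D x y) \<le> norm D * norm x * norm y" for x y
    using norm_cblinfun[of "D x" y] mult_right_mono[OF norm_cblinfun[of D x] norm_ge_zero[of y]] by linarith
  moreover have "cbilinear (\<lambda>x y. D x y)"
    unfolding cbilinear_def clinear_iff
    by (simp add: cblinfun.add_right cblinfun_scaleC_arg cblinfun_apply_add cblinfun_apply_scaleC)
  ultimately show ?thesis unfolding bounded_cbilinear_def by blast
qed

lemma bounded_cbilinear_scale:
  assumes "bounded_cbilinear B"
  shows "bounded_cbilinear (\<lambda>x y. c *\<^sub>C B x y)"
  using bounded_cbilinear_post[OF assms, of "c *\<^sub>C cblinfun_id"] by (simp add: cblinfun_apply_scaleC)

lemma bounded_clinear_partial:
  assumes "bounded_cbilinear B"
  shows "bounded_clinear (B x)"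
proof -
  obtain K where K: "\<And>x y. norm (B x y) \<le> K * norm x * norm y" and B: "cbilinear B"
    using assms unfolding bounded_cbilinear_def by blast
  show ?thesis
    by (rule bounded_clinear_intro[where K = "K * norm x"])
      (use K[of x] cbilinear_simps[OF B] in \<open>simp_all add: mult.commute\<close>)
qed

lemma curry_bounded_cbilinear:
  assumes B: "bounded_cbilinear B"
  obtains D where "\<And>x y. cblinfun_apply (cblinfun_apply D x) y = B x y"
proof -
  obtain K where K: "\<And>x y. norm (B x y) \<le> K * norm x * norm y" and bil: "cbilinear B"
    using assms unfolding bounded_cbilinear_def by blast
  define t where "t x = CBlinfun (B x)" for x
  have t: "t x y = B x y" for x y by (simp add: t_def CBlinfun_apply bounded_clinear_partial[OF B])
  have "norm (t x) \<le> norm x * \<bar>K\<bar>" for x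
  proof (rule norm_cblinfun_bound)
    show "norm (t x y) \<le> norm x * \<bar>K\<bar> * norm y" for y
      unfolding t using order_trans[OF K mult_right_mono[OF mult_right_mono[OF abs_ge_self[of K]]]]
      by (simp add: mult.commute)
  qed simp
  then have "bounded_clinear t"
    by (intro bounded_clinear_intro[where K = "\<bar>K\<bar>"] cblinfun_eqI)
      (simp_all add: t cblinfun_apply_add cblinfun_apply_scaleC cbilinear_simps[OF bil])
  then show ?thesis by (intro that[of "CBlinfun t"]) (simp add: CBlinfun_apply t)
qed

lemma bounded_cbilinear_approx_eqI:
  fixes B B' :: "'a::complex_banach approx_op \<Rightarrow> 'b::complex_banach approx_op \<Rightarrow> 'c::complex_normed_vector"
  assumes B: "bounded_cbilinear B" "bounded_cbilinear B'"
    and eq: "\<And>x f y g. B (elem_op x f) (elem_op y g) = B' (elem_op x f) (elem_op y g)"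
  shows "B a b = B' a b"
proof -
  obtain D where D: "\<And>x y. cblinfun_apply (cblinfun_apply D x) y = B x y"
    using curry_bounded_cbilinear[OF B(1)] by metis
  obtain D' where D': "\<And>x y. cblinfun_apply (cblinfun_apply D' x) y = B' x y"
    using curry_bounded_cbilinear[OF B(2)] by metis
  have "D (elem_op x f) = D' (elem_op x f)" for x f
    by (rule approx_cblinfun_eqI) (simp add: D D' eq)
  then have "D = D'" by (rule approx_cblinfun_eqI)
  then show ?thesis by (metis D D')
qed

section \<open>Local nuclearity of the functionals on the approximable operators\<close>

text \<open>The norm of a functional may fail to be attained; the factor 2 leaves room for a single
  vector, and a rotation makes the value real.\<close>

lemma functional_almost_attained:
  fixes h :: "'a::complex_normed_vector cdual"
  obtains x where "norm x \<le> 1" "norm h \<le> 2 * Re (h x)"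
proof -
  have "\<exists>x. norm x \<le> 1 \<and> norm h \<le> 2 * cmod (h x)"
  proof (rule ccontr)
    assume "\<not> ?thesis"
    then have lt: "\<And>x. norm x \<le> 1 \<Longrightarrow> 2 * cmod (h x) < norm h" by force
    have "norm h \<le> norm h / 2"
    proof (rule norm_cblinfun_unit_ball)
      show "cmod (h x) \<le> norm h / 2" if "norm x \<le> 1" for x using lt[OF that] by simp
    qed
    then have "h = 0" by simp
    with lt[of 0] show False by simp
  qed
  then obtain x where x: "norm x \<le> 1" "norm h \<le> 2 * cmod (h x)" by blast
  show ?thesis
  proof (cases "h x = 0")
    case True
    then show ?thesis using x by (intro that[of 0]) (auto simp: cblinfun.zero_right)
  next
    case False
    define c where "c = cnj (h x) / cmod (h x)"
    have "h (c *\<^sub>C x) = cmod (h x)"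
      using False complex_norm_square[of "h x"]
      by (simp add: c_def cblinfun_scaleC_arg scaleC_complex_def field_simps power2_eq_square)
    moreover have "norm (c *\<^sub>C x) \<le> 1" using x False by (simp add: c_def norm_scaleC norm_divide)
    ultimately show ?thesis using x by (intro that[of "c *\<^sub>C x"]) auto
  qed
qed

lemma cdual_eq_if_Re_eq:
  fixes f g :: "'a::complex_normed_vector cdual"
  assumes "\<And>x. Re (f x) = Re (g x)"
  shows "f = g"
proof (rule cblinfun_eqI, rule complex_eqI)
  show "Im (f x) = Im (g x)" for x
    using assms[of "\<i> *\<^sub>C x"] by (simp add: cblinfun_scaleC_arg scaleC_complex_def)
qed (rule assms)

text \<open>
  Functionals on the approximable operators are integral: on finitely many \<open>f\<close> the norm of the
  operators of the form \<open>\<Sum>i. x\<^sub>i \<otimes> f\<^sub>i\<close> is equivalent to the supremum over a finite net \<open>\<xi>\<close> of the unit ball,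
  and a Hahn--Banach extension to \<open>\<ell>\<^sub>\<infinity>(X)\<close>, realised as bounded functions on the discrete space \<open>nat\<close>,
  yields the functionals \<open>h\<close>.
\<close>

lemma approx_functional_locally_nuclear:
  fixes \<psi> :: "'a::complex_banach approx_op cdual" and S :: "'a cdual \<Rightarrow>\<^sub>C\<^sub>L 'a cdual"
  assumes S: "\<And>f x. S f x = \<psi> (elem_op x f)" and I: "finite I"
  shows "\<exists>(m::nat) (\<xi> :: nat \<Rightarrow> 'a) (h :: nat \<Rightarrow> 'a cdual).
    (\<forall>j<m. norm (\<xi> j) \<le> 1) \<and> (\<Sum>j<m. norm (h j)) \<le> 2 * (2 * norm \<psi> + 1) \<and>
    (\<forall>f\<in>I. S f = (\<Sum>j<m. f (\<xi> j) *\<^sub>C h j))"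
proof -
  \<comment> \<open>The factor \<open>2 * norm \<psi>\<close> comes from
    \<open>norm a \<le> 2 * norm (ev a)\<close> on \<open>W\<close>; adding 1 permits division by
    \<open>N\<close>.\<close>
  define N where "N = 2 * norm \<psi> + 1"
  have N: "N > 0" by (simp add: N_def add_nonneg_pos)
  obtain \<Xi> where \<Xi>: "finite \<Xi>" "\<Xi> \<subseteq> cball 0 1"
    "\<And>(a :: 'a \<Rightarrow>\<^sub>C\<^sub>L 'a) c.
      (\<And>\<xi>. (\<And>g. g \<in> I \<Longrightarrow> g \<xi> = 0) \<Longrightarrow> cblinfun_apply a \<xi> = 0) \<Longrightarrow>
      (\<And>\<xi>. \<xi> \<in> \<Xi> \<Longrightarrow> norm (cblinfun_apply a \<xi>) \<le> c) \<Longrightarrow> norm a \<le> 2 * c"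
    using finite_norming_net[OF I] by metis
  define m where "m = card \<Xi>"
  obtain \<xi> where "bij_betw \<xi> {0..<m} \<Xi>"
    using ex_bij_betw_nat_finite[OF \<Xi>(1)] unfolding m_def by blast
  then have \<xi>_image: "\<xi> ` {..<m} = \<Xi>" by (simp add: bij_betw_def atLeast0LessThan)
  have \<xi>1: "norm (\<xi> j) \<le> 1" if "j < m" for j using \<Xi>(2) \<xi>_image that by auto
  define emb :: "(nat \<Rightarrow> 'a) \<Rightarrow> (nat, 'a) bcontfun"
    where "emb g = Bcontfun (\<lambda>j. if j < m then g j else 0)" for g
  have emb: "apply_bcontfun (emb g) j = (if j < m then g j else 0)" for g j
  proof -
    have "range (\<lambda>j. if j < m then g j else 0) \<subseteq> insert 0 (g ` {..<m})" by auto
    then have "bounded (range (\<lambda>j. if j < m then g j else 0))"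
      by (rule bounded_subset[rotated]) (simp add: finite_imp_bounded)
    then have "(\<lambda>j. if j < m then g j else 0) \<in> bcontfun"
      by (simp add: bcontfun_def continuous_on_discrete)
    then show ?thesis by (simp add: emb_def Bcontfun_inverse)
  qed
  have emb_norm: "norm (emb g) \<le> c" if "c \<ge> 0" "\<And>j. j < m \<Longrightarrow> norm (g j) \<le> c" for g c
    by (rule norm_bound) (use that in \<open>auto simp: emb\<close>)
  have emb_add: "emb (\<lambda>j. g j + g' j) = emb g + emb g'" for g g'
    by (rule bcontfun_eqI) (simp add: emb)
  have emb_scale: "emb (\<lambda>j. r *\<^sub>R g j) = r *\<^sub>R emb g" for g r
    by (rule bcontfun_eqI) (simp add: emb)
  \<comment> \<open>\<open>W\<close> contains \<open>elem_op x f\<close> for all \<open>f\<close> in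
    \<open>I\<close>, and is described by kernels so that the norming net applies to it.\<close>
  define W where "W = {a :: 'a approx_op. \<forall>\<eta>. (\<forall>f\<in>I. f \<eta> = 0) \<longrightarrow> op_of_approx a \<eta> = 0}"
  define ev where "ev a = emb (\<lambda>j. cblinfun_apply (op_of_approx a) (\<xi> j))" for a
  have ev_add: "ev (a + b) = ev a + ev b" for a b
    by (simp add: ev_def plus_approx_op.rep_eq cblinfun_apply_add emb_add)
  have ev_scale: "ev (r *\<^sub>R a) = r *\<^sub>R ev a" for a r
    by (simp add: ev_def scaleR_approx_op.rep_eq cblinfun_apply_scaleR emb_scale)
  have norm_ev: "norm a \<le> 2 * norm (ev a)" if a: "a \<in> W" for a
    unfolding norm_approx_op.rep_eq
  proof (rule \<Xi>(3))
    show "op_of_approx a \<eta> = 0" if "\<And>g. g \<in> I \<Longrightarrow> g \<eta> = 0" for \<eta>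
      using a that by (simp add: W_def)
    fix \<eta> assume "\<eta> \<in> \<Xi>"
    then obtain j where "j < m" "\<eta> = \<xi> j" using \<xi>_image by auto
    then show "norm (op_of_approx a \<eta>) \<le> norm (ev a)"
      using norm_bounded[of "ev a" j] by (simp add: ev_def emb)
  qed
  define G where "G = {(ev a, Re (\<psi> a) / N) | a. a \<in> W}"
  have sub: "subspace G"
    unfolding subspace_def
  proof (intro conjI ballI allI)
    have "ev 0 = 0" using ev_scale[of 0 0] by simp
    moreover have "0 \<in> W" by (simp add: W_def zero_approx_op.rep_eq)
    ultimately show "0 \<in> G" unfolding G_def by (force simp: zero_prod_def cblinfun.zero_right)
    fix p q r assume "p \<in> G"
    then obtain a where a: "p = (ev a, Re (\<psi> a) / N)" "a \<in> W" unfolding G_def by blast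
    have "r *\<^sub>R a \<in> W" using a(2) by (simp add: W_def scaleR_approx_op.rep_eq cblinfun_apply_scaleR)
    moreover have "r *\<^sub>R p = (ev (r *\<^sub>R a), Re (\<psi> (r *\<^sub>R a)) / N)"
      by (simp add: a(1) ev_scale cblinfun.scaleR_right)
    ultimately show "r *\<^sub>R p \<in> G" unfolding G_def by blast
    assume "q \<in> G"
    then obtain b where b: "q = (ev b, Re (\<psi> b) / N)" "b \<in> W" unfolding G_def by blast
    have "a + b \<in> W" using a(2) b(2) by (simp add: W_def plus_approx_op.rep_eq cblinfun_apply_add)
    moreover have "p + q = (ev (a + b), Re (\<psi> (a + b)) / N)"
      by (simp add: a(1) b(1) ev_add cblinfun.add_right add_divide_distrib)
    ultimately show "p + q \<in> G" unfolding G_def by blast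
  qed
  have le: "r \<le> norm y" if yr: "(y, r) \<in> G" for y r
  proof -
    obtain a where a: "y = ev a" "r = Re (\<psi> a) / N" "a \<in> W" using yr unfolding G_def by blast
    have "Re (\<psi> a) \<le> norm \<psi> * norm a" using complex_Re_le_cmod[of "\<psi> a"] norm_cblinfun[of \<psi> a] by linarith
    also have "\<dots> \<le> norm \<psi> * (2 * norm (ev a))" using norm_ev[OF a(3)] by (intro mult_left_mono) auto
    also have "\<dots> \<le> N * norm (ev a)" by (simp add: N_def algebra_simps)
    finally show ?thesis using N by (simp add: a(1,2) pos_divide_le_eq mult.commute)
  qed
  obtain p where p: "bounded_linear p" "\<And>y. \<bar>p y\<bar> \<le> norm y" "\<And>y r. (y, r) \<in> G \<Longrightarrow> p y = r"
    using norm_dominated_extension[OF sub le] by metis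
  interpret p: bounded_linear p by fact
  define single where "single j x = emb (\<lambda>i. if i = j then x else 0)" for j x
  have single_sum: "emb g = (\<Sum>j<m. single j (g j))" for g
  proof (rule bcontfun_eqI)
    have app_sum: "apply_bcontfun (\<Sum>j\<in>J. single j (g j)) i = (\<Sum>j\<in>J. apply_bcontfun (single j (g j)) i)" for J i
      by (induction J rule: infinite_finite_induct) auto
    show "apply_bcontfun (emb g) i = apply_bcontfun (\<Sum>j<m. single j (g j)) i" for i
      unfolding app_sum by (auto simp: emb single_def)
  qed
  have "\<exists>h :: 'a cdual. \<forall>x. Re (h x) = N * p (single j x)" for j
  proof -
    have bound: "\<bar>N * p (single j x)\<bar> \<le> N * norm x" for x
      using order_trans[OF p(2) emb_norm[of "norm x" "\<lambda>i. if i = j then x else 0"]] N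
      by (auto simp: abs_mult single_def)
    have "bounded_linear (\<lambda>x. N * p (single j x))"
    proof (rule bounded_linear_intro[where K = N])
      have "single j (x + y) = single j x + single j y" for x y
        unfolding single_def by (subst emb_add[symmetric]) (rule arg_cong[where f = emb], auto)
      then show "N * p (single j (x + y)) = N * p (single j x) + N * p (single j y)" for x y
        by (simp add: p.add algebra_simps)
      have "single j (r *\<^sub>R x) = r *\<^sub>R single j x" for r x
        unfolding single_def by (subst emb_scale[symmetric]) (rule arg_cong[where f = emb], auto)
      then show "N * p (single j (r *\<^sub>R x)) = r *\<^sub>R (N * p (single j x))" for r x
        by (simp add: p.scaleR)
      show "norm (N * p (single j x)) \<le> norm x * N" for x using bound[of x] by (simp add: mult.commute)
    qed
    from complexify_functional[OF this bound] show ?thesis by metis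
  qed
  then obtain h :: "nat \<Rightarrow> 'a cdual" where h: "\<And>j x. Re (h j x) = N * p (single j x)" by metis
  have rep: "S f = (\<Sum>j<m. f (\<xi> j) *\<^sub>C h j)" if f: "f \<in> I" for f
  proof (rule cdual_eq_if_Re_eq)
    fix x
    have app: "(\<Sum>j\<in>J. f (\<xi> j) *\<^sub>C h j) x = (\<Sum>j\<in>J. h j (f (\<xi> j) *\<^sub>C x))" for J
      by (induction J rule: infinite_finite_induct)
        (auto simp: cblinfun_apply_add cblinfun_apply_scaleC cblinfun_scaleC_arg)
    have "elem_op x f \<in> W" using f by (simp add: W_def rank_one_apply)
    then have "(ev (elem_op x f), Re (\<psi> (elem_op x f)) / N) \<in> G" unfolding G_def by blast
    then have "Re (S f x) = N * p (ev (elem_op x f))" using p(3) N by (simp add: S)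
    also have "ev (elem_op x f) = (\<Sum>j<m. single j (f (\<xi> j) *\<^sub>C x))"
      by (simp add: ev_def rank_one_apply single_sum)
    also have "N * p \<dots> = Re ((\<Sum>j<m. f (\<xi> j) *\<^sub>C h j) x)"
      by (simp add: app p.sum sum_distrib_left h)
    finally show "Re (S f x) = Re ((\<Sum>j<m. f (\<xi> j) *\<^sub>C h j) x)" .
  qed
  have "\<exists>x. norm x \<le> 1 \<and> norm (h j) \<le> 2 * Re (h j x)" for j
    using functional_almost_attained[of "h j"] by metis
  then obtain x where x: "\<And>j. norm (x j) \<le> 1" "\<And>j. norm (h j) \<le> 2 * Re (h j (x j))" by metis
  \<comment> \<open>The almost norming vectors of all coordinates are assembled into one vector
    \<open>emb x\<close> of norm at most 1, so that a single value of \<open>p\<close> controls the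
    whole sum: the dual norm of a supremum norm is a sum of norms.\<close>
  have "(\<Sum>j<m. norm (h j)) \<le> (\<Sum>j<m. 2 * Re (h j (x j)))" by (rule sum_mono) (rule x(2))
  also have "\<dots> = 2 * (N * p (emb x))" by (simp add: h single_sum p.sum sum_distrib_left)
  also have "\<dots> \<le> 2 * N"
    using p(2)[of "emb x"] emb_norm[of 1 x] x(1) N by (simp add: abs_le_iff)
  finally show ?thesis using \<xi>1 rep unfolding N_def by blast
qed

section \<open>Complemented subspaces\<close>

text \<open>The decomposition is only algebraic; boundedness of the projection comes from the open
  mapping theorem for addition on \<open>Y \<times> Z\<close>.\<close>

lemma direct_sum_projection:
  fixes Y Z :: "'a::complex_banach set"
  assumes YZ: "direct_sum Y Z" "closed Y" "closed Z"
  obtains q :: "'a \<Rightarrow>\<^sub>C\<^sub>L 'a" where "\<And>y. y \<in> Y \<Longrightarrow> q y = y" "\<And>z. z \<in> Z \<Longrightarrow> q z = 0"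
    "\<And>x. q x \<in> Y" "\<And>x. x - q x \<in> Z"
proof -
  have Y: "complex_vector.subspace Y" and Z: "complex_vector.subspace Z" and int: "Y \<inter> Z = {0}"
    and ex: "\<And>x. \<exists>v\<in>Y. \<exists>w\<in>Z. x = v + w"
    using YZ(1) unfolding direct_sum_def by auto
  have real: "subspace V" if "complex_vector.subspace V" for V :: "'a set"
    using that unfolding subspace_def complex_vector.subspace_def by (simp add: scaleR_eq_scaleC)
  have T: "bounded_linear (\<lambda>p :: 'a \<times> 'a. fst p + snd p)"
    by (intro bounded_linear_add bounded_linear_fst bounded_linear_snd)
  have im: "(\<lambda>p. fst p + snd p) ` (Y \<times> Z) = UNIV"
  proof (intro equalityI subsetI UNIV_I)
    fix x :: 'a
    obtain v w where "v \<in> Y" "w \<in> Z" "x = v + w" using ex by blast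
    then show "x \<in> (\<lambda>p. fst p + snd p) ` (Y \<times> Z)" by (intro image_eqI[of _ _ "(v, w)"]) auto
  qed
  then have cl: "closed ((\<lambda>p. fst p + snd p) ` (Y \<times> Z))" by simp
  have "\<exists>C>0. \<forall>x\<in>(\<lambda>p. fst p + snd p) ` (Y \<times> Z). \<exists>p\<in>Y \<times> Z. fst p + snd p = x \<and> norm p \<le> C * norm x"
    by (rule open_mapping_subspace[OF T subspace_Times[OF real[OF Y] real[OF Z]] closed_Times[OF YZ(2,3)] cl])
  then obtain C where C: "\<And>x. \<exists>p\<in>Y \<times> Z. fst p + snd p = x \<and> norm p \<le> C * norm x"
    unfolding im by auto
  have "\<exists>y. y \<in> Y \<and> x - y \<in> Z \<and> norm y \<le> C * norm x" for x
  proof -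
    obtain p where p: "p \<in> Y \<times> Z" "fst p + snd p = x" "norm p \<le> C * norm x" using C by blast
    have "norm (fst p) \<le> norm p" using norm_fst_le[of "fst p" "snd p"] by simp
    moreover have "x - fst p = snd p" using p(2) by auto
    ultimately show ?thesis using p by (intro exI[of _ "fst p"]) auto
  qed
  then obtain q where q: "\<And>x. q x \<in> Y" "\<And>x. x - q x \<in> Z" "\<And>x. norm (q x) \<le> C * norm x" by metis
  have uniq: "q x = y" if y: "y \<in> Y" "x - y \<in> Z" for x y
  proof -
    have "q x - y \<in> Y" using Y q(1) y(1) by (rule complex_vector.subspace_diff)
    moreover have "(x - y) - (x - q x) \<in> Z" using Z y(2) q(2) by (rule complex_vector.subspace_diff)
    then have "q x - y \<in> Z" by simp
    ultimately have "q x - y \<in> Y \<inter> Z" by (rule IntI)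
    then have "q x - y = 0" unfolding int by (rule singletonD)
    then show ?thesis by simp
  qed
  have "bounded_clinear q"
  proof (rule bounded_clinear_intro)
    fix x x' and c
    have "x + x' - (q x + q x') \<in> Z"
      using complex_vector.subspace_add[OF Z q(2)[of x] q(2)[of x']] by (simp add: algebra_simps)
    then show "q (x + x') = q x + q x'"
      by (rule uniq[OF complex_vector.subspace_add[OF Y q(1) q(1)]])
    have "c *\<^sub>C x - c *\<^sub>C q x \<in> Z"
      using complex_vector.subspace_scale[OF Z q(2)[of x], of c] by (simp add: complex_vector.scale_right_diff_distrib)
    then show "q (c *\<^sub>C x) = c *\<^sub>C q x"
      by (rule uniq[OF complex_vector.subspace_scale[OF Y q(1)]])
    show "norm (q x) \<le> norm x * C" using q(3)[of x] by (simp add: mult.commute)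
  qed
  then have q': "CBlinfun q x = q x" for x by (simp add: CBlinfun_apply)
  show ?thesis
  proof (rule that[of "CBlinfun q"]; unfold q')
    show "q y = y" if "y \<in> Y" for y
      by (rule uniq) (use that complex_vector.subspace_0[OF Z] in simp_all)
    show "q z = 0" if "z \<in> Z" for z
      by (rule uniq) (use that complex_vector.subspace_0[OF Y] in simp_all)
  qed (rule q)+
qed

section \<open>One-dimensional kernel of the trace\<close>

text \<open>The transposed sum is the adjoint of the original operator.\<close>

lemma form_sum_rank_one_transpose:
  fixes ps :: "('a::complex_normed_vector \<times> 'a cdual) list"
  shows "norm (form_sum rank_one (map (\<lambda>(x, f). (f, eval_functional x)) ps)) \<le> norm (form_sum rank_one ps)"
proof (rule norm_cblinfun_bound)
  fix h :: "'a cdual"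
  have "form_sum rank_one (map (\<lambda>(x, f). (f, eval_functional x)) qs) h = h o\<^sub>C\<^sub>L form_sum rank_one qs"
    for qs :: "('a \<times> 'a cdual) list"
    by (induction qs) (auto simp: functional_compose_simps cblinfun_apply_add rank_one_apply
        eval_functional_apply)
  then show "norm (form_sum rank_one (map (\<lambda>(x, f). (f, eval_functional x)) ps) h) \<le> norm (form_sum rank_one ps) * norm h"
    using norm_cblinfun_compose[of h "form_sum rank_one ps"] by (simp add: mult.commute)
qed simp

text \<open>A list involves only finitely many functionals \<open>f\<close>. The local
  representation of \<open>S\<close> on them turns the pairing into
  \<open>\<Sum>j<m. V (h j) (\<xi> j)\<close>, and the bound \<open>K\<close> on the
  \<open>norm (h j)\<close> is the same for all lists.\<close>

lemma approx_functional_integral: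
  fixes \<psi> :: "'a::complex_banach approx_op cdual" and S :: "'a cdual \<Rightarrow>\<^sub>C\<^sub>L 'a cdual"
  assumes S: "\<And>f x. S f x = \<psi> (elem_op x f)"
  shows "S \<in> integral_operators"
proof -
  define K where "K = 2 * (2 * norm \<psi> + 1)"
  have "cmod (form_sum (\<lambda>f \<Psi>. cblinfun_apply \<Psi> (S f)) ps) \<le> K * norm (form_sum rank_one ps)"
    for ps :: "('a cdual \<times> 'a cdual cdual) list"
  proof -
    define V where "V = form_sum rank_one ps"
    obtain m :: nat and \<xi> :: "nat \<Rightarrow> 'a" and h :: "nat \<Rightarrow> 'a cdual"
      where \<xi>: "\<And>j. j < m \<Longrightarrow> norm (\<xi> j) \<le> 1" and hK: "(\<Sum>j<m. norm (h j)) \<le> K"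
        and rep: "\<And>f. f \<in> fst ` set ps \<Longrightarrow> S f = (\<Sum>j<m. f (\<xi> j) *\<^sub>C h j)"
      using approx_functional_locally_nuclear[OF S finite_imageI[OF finite_set, of fst ps]]
      unfolding K_def by blast
    have app_sum: "\<Psi> (\<Sum>j<m. c j *\<^sub>C h j) = (\<Sum>j<m. c j * \<Psi> (h j))"
      for \<Psi> :: "'a cdual cdual" and c
      by (simp add: cblinfun.sum_right cblinfun_scaleC_arg scaleC_complex_def)
    have "form_sum (\<lambda>f \<Psi>. cblinfun_apply \<Psi> (S f)) qs = (\<Sum>j<m. form_sum rank_one qs (h j) (\<xi> j))"
      if "set qs \<subseteq> set ps" for qs :: "('a cdual \<times> 'a cdual cdual) list"
      using that
    proof (induction qs)
      case (Cons q qs)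
      obtain f \<Psi> where q: "q = (f, \<Psi>)" by (cases q)
      have "S f = (\<Sum>j<m. f (\<xi> j) *\<^sub>C h j)" using Cons.prems by (intro rep) (force simp: q)
      then have "\<Psi> (S f) = (\<Sum>j<m. \<Psi> (h j) * f (\<xi> j))" by (simp add: app_sum mult.commute)
      then show ?case
        using Cons by (simp add: q cblinfun_apply_add rank_one_apply cblinfun_apply_scaleC
            scaleC_complex_def sum.distrib)
    qed simp
    then have "form_sum (\<lambda>f \<Psi>. cblinfun_apply \<Psi> (S f)) ps = (\<Sum>j<m. V (h j) (\<xi> j))"
      by (simp add: V_def)
    also have "cmod \<dots> \<le> (\<Sum>j<m. norm V * norm (h j))"
    proof (rule sum_norm_le)
      fix j assume "j \<in> {..<m}"
      then have "norm (V (h j)) * norm (\<xi> j) \<le> (norm V * norm (h j)) * 1"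
        using \<xi>[of j] by (intro mult_mono norm_cblinfun) auto
      then show "cmod (V (h j) (\<xi> j)) \<le> norm V * norm (h j)"
        using norm_cblinfun[of "V (h j)" "\<xi> j"] by simp
    qed
    also have "\<dots> \<le> norm V * K" using hK by (simp add: mult_left_mono flip: sum_distrib_left)
    finally show ?thesis by (simp add: V_def mult.commute)
  qed
  then show ?thesis unfolding integral_operator_iff by blast
qed

text \<open>On \<open>V\<close> the identity is \<open>inverse c\<close> times \<open>S\<close>, so
  it inherits the uniform local nuclearity of \<open>S\<close>.\<close>

lemma finite_cdim_if_eigenspace:
  fixes \<psi> :: "'a::complex_banach approx_op cdual" and S :: "'a cdual \<Rightarrow>\<^sub>C\<^sub>L 'a cdual"
  assumes S: "\<And>f x. S f x = \<psi> (elem_op x f)" and V: "\<And>f. f \<in> V \<Longrightarrow> S f = c *\<^sub>C f" and c: "c \<noteq> 0"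
  shows "finite_cdim V"
proof (rule finite_cdim_if_uniformly_nuclear)
  define K where "K = 2 * (2 * norm \<psi> + 1)"
  fix I assume I: "finite I" "I \<subseteq> V"
  obtain m :: nat and \<xi> :: "nat \<Rightarrow> 'a" and h :: "nat \<Rightarrow> 'a cdual"
    where \<xi>: "\<And>j. j < m \<Longrightarrow> norm (\<xi> j) \<le> 1" and hK: "(\<Sum>j<m. norm (h j)) \<le> K"
      and rep: "\<And>f. f \<in> I \<Longrightarrow> S f = (\<Sum>j<m. f (\<xi> j) *\<^sub>C h j)"
    using approx_functional_locally_nuclear[OF S I(1)] unfolding K_def by blast
  define h' where "h' j = inverse c *\<^sub>C h j" for j
  have "f = (\<Sum>j<m. f (\<xi> j) *\<^sub>C h' j)" if f: "f \<in> I" for f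
  proof -
    have "f = inverse c *\<^sub>C S f" using V[of f] f I(2) c by (auto simp: scaleC_scaleC)
    also have "\<dots> = (\<Sum>j<m. f (\<xi> j) *\<^sub>C h' j)"
      by (simp add: rep[OF f] complex_vector.scale_sum_right h'_def scaleC_scaleC mult.commute)
    finally show ?thesis .
  qed
  moreover have "(\<Sum>j<m. norm (h' j)) \<le> cmod (inverse c) * K"
    using hK by (simp add: h'_def norm_scaleC mult_left_mono flip: sum_distrib_left)
  ultimately show "\<exists>(m::nat) (\<xi> :: nat \<Rightarrow> 'a) (h :: nat \<Rightarrow> 'a cdual).
    (\<forall>j<m. norm (\<xi> j) \<le> 1) \<and> (\<Sum>j<m. norm (h j)) \<le> cmod (inverse c) * K \<and>
    (\<forall>f\<in>I. f = (\<Sum>j<m. cblinfun_apply f (\<xi> j) *\<^sub>C h j))"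
    using \<xi> by blast
qed

text \<open>Conditions (a) and (b) with a chosen generator \<open>k\<close> of the kernel, whose
  scalar trace will serve as a normalization.\<close>

locale one_dim_trace_kernel =
  fixes k :: "'x::complex_banach trace_tensor"
  assumes kernel_eq: "kernel (approx_trace :: 'x trace_tensor \<Rightarrow>\<^sub>C\<^sub>L 'x approx_op) = complex_vector.span {k}"
    and k_nonzero: "k \<noteq> 0"
    and surj: "range (cblinfun_apply (approx_trace :: 'x trace_tensor \<Rightarrow>\<^sub>C\<^sub>L 'x approx_op)) = UNIV"
begin

lemma approx_trace_k: "approx_trace k = 0"
  using kernel_eq complex_vector.span_base[of k "{k}"] by (auto simp: kernel_def)

lemma kernel_scale:
  assumes "approx_trace u = 0"
  obtains c where "u = c *\<^sub>C k"
proof -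
  have "u \<in> complex_vector.span {k}" using assms kernel_eq by (auto simp: kernel_def)
  then show ?thesis using that by (auto simp: complex_vector.span_singleton)
qed

text \<open>A functional that kills the kernel may be evaluated at any preimage of
  \<open>approx_trace u\<close>, in particular at one whose norm is controlled by the open mapping
  theorem.\<close>

lemma functional_bound:
  fixes \<phi> :: "'x trace_tensor cdual"
  assumes "\<phi> k = 0"
  obtains C where "\<And>u. cmod (\<phi> u) \<le> C * norm (approx_trace u)"
proof -
  have "\<exists>C>0. \<forall>r\<in>cblinfun_apply approx_trace ` UNIV. \<exists>u\<in>UNIV. approx_trace u = r \<and> norm u \<le> C * norm (r :: 'x approx_op)"
    by (rule open_mapping_subspace[OF bounded_linear_cblinfun_apply]) (simp_all add: surj)
  then obtain C where C: "\<And>r :: 'x approx_op. \<exists>u. approx_trace u = r \<and> norm u \<le> C * norm r"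
    by (auto simp: surj)
  have "cmod (\<phi> u) \<le> (norm \<phi> * C) * norm (approx_trace u)" for u
  proof -
    obtain v where v: "approx_trace v = approx_trace u" "norm v \<le> C * norm (approx_trace u)"
      using C[of "approx_trace u"] by blast
    have "approx_trace (u - v) = 0" using v(1) by (simp add: cblinfun.diff_right)
    then obtain c where "u - v = c *\<^sub>C k" by (rule kernel_scale)
    then have "\<phi> (u - v) = 0" using assms by (simp add: cblinfun_scaleC_arg scaleC_complex_def)
    then have "\<phi> u = \<phi> v" by (simp add: cblinfun.diff_right)
    then have "cmod (\<phi> u) \<le> norm \<phi> * norm v" using norm_cblinfun[of \<phi> v] by simp
    also have "\<dots> \<le> norm \<phi> * (C * norm (approx_trace u))" using v(2) by (intro mult_left_mono) auto
    finally show ?thesis by (simp add: mult.assoc)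
  qed
  then show ?thesis by (rule that)
qed

lemma trace_unbounded:
  "\<exists>ps :: ('x \<times> 'x cdual) list. cmod (scalar_trace (form_sum (\<otimes>) ps)) > C * norm (form_sum elem_op ps)"
proof (rule ccontr)
  assume "\<not> ?thesis"
  then have "cmod (scalar_trace (form_sum (\<otimes>) ps)) \<le> C * norm (form_sum elem_op ps)" for ps :: "('x \<times> 'x cdual) list"
    by (metis not_less)
  from trace_bounded_imp_injective[OF this approx_trace_k] show False using k_nonzero by simp
qed

lemma scalar_trace_k: "scalar_trace k \<noteq> 0"
proof
  assume "scalar_trace k = 0"
  then obtain C where C: "\<And>u :: 'x trace_tensor. cmod (scalar_trace u) \<le> C * norm (approx_trace u)"
    by (rule functional_bound) metis
  obtain ps :: "('x \<times> 'x cdual) list" where "cmod (scalar_trace (form_sum (\<otimes>) ps)) > C * norm (form_sum elem_op ps)"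
    using trace_unbounded by blast
  with C[of "form_sum (\<otimes>) ps"] show False by (simp add: approx_trace_form_sum)
qed

lemma functional_decomposition:
  fixes \<phi> :: "'x trace_tensor cdual"
  shows "\<exists>\<psi> \<mu>. \<forall>u. \<phi> u = cblinfun_apply \<psi> (approx_trace u) + \<mu> * scalar_trace u"
proof -
  \<comment> \<open>Makes the remainder vanish at \<open>k\<close>, hence on the whole kernel of
    \<open>Tr\<close>.\<close>
  define \<mu> where "\<mu> = \<phi> k / scalar_trace k"
  define \<phi>' where "\<phi>' = \<phi> - \<mu> *\<^sub>C scalar_trace"
  have "\<phi>' k = 0"
    using scalar_trace_k by (simp add: \<phi>'_def \<mu>_def cblinfun_apply_diff cblinfun_apply_scaleC scaleC_complex_def)
  then obtain C where C: "\<And>u. cmod (\<phi>' u) \<le> C * norm (approx_trace u)" by (rule functional_bound) metis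
  then obtain \<psi> :: "'x approx_op cdual" where \<psi>: "\<phi>' = \<psi> o\<^sub>C\<^sub>L approx_trace"
    using functional_factors_through by metis
  have "\<phi> u = \<psi> (approx_trace u) + \<mu> * scalar_trace u" for u
  proof -
    have "\<phi>' u = \<psi> (approx_trace u)" by (simp add: \<psi>)
    then show ?thesis
      by (simp add: \<phi>'_def cblinfun_apply_diff cblinfun_apply_scaleC scaleC_complex_def diff_eq_eq)
  qed
  then show ?thesis by blast
qed

lemma dual_operator_decomposition:
  fixes T :: "'x cdual \<Rightarrow>\<^sub>C\<^sub>L 'x cdual"
  shows "\<exists>\<psi> \<mu>. \<forall>f x. (T - \<mu> *\<^sub>C cblinfun_id) f x = cblinfun_apply \<psi> (elem_op x f)"
proof -
  obtain \<psi> \<mu> where *: "\<And>u. tensor_functional T u = cblinfun_apply \<psi> (approx_trace u) + \<mu> * scalar_trace u"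
    using functional_decomposition by metis
  have "(T - \<mu> *\<^sub>C cblinfun_id) f x = \<psi> (elem_op x f)" for f x
    using *[of "x \<otimes> f"]
    by (simp add: tensor_functional_tensor approx_trace_tensor scalar_trace_tensor cblinfun_apply_diff
        cblinfun_apply_scaleC scaleC_complex_def)
  then show ?thesis by blast
qed

section \<open>Splitting off the identity, and indecomposability\<close>

lemma subspace_range_scale: "complex_vector.subspace (range (\<lambda>c. c *\<^sub>C (v :: 'a::complex_normed_vector)))"
  unfolding complex_vector.span_singleton[symmetric] by (rule complex_vector.subspace_span)

text \<open>If \<open>c\<close> times the identity were integral, \<open>c\<close> times the scalar
  trace would be bounded in the operator norm, which forces \<open>c = 0\<close>. For the sum,
  \<open>T\<close> is read as the functional \<open>x \<otimes> g \<mapsto> g (T x)\<close> on P;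
  the part of it that factors through \<open>Tr\<close> belongs to an integral operator.\<close>

lemma integral_direct_sum:
  "direct_sum (integral_operators :: ('x \<Rightarrow>\<^sub>C\<^sub>L 'x) set) (range (\<lambda>c. c *\<^sub>C cblinfun_id))"
  unfolding direct_sum_def
proof (intro conjI allI subspace_integral_operators subspace_range_scale)
  have "c = 0" if "c *\<^sub>C cblinfun_id \<in> (integral_operators :: ('x \<Rightarrow>\<^sub>C\<^sub>L 'x) set)" for c
  proof (rule ccontr)
    assume c: "c \<noteq> 0"
    obtain C where C: "\<And>ps :: ('x \<times> 'x cdual) list.
        cmod (form_sum (\<lambda>x g. cblinfun_apply g ((c *\<^sub>C cblinfun_id) x)) ps) \<le> C * norm (form_sum rank_one ps :: 'x \<Rightarrow>\<^sub>C\<^sub>L 'x)"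
      using \<open>_ \<in> integral_operators\<close> unfolding integral_operator_iff by blast
    have eq: "form_sum (\<lambda>x g. cblinfun_apply g ((c *\<^sub>C cblinfun_id) x)) ps = c * scalar_trace (form_sum (\<otimes>) ps)"
      for ps :: "('x \<times> 'x cdual) list"
      by (induction ps) (auto simp: cblinfun.zero_right cblinfun.add_right scalar_trace_tensor
          cblinfun_apply_scaleC cblinfun_scaleC_arg scaleC_complex_def algebra_simps)
    obtain ps :: "('x \<times> 'x cdual) list"
      where ps: "cmod (scalar_trace (form_sum (\<otimes>) ps)) > (C / cmod c) * norm (form_sum elem_op ps)"
      using trace_unbounded by blast
    then show False
      using C[of ps] c unfolding eq norm_approx_op.rep_eq op_of_form_sum_elem_op
      by (simp add: norm_mult field_simps)
  qed
  moreover have "0 \<in> (integral_operators :: ('x \<Rightarrow>\<^sub>C\<^sub>L 'x) set)"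
    by (rule complex_vector.subspace_0[OF subspace_integral_operators])
  ultimately show "(integral_operators :: ('x \<Rightarrow>\<^sub>C\<^sub>L 'x) set) \<inter> range (\<lambda>c. c *\<^sub>C cblinfun_id) = {0}"
    by (auto intro: range_eqI[of _ _ 0])
next
  fix T :: "'x \<Rightarrow>\<^sub>C\<^sub>L 'x"
  have bil: "bounded_cbilinear (\<lambda>x g. cblinfun_apply (g :: 'x cdual) (T x))"
    using bounded_cbilinear_compose[OF bounded_cbilinear_functional_apply, of cblinfun_id T] by simp
  define \<phi> where "\<phi> = tensor_lift (\<lambda>x g. cblinfun_apply (g :: 'x cdual) (T x))"
  have \<phi>: "\<phi> (x \<otimes> g) = g (T x)" for x g by (simp add: \<phi>_def tensor_lift_tensor[OF bil])
  obtain \<psi> \<mu> where dec: "\<And>u. \<phi> u = cblinfun_apply \<psi> (approx_trace u) + \<mu> * scalar_trace u"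
    using functional_decomposition by metis
  define S where "S = T - \<mu> *\<^sub>C cblinfun_id"
  have S: "cblinfun_apply g (S x) = \<psi> (elem_op x g)" for x g
    using dec[of "x \<otimes> g"]
    by (simp add: \<phi> S_def approx_trace_tensor scalar_trace_tensor cblinfun_apply_diff cblinfun.diff_right
        cblinfun_apply_scaleC cblinfun_scaleC_arg scaleC_complex_def)
  have "form_sum (\<lambda>x g. cblinfun_apply g (S x)) ps = \<psi> (form_sum elem_op ps)" for ps
    by (simp add: S cblinfun_form_sum)
  then have "S \<in> integral_operators"
    unfolding integral_operator_iff op_of_form_sum_elem_op[symmetric] norm_approx_op.rep_eq[symmetric]
    using norm_cblinfun[of \<psi>] by auto
  moreover have "T = S + \<mu> *\<^sub>C cblinfun_id" by (simp add: S_def)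
  ultimately show "\<exists>v\<in>integral_operators. \<exists>w\<in>range (\<lambda>c. c *\<^sub>C cblinfun_id). T = v + w" by blast
qed

text \<open>Integrality is now tested on tensors with factors in the bidual. For the intersection it
  is enough to test on transposes of lists from P; for the sum, arbitrary elements of the bidual are
  handled by the local nuclearity of functionals on A.\<close>

lemma integral_direct_sum_dual:
  "direct_sum (integral_operators :: ('x cdual \<Rightarrow>\<^sub>C\<^sub>L 'x cdual) set) (range (\<lambda>c. c *\<^sub>C cblinfun_id))"
  unfolding direct_sum_def
proof (intro conjI allI subspace_integral_operators subspace_range_scale)
  have "c = 0" if "c *\<^sub>C cblinfun_id \<in> (integral_operators :: ('x cdual \<Rightarrow>\<^sub>C\<^sub>L 'x cdual) set)" for c
  proof (rule ccontr)
    assume c: "c \<noteq> 0"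
    obtain C where C: "\<And>ps :: ('x cdual \<times> 'x cdual cdual) list.
        cmod (form_sum (\<lambda>x g. cblinfun_apply g ((c *\<^sub>C cblinfun_id) x)) ps) \<le> C * norm (form_sum rank_one ps :: 'x cdual \<Rightarrow>\<^sub>C\<^sub>L 'x cdual)"
      using \<open>_ \<in> integral_operators\<close> unfolding integral_operator_iff by blast
    define tr where "tr = map (\<lambda>(x :: 'x, f :: 'x cdual). (f, eval_functional x))"
    have eq: "form_sum (\<lambda>x g. cblinfun_apply g ((c *\<^sub>C cblinfun_id) x)) (tr ps) = c * scalar_trace (form_sum (\<otimes>) ps)"
      for ps :: "('x \<times> 'x cdual) list"
      by (induction ps) (auto simp: tr_def cblinfun.zero_right cblinfun.add_right scalar_trace_tensor
          eval_functional_apply cblinfun_apply_scaleC cblinfun_scaleC_arg scaleC_complex_def algebra_simps)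
    obtain ps :: "('x \<times> 'x cdual) list"
      where ps: "cmod (scalar_trace (form_sum (\<otimes>) ps)) > (\<bar>C\<bar> / cmod c) * norm (form_sum elem_op ps)"
      using trace_unbounded by blast
    have "C * norm (form_sum rank_one (tr ps)) \<le> \<bar>C\<bar> * norm (form_sum rank_one ps)"
      unfolding tr_def by (intro mult_mono form_sum_rank_one_transpose) auto
    then have "cmod c * cmod (scalar_trace (form_sum (\<otimes>) ps)) \<le> \<bar>C\<bar> * norm (form_sum rank_one ps)"
      using C[of "tr ps"] unfolding eq norm_mult by linarith
    then show False
      using ps c unfolding norm_approx_op.rep_eq op_of_form_sum_elem_op by (simp add: field_simps)
  qed
  moreover have "0 \<in> (integral_operators :: ('x cdual \<Rightarrow>\<^sub>C\<^sub>L 'x cdual) set)"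
    by (rule complex_vector.subspace_0[OF subspace_integral_operators])
  ultimately show "(integral_operators :: ('x cdual \<Rightarrow>\<^sub>C\<^sub>L 'x cdual) set) \<inter> range (\<lambda>c. c *\<^sub>C cblinfun_id) = {0}"
    by (auto intro: range_eqI[of _ _ 0])
next
  fix T :: "'x cdual \<Rightarrow>\<^sub>C\<^sub>L 'x cdual"
  obtain \<psi> \<mu> where S: "\<And>f x. (T - \<mu> *\<^sub>C cblinfun_id) f x = cblinfun_apply \<psi> (elem_op x f)"
    using dual_operator_decomposition by blast
  have "T - \<mu> *\<^sub>C cblinfun_id \<in> integral_operators" by (rule approx_functional_integral[OF S])
  moreover have "T = (T - \<mu> *\<^sub>C cblinfun_id) + \<mu> *\<^sub>C cblinfun_id" by simp
  ultimately show "\<exists>v\<in>integral_operators. \<exists>w\<in>range (\<lambda>c. c *\<^sub>C cblinfun_id). T = v + w" by blast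
qed

text \<open>\<open>q\<close> minus \<open>\<mu>\<close> times the identity acts on \<open>Y\<close>
  as \<open>1 - \<mu>\<close> and on \<open>Z\<close> as \<open>- \<mu>\<close>, and these two
  numbers are not both 0.\<close>

lemma projection_finite:
  fixes q :: "'x cdual \<Rightarrow>\<^sub>C\<^sub>L 'x cdual"
  assumes Y: "\<And>y. y \<in> Y \<Longrightarrow> q y = y" and Z: "\<And>z. z \<in> Z \<Longrightarrow> q z = 0"
  shows "finite_cdim Y \<or> finite_cdim Z"
proof -
  obtain \<psi> \<mu> where S: "\<And>f x. (q - \<mu> *\<^sub>C cblinfun_id) f x = cblinfun_apply \<psi> (elem_op x f)"
    using dual_operator_decomposition by blast
  show ?thesis
  proof (cases "\<mu> = 1")
    case True
    have "finite_cdim Z"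
      by (rule finite_cdim_if_eigenspace[OF S, of Z "- 1"])
        (simp_all add: Z True cblinfun_apply_diff cblinfun_apply_scaleC)
    then show ?thesis ..
  next
    case False
    have "finite_cdim Y"
      by (rule finite_cdim_if_eigenspace[OF S, of Y "1 - \<mu>"])
        (use False in \<open>simp_all add: Y cblinfun_apply_diff cblinfun_apply_scaleC
          complex_vector.scale_left_diff_distrib\<close>)
    then show ?thesis ..
  qed
qed

lemma indecomposable_dual: "indecomposable TYPE('x cdual)"
  unfolding indecomposable_def
proof (intro allI impI, elim conjE)
  fix Y Z :: "'x cdual set" assume "closed Y" "closed Z" "direct_sum Y Z"
  then obtain q :: "'x cdual \<Rightarrow>\<^sub>C\<^sub>L 'x cdual" where "\<And>y. y \<in> Y \<Longrightarrow> q y = y" "\<And>z. z \<in> Z \<Longrightarrow> q z = 0"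
    using direct_sum_projection by metis
  then show "finite_cdim Y \<or> finite_cdim Z" by (rule projection_finite)
qed

text \<open>The functionals \<open>f o\<^sub>C\<^sub>L p\<close> separate the points of
  \<open>Y\<close>, because \<open>p\<close> is the identity there; so does any finite set spanning
  them.\<close>

lemma finite_cdim_predual:
  fixes Y :: "'x set" and p :: "'x \<Rightarrow>\<^sub>C\<^sub>L 'x"
  assumes Y: "complex_vector.subspace Y" and p: "\<And>y. y \<in> Y \<Longrightarrow> p y = y"
    and fin: "finite_cdim (range (\<lambda>f :: 'x cdual. f o\<^sub>C\<^sub>L p))"
  shows "finite_cdim Y"
proof -
  obtain G where G: "finite G" "range (\<lambda>f :: 'x cdual. f o\<^sub>C\<^sub>L p) \<subseteq> complex_vector.span G"
    using fin unfolding finite_cdim_def by blast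
  show ?thesis
  proof (rule finite_cdim_if_separated[OF Y G(1)], rule ccontr)
    fix y assume y: "y \<in> Y" "\<And>g. g \<in> G \<Longrightarrow> g y = 0" and nz: "y \<noteq> 0"
    obtain f :: "'x cdual" where f: "f y \<noteq> 0" using cdual_separates[OF nz] .
    have "complex_vector.subspace {g :: 'x cdual. g y = 0}"
      by (auto simp: complex_vector.subspace_def cblinfun_apply_add cblinfun_apply_scaleC)
    moreover have "G \<subseteq> {g. cblinfun_apply g y = 0}" using y(2) by auto
    ultimately have "complex_vector.span G \<subseteq> {g. cblinfun_apply g y = 0}" by (intro complex_vector.span_minimal)
    then have "(f o\<^sub>C\<^sub>L p) y = 0" using G(2) by blast
    then show False using f p[OF y(1)] by simp
  qed
qed

text \<open>The projection is replaced by its adjoint \<open>Q\<close>, to which the result on the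
  dual applies: \<open>Q\<close> fixes every \<open>f o\<^sub>C\<^sub>L q\<close> and kills every
  \<open>f o\<^sub>C\<^sub>L p\<close>. Finite dimension of one of these families is carried back to
  \<open>Y\<close> or \<open>Z\<close>.\<close>

lemma indecomposable_space: "indecomposable TYPE('x)"
  unfolding indecomposable_def
proof (intro allI impI, elim conjE)
  fix Y Z :: "'x set" assume YZ: "closed Y" "closed Z" "direct_sum Y Z"
  then obtain q :: "'x \<Rightarrow>\<^sub>C\<^sub>L 'x" where q: "\<And>y. y \<in> Y \<Longrightarrow> q y = y" "\<And>z. z \<in> Z \<Longrightarrow> q z = 0"
    "\<And>x. q x \<in> Y" "\<And>x. x - q x \<in> Z"
    using direct_sum_projection[OF YZ(3,1,2)] by metis
  have sub: "complex_vector.subspace Y" "complex_vector.subspace Z" using YZ(3) unfolding direct_sum_def by auto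
  have qq: "q (q x) = q x" for x by (rule q(1)[OF q(3)])
  define p where "p = cblinfun_id - q"
  have p: "p x = x - q x" for x by (simp add: p_def cblinfun_apply_diff)
  have bl: "bounded_clinear (\<lambda>f :: 'x cdual. f o\<^sub>C\<^sub>L q)"
    by (rule bounded_clinear_intro[where K = "norm q"])
      (auto intro!: cblinfun_eqI simp: cblinfun_apply_add cblinfun_apply_scaleC norm_cblinfun_compose)
  define Q where "Q = CBlinfun (\<lambda>f :: 'x cdual. f o\<^sub>C\<^sub>L q)"
  have Q: "Q f = f o\<^sub>C\<^sub>L q" for f by (simp add: Q_def CBlinfun_apply[OF bl])
  have "finite_cdim (range (\<lambda>f :: 'x cdual. f o\<^sub>C\<^sub>L q)) \<or> finite_cdim (range (\<lambda>f :: 'x cdual. f o\<^sub>C\<^sub>L p))"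
  proof (rule projection_finite[of _ Q])
    show "Q y = y" if "y \<in> range (\<lambda>f :: 'x cdual. f o\<^sub>C\<^sub>L q)" for y
      using that by (auto simp: Q qq intro!: cblinfun_eqI)
    show "Q y = 0" if "y \<in> range (\<lambda>f :: 'x cdual. f o\<^sub>C\<^sub>L p)" for y
      using that by (auto simp: Q qq p cblinfun.zero_right intro!: cblinfun_eqI)
  qed
  then show "finite_cdim Y \<or> finite_cdim Z"
  proof
    assume "finite_cdim (range (\<lambda>f :: 'x cdual. f o\<^sub>C\<^sub>L q))"
    with sub(1) q(1) have "finite_cdim Y" by (rule finite_cdim_predual)
    then show ?thesis ..
  next
    assume "finite_cdim (range (\<lambda>f :: 'x cdual. f o\<^sub>C\<^sub>L p))"
    moreover have "p z = z" if "z \<in> Z" for z by (simp add: p q(2)[OF that])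
    ultimately have "finite_cdim Z" using sub(2) finite_cdim_predual by metis
    then show ?thesis ..
  qed
qed

end

section \<open>Derivations and traces\<close>

lemma derivation_apply:
  assumes "derivation D"
  shows "D (a * b) c = D b (c * a) + D a (b * c)"
  using assms by (simp add: derivation_def cblinfun_apply_add dual_lact_apply dual_ract_apply)

lemma derivationI:
  fixes D :: "'a::complex_banach_algebra \<Rightarrow>\<^sub>C\<^sub>L 'a cdual"
  assumes "\<And>a b c. D (a * b) c = D b (c * a) + D a (b * c)"
  shows "derivation D"
  unfolding derivation_def
  by (intro allI cblinfun_eqI) (simp add: assms cblinfun_apply_add dual_lact_apply dual_ract_apply)

lemma inner_derivation_iff:
  fixes D :: "'a::complex_banach_algebra \<Rightarrow>\<^sub>C\<^sub>L 'a cdual"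
  shows "inner_derivation D \<longleftrightarrow> (\<exists>\<phi>. \<forall>a b. D a b = cblinfun_apply \<phi> (b * a) - \<phi> (a * b))"
proof -
  have "D a = dual_lact a \<phi> - dual_ract \<phi> a \<longleftrightarrow> (\<forall>b. D a b = \<phi> (b * a) - \<phi> (a * b))" for a \<phi>
    using cblinfun_eqI[of "D a" "dual_lact a \<phi> - dual_ract \<phi> a"]
    by (auto simp: cblinfun_apply_diff dual_lact_apply dual_ract_apply)
  then show ?thesis unfolding inner_derivation_def by simp
qed

lemma bounded_clinear_elem_op:
  "bounded_clinear (\<lambda>x. elem_op x f)" "bounded_clinear (elem_op x)"
  using bounded_clinear_partial[OF bounded_cbilinear_flip[OF bounded_cbilinear_elem_op]]
    bounded_clinear_partial[OF bounded_cbilinear_elem_op] by auto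

text \<open>
  On the finite rank operators every derivation is inner, implemented by a functional on \<open>X \<otimes> X\<^sup>*\<close>: the
  elementary operators behave like matrix units over the idempotent \<open>elem_op z f\<^sub>0\<close>.
\<close>

lemma derivation_elem_op:
  fixes D :: "'x::complex_banach approx_op \<Rightarrow>\<^sub>C\<^sub>L 'x approx_op cdual" and f0 :: "'x cdual"
  assumes D: "derivation D" and z: "f0 z = 1"
  shows "\<exists>\<phi> :: 'x trace_tensor cdual. \<forall>x f y g.
    D (elem_op x f) (elem_op y g) = f y * \<phi> (x \<otimes> g) - g x * \<phi> (y \<otimes> f)"
proof -
  define L where "L = CBlinfun (\<lambda>x. elem_op x f0)"
  define R where "R = CBlinfun (elem_op z)"
  have L: "L x = elem_op x f0" and R: "R g = elem_op z g" for x g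
    by (simp_all add: L_def R_def CBlinfun_apply bounded_clinear_elem_op)
  have bil: "bounded_cbilinear (\<lambda>x g. D (L x) (R g))"
    by (rule bounded_cbilinear_compose[OF bounded_cbilinear_apply])
  define \<phi> where "\<phi> = tensor_lift (\<lambda>x g. D (L x) (R g))"
  have \<phi>: "\<phi> (x \<otimes> g) = D (elem_op x f0) (elem_op z g)" for x g
  proof -
    have "\<phi> (x \<otimes> g) = D (L x) (R g)" unfolding \<phi>_def by (rule tensor_lift_tensor[OF bil])
    then show ?thesis by (simp add: L R)
  qed
  define e where "e = elem_op z f0"
  have "D (e * e) e = D e (e * e) + D e (e * e)" by (rule derivation_apply[OF D])
  then have ee: "D e e = 0" by (simp add: e_def elem_op_mult(1) z)
  \<comment> \<open>\<open>elem_op z f * elem_op y f0\<close> is \<open>f y\<close> times the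
    idempotent \<open>e\<close>, and \<open>D e e = 0\<close>; the rule for this product is tested
    at \<open>e\<close>.\<close>
  have anti: "D (elem_op z f) (elem_op y f0) = - D (elem_op y f0) (elem_op z f)" for f y
  proof -
    have "D (elem_op z f * elem_op y f0) e = D (elem_op y f0) (e * elem_op z f) + D (elem_op z f) (elem_op y f0 * e)"
      by (rule derivation_apply[OF D])
    then have "f y *\<^sub>C D e e = D (elem_op y f0) (elem_op z f) + D (elem_op z f) (elem_op y f0)"
      by (simp add: e_def elem_op_mult(1) z cblinfun_scaleC_arg cblinfun_apply_scaleC)
    then show ?thesis by (simp add: ee add_eq_0_iff2 scaleC_complex_def)
  qed
  have "D (elem_op x f) (elem_op y g) = f y * \<phi> (x \<otimes> g) - g x * \<phi> (y \<otimes> f)" for x f y g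
  proof -
    \<comment> \<open>The product is \<open>elem_op x f\<close>, as \<open>f0 z = 1\<close>. The
      derivation rule leaves values of the kind that define \<open>\<phi>\<close>, one of them after
      \<open>anti\<close>.\<close>
    have "D (elem_op x f0 * elem_op z f) (elem_op y g)
      = D (elem_op z f) (elem_op y g * elem_op x f0) + D (elem_op x f0) (elem_op z f * elem_op y g)"
      by (rule derivation_apply[OF D])
    then show ?thesis
      by (simp add: elem_op_mult(1) z cblinfun_scaleC_arg cblinfun_apply_scaleC anti \<phi> scaleC_complex_def)
  qed
  then show ?thesis by blast
qed

lemma nonzero_vector_if_nonzero_tensor:
  fixes u :: "('a::complex_normed_vector, 'b::complex_normed_vector) proj_tensor"
  assumes "u \<noteq> 0"
  shows "\<exists>z :: 'a. z \<noteq> 0"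
proof (rule ccontr)
  assume "\<not> ?thesis"
  then have z: "x = 0" for x :: 'a by blast
  have "(cblinfun_id :: ('a, 'b) proj_tensor \<Rightarrow>\<^sub>C\<^sub>L _) = 0"
  proof (rule proj_tensor_cblinfun_eqI)
    fix x :: 'a and y :: 'b
    have "x \<otimes> y = 0" unfolding z[of x] by (rule tensor_bilinear)
    then show "cblinfun_id (x \<otimes> y) = cblinfun_apply 0 (x \<otimes> y)" by simp
  qed
  then have "cblinfun_id u = 0" by simp
  then show False using assms by simp
qed

lemma (in one_dim_trace_kernel) weakly_amenable_approx_op: "weakly_amenable TYPE('x approx_op)"
  unfolding weakly_amenable_def inner_derivation_iff
proof (intro allI impI)
  fix D :: "'x approx_op \<Rightarrow>\<^sub>C\<^sub>L 'x approx_op cdual"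
  assume D: "derivation D"
  obtain z :: 'x where "z \<noteq> 0" using nonzero_vector_if_nonzero_tensor[OF k_nonzero] by blast
  then obtain f0 :: "'x cdual" where z: "f0 z = 1" by (rule separating_functional_one)
  obtain \<phi> :: "'x trace_tensor cdual" where \<phi>: "\<And>x f y g.
      D (elem_op x f) (elem_op y g) = f y * \<phi> (x \<otimes> g) - g x * \<phi> (y \<otimes> f)"
    using derivation_elem_op[OF D z] by blast
  obtain \<psi> \<mu> where dec: "\<And>u. \<phi> u = cblinfun_apply \<psi> (approx_trace u) + \<mu> * scalar_trace u"
    using functional_decomposition by metis
  \<comment> \<open>The part \<open>\<mu> * scalar_trace\<close> of \<open>\<phi>\<close>
    contributes \<open>\<mu> * (f y * g x - g x * f y) = 0\<close>; the sign of
    \<open>\<tau>\<close> matches the order of products in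
    \<open>inner_derivation_iff\<close>.\<close>
  define \<tau> where "\<tau> = (- 1) *\<^sub>C \<psi>"
  have b1: "bounded_cbilinear (\<lambda>a b. \<tau> (a * b))"
    by (rule bounded_cbilinear_post[OF bounded_cbilinear_times])
  have bil: "bounded_cbilinear (\<lambda>a b. \<tau> (b * a) + (- 1) *\<^sub>C \<tau> (a * b))"
    by (rule bounded_cbilinear_add[OF bounded_cbilinear_flip[OF b1] bounded_cbilinear_scale[OF b1]])
  have elem: "D (elem_op x f) (elem_op y g)
      = \<tau> (elem_op y g * elem_op x f) + (- 1) *\<^sub>C \<tau> (elem_op x f * elem_op y g)" for x f y g
    unfolding \<phi> dec approx_trace_tensor scalar_trace_tensor elem_op_mult(1) cblinfun_scaleC_arg
    by (simp add: \<tau>_def cblinfun_apply_minus scaleC_complex_def algebra_simps)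
  have "D a b = \<tau> (b * a) + (- 1) *\<^sub>C \<tau> (a * b)" for a b
    by (rule bounded_cbilinear_approx_eqI[OF bounded_cbilinear_apply[of D] bil elem])
  then show "\<exists>\<phi>. \<forall>a b. D a b = cblinfun_apply \<phi> (b * a) - \<phi> (a * b)"
    by (intro exI[of _ \<tau>]) simp
qed

section \<open>Self-induced algebras and balanced functionals\<close>

lemma complex_subspace_closure:
  fixes S :: "'a::complex_normed_vector set"
  assumes S: "complex_vector.subspace S"
  shows "complex_vector.subspace (closure S)"
  unfolding complex_vector.subspace_def
proof (intro conjI ballI allI)
  show "0 \<in> closure S" using complex_vector.subspace_0[OF S] closure_subset by blast
  fix x y c assume "x \<in> closure S"
  then obtain a where a: "\<And>n::nat. a n \<in> S" "a \<longlonglongrightarrow> x" unfolding closure_sequential by blast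
  have "(\<lambda>n. c *\<^sub>C a n) \<longlonglongrightarrow> c *\<^sub>C x" by (rule bounded_linear.tendsto[OF bounded_linear_scaleC a(2)])
  then show "c *\<^sub>C x \<in> closure S"
    unfolding closure_sequential using complex_vector.subspace_scale[OF S a(1)]
    by (intro exI[of _ "\<lambda>n. c *\<^sub>C a n"]) simp
  assume "y \<in> closure S"
  then obtain b where b: "\<And>n::nat. b n \<in> S" "b \<longlonglongrightarrow> y" unfolding closure_sequential by blast
  have "(\<lambda>n. a n + b n) \<longlonglongrightarrow> x + y" by (rule tendsto_add[OF a(2) b(2)])
  then show "x + y \<in> closure S"
    unfolding closure_sequential using complex_vector.subspace_add[OF S a(1) b(1)]
    by (intro exI[of _ "\<lambda>n. a n + b n"]) simp
qed

text \<open>Norm-controlled lifts make the range closed: lifts of the successive differences of a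
  fast approximating sequence sum up to a lift of the limit.\<close>

lemma surjective_if_dense_range:
  fixes L :: "'a::complex_banach \<Rightarrow>\<^sub>C\<^sub>L 'b::complex_banach"
  assumes lift: "\<And>u. \<exists>w. L w = L u \<and> norm w \<le> C * norm (L u)"
    and dense: "\<And>a e. e > 0 \<Longrightarrow> \<exists>u. norm (L u - a) < e"
  shows "\<exists>u. L u = a"
proof -
  define e :: "nat \<Rightarrow> real" where "e n = (1 / 2) ^ n" for n
  have e: "e n > 0" "e (Suc n) \<le> e n" for n by (simp_all add: e_def)
  have e_sum: "summable (\<lambda>n. \<bar>C\<bar> * (2 * e n))"
    unfolding e_def by (intro summable_mult summable_geometric) simp
  have e0: "e \<longlonglongrightarrow> 0" unfolding e_def by (rule LIMSEQ_power_zero) simp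
  obtain u where u: "\<And>n. norm (L (u n) - a) < e n" using dense[OF e(1)] by metis
  have "(\<lambda>n. L (u n) - a) \<longlonglongrightarrow> 0"
    by (rule Lim_null_comparison[OF always_eventually e0]) (blast intro: less_imp_le[OF u])
  then have lim: "(\<lambda>n. L (u n)) \<longlonglongrightarrow> a" by (simp add: LIM_zero_cancel)
  have "\<forall>n. \<exists>w. L w = L (u (Suc n) - u n) \<and> norm w \<le> C * norm (L (u (Suc n) - u n))"
    by (intro allI lift)
  from choice[OF this] obtain w where w: "\<And>n. L (w n) = L (u (Suc n) - u n)"
    "\<And>n. norm (w n) \<le> C * norm (L (u (Suc n) - u n))"
    by blast
  have wb: "norm (w n) \<le> \<bar>C\<bar> * (2 * e n)" for n
  proof -
    have "norm (L (u (Suc n) - u n)) \<le> norm (L (u (Suc n)) - a) + norm (L (u n) - a)"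
      using norm_triangle_ineq4[of "L (u (Suc n)) - a" "L (u n) - a"] by (simp add: cblinfun.diff_right)
    also have "\<dots> \<le> 2 * e n" using u[of "Suc n"] u[of n] e(2)[of n] by linarith
    finally have "\<bar>C\<bar> * norm (L (u (Suc n) - u n)) \<le> \<bar>C\<bar> * (2 * e n)" by (intro mult_left_mono) auto
    moreover have "C * norm (L (u (Suc n) - u n)) \<le> \<bar>C\<bar> * norm (L (u (Suc n) - u n))"
      by (intro mult_right_mono) auto
    ultimately show ?thesis using w(2)[of n] by linarith
  qed
  have "summable (\<lambda>n. norm (w n))"
    by (rule summable_comparison_test'[OF e_sum, where N = 0]) (simp add: wb)
  then have "w sums (\<Sum>n. w n)" by (rule summable_sums[OF summable_norm_cancel])
  then have "(\<lambda>n. L (w n)) sums L (\<Sum>n. w n)"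
    by (rule bounded_linear.sums[OF bounded_linear_cblinfun_apply])
  moreover have "(\<lambda>n. L (w n)) sums (a - L (u 0))"
    unfolding w(1) cblinfun.diff_right by (rule telescope_sums[OF lim])
  ultimately have "L (\<Sum>n. w n) = a - L (u 0)" by (rule sums_unique2)
  then have "L ((\<Sum>n. w n) + u 0) = a" by (simp add: cblinfun.add_right)
  then show ?thesis by blast
qed

text \<open>A bounded bilinear form in curried form; the condition says that the functional it
  induces on the projective tensor product kills the generators of
  \<open>balanced_subspace\<close>.\<close>

definition balanced :: "('a::complex_banach_algebra \<Rightarrow>\<^sub>C\<^sub>L 'a cdual) \<Rightarrow> bool"
  where "balanced D \<longleftrightarrow> (\<forall>a b c. D (a * c) b = D a (c * b))"

text \<open>By \<open>factor\<close>, the range of the adjoint of multiplication is the annihilator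
  of the balanced subspace, hence closed. The open mapping theorem then bounds the choice of
  \<open>\<psi>\<close>, and Hahn-Banach turns this into a bound of the quotient norm by the norm of
  the product. Together with density this yields surjectivity.\<close>

lemma self_induced_if_balanced_factor:
  assumes factor: "\<And>D :: 'a::complex_banach_algebra \<Rightarrow>\<^sub>C\<^sub>L 'a cdual. balanced D \<Longrightarrow>
      \<exists>\<psi>. \<forall>a b. cblinfun_apply (cblinfun_apply D a) b = cblinfun_apply \<psi> (a * b)"
    and dense: "\<And>(a :: 'a) e. e > 0 \<Longrightarrow> \<exists>u. norm (multiplication_map u - a) < e"
  shows "self_induced TYPE('a)"
proof -
  define L where "L = (multiplication_map :: ('a, 'a) proj_tensor \<Rightarrow>\<^sub>C\<^sub>L 'a)"
  define N where "N = (balanced_subspace (*) (*) :: ('a, 'a) proj_tensor set)"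
  have N: "complex_vector.subspace N" "closed N"
    unfolding N_def balanced_subspace_def
    by (simp_all add: complex_subspace_closure complex_vector.subspace_span)
  have N0: "0 \<in> N" using N(1) by (rule complex_vector.subspace_0)
  have NL: "L n = 0" if "n \<in> N" for n
    using balanced_subspace_le_kernel that unfolding N_def L_def kernel_def by blast
  have gen: "(a * c) \<otimes> b - a \<otimes> (c * b) \<in> N" for a b c
    unfolding N_def balanced_subspace_def
    by (rule subsetD[OF closure_subset], rule complex_vector.span_base) blast
  define P where "P = {\<phi> :: ('a, 'a) proj_tensor cdual. \<forall>n\<in>N. \<phi> n = 0}"
  have ex: "\<exists>\<psi> :: 'a cdual. \<phi> = \<psi> o\<^sub>C\<^sub>L L" if \<phi>: "\<phi> \<in> P" for \<phi>
  proof -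
    obtain D :: "'a \<Rightarrow>\<^sub>C\<^sub>L 'a cdual" where D: "\<And>a b. D a b = \<phi> (a \<otimes> b)"
      using curry_bounded_cbilinear[OF bounded_cbilinear_post[OF bounded_cbilinear_tensor], of \<phi>] by metis
    have "\<phi> ((a * c) \<otimes> b - a \<otimes> (c * b)) = 0" for a b c
      using \<phi> gen[of a c b] unfolding P_def by simp
    then have "balanced D" by (simp add: balanced_def D cblinfun.diff_right)
    then obtain \<psi> :: "'a cdual" where "\<And>a b. D a b = \<psi> (a * b)" using factor by blast
    then have "\<phi> = \<psi> o\<^sub>C\<^sub>L L"
      by (intro proj_tensor_cblinfun_eqI) (simp add: L_def multiplication_map_tensor flip: D)
    then show ?thesis by blast
  qed
  have im: "(\<lambda>\<psi> :: 'a cdual. \<psi> o\<^sub>C\<^sub>L L) ` UNIV = P"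
  proof (intro equalityI subsetI)
    show "\<phi> \<in> P" if "\<phi> \<in> (\<lambda>\<psi> :: 'a cdual. \<psi> o\<^sub>C\<^sub>L L) ` UNIV" for \<phi>
      using that by (auto simp: P_def NL cblinfun.zero_right)
    show "\<phi> \<in> (\<lambda>\<psi> :: 'a cdual. \<psi> o\<^sub>C\<^sub>L L) ` UNIV" if "\<phi> \<in> P" for \<phi>
      using ex[OF that] by blast
  qed
  have "P = (\<Inter>n\<in>N. {\<phi>. cblinfun_apply \<phi> n = 0})" by (auto simp: P_def)
  moreover have "closed {\<phi> :: ('a, 'a) proj_tensor cdual. \<phi> n = 0}" for n
    by (intro closed_Collect_eq bounded_linear.continuous_on[OF cblinfun.bounded_linear_left]
        continuous_on_id continuous_on_const)
  ultimately have "closed P" by (simp add: closed_INT)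
  then have cl: "closed ((\<lambda>\<psi> :: 'a cdual. \<psi> o\<^sub>C\<^sub>L L) ` UNIV)" by (simp add: im)
  have bl: "bounded_linear (\<lambda>\<psi> :: 'a cdual. \<psi> o\<^sub>C\<^sub>L L)"
    by (rule bounded_bilinear.bounded_linear_left[OF bounded_bilinear_cblinfun_compose])
  have "\<exists>C>0. \<forall>\<phi>\<in>(\<lambda>\<psi> :: 'a cdual. \<psi> o\<^sub>C\<^sub>L L) ` UNIV. \<exists>\<psi>\<in>UNIV. \<psi> o\<^sub>C\<^sub>L L = \<phi> \<and> norm \<psi> \<le> C * norm \<phi>"
    by (rule open_mapping_subspace[OF bl subspace_UNIV closed_UNIV cl])
  then obtain C where C0: "C > 0" and C: "\<And>\<phi>. \<phi> \<in> P \<Longrightarrow> \<exists>\<psi> :: 'a cdual. \<psi> o\<^sub>C\<^sub>L L = \<phi> \<and> norm \<psi> \<le> C * norm \<phi>"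
    unfolding im by auto
  define qn where "qn u = quotient_norm ((+) u ` N)" for u
  have bdd: "bdd_below (norm ` (+) u ` N)" for u by (rule bdd_belowI[of _ 0]) auto
  have qn_le: "qn u \<le> norm (u + n)" if "n \<in> N" for u n
    unfolding qn_def quotient_norm_def by (rule cInf_lower[OF _ bdd]) (use that in auto)
  have qn_greatest: "d \<le> qn u" if "\<And>n. n \<in> N \<Longrightarrow> d \<le> norm (u + n)" for d u
    unfolding qn_def quotient_norm_def by (rule cInf_greatest) (use that N0 in auto)
  have qn_bound: "qn u \<le> C * norm (L u)" for u
  proof -
    have "qn u \<le> norm (u - n)" if "n \<in> N" for n
      using qn_le[OF complex_vector.subspace_neg[OF N(1) that], of u] by simp
    moreover have "0 \<le> qn u" by (rule qn_greatest) simp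
    ultimately obtain \<phi> :: "('a, 'a) proj_tensor cdual"
      where n1: "norm \<phi> \<le> 1" and \<phi>: "\<And>n. n \<in> N \<Longrightarrow> \<phi> n = 0" "\<phi> u = qn u"
      using functional_distance[OF N(1), of "qn u" u] by metis
    obtain \<psi> where \<psi>: "\<psi> o\<^sub>C\<^sub>L L = \<phi>" "norm \<psi> \<le> C * norm \<phi>" using C[of \<phi>] \<phi>(1) by (auto simp: P_def)
    have "qn u \<le> cmod (\<phi> u)" by (simp add: \<phi>(2))
    also have "\<dots> = cmod (\<psi> (L u))" by (simp flip: \<psi>(1))
    also have "\<dots> \<le> norm \<psi> * norm (L u)" by (rule norm_cblinfun)
    also have "\<dots> \<le> C * norm (L u)"
      using \<psi>(2) mult_left_mono[OF n1 less_imp_le[OF C0]] by (intro mult_right_mono) auto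
    finally show ?thesis .
  qed
  \<comment> \<open>The infimum in the quotient norm may not be attained, so \<open>C\<close> is
    doubled; for \<open>L u = 0\<close> doubling gains nothing, and the lift is 0.\<close>
  have lift: "\<exists>w. L w = L u \<and> norm w \<le> (2 * C) * norm (L u)" for u
  proof (cases "L u = 0")
    case True
    then show ?thesis by (intro exI[of _ 0]) (simp add: cblinfun.zero_right)
  next
    case False
    then have "0 < C * norm (L u)" using C0 by simp
    then have "qn u < (2 * C) * norm (L u)" using qn_bound[of u] by linarith
    moreover have "(2 * C) * norm (L u) \<le> qn u" if "\<And>n. n \<in> N \<Longrightarrow> (2 * C) * norm (L u) \<le> norm (u + n)"
      using that by (rule qn_greatest)
    ultimately obtain n where n: "n \<in> N" "norm (u + n) < (2 * C) * norm (L u)"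
      by (metis not_less)
    then show ?thesis by (intro exI[of _ "u + n"]) (simp add: cblinfun.add_right NL)
  qed
  have surj: "\<exists>u. L u = a" for a
    by (rule surjective_if_dense_range[OF lift]) (use dense in \<open>simp add: L_def\<close>)
  define Q where "Q = (module_tensor (*) (*) :: ('a, 'a) proj_tensor set set)"
  define m where "m = induced_map L"
  have Q: "Q = range (\<lambda>u. (+) u ` N)" by (simp add: Q_def module_tensor_def quotient_space_def N_def)
  have m: "m ((+) u ` N) = L u" for u
    unfolding m_def by (rule induced_map_coset) (use NL N0 in \<open>auto simp: kernel_def\<close>)
  have coset_eq: "(+) u ` N = (+) v ` N" if uv: "L u = L v" for u v
  proof -
    have uvN: "u - v \<in> N"
    proof (rule ccontr)
      assume "u - v \<notin> N"
      then obtain \<phi> :: "('a, 'a) proj_tensor cdual" where \<phi>: "\<And>n. n \<in> N \<Longrightarrow> \<phi> n = 0" "\<phi> (u - v) \<noteq> 0"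
        using functional_vanishing_on_subspace[OF N] by metis
      then obtain \<psi> :: "'a cdual" where "\<phi> = \<psi> o\<^sub>C\<^sub>L L" using ex[of \<phi>] by (auto simp: P_def)
      then show False using \<phi>(2) uv by (simp add: cblinfun.diff_right cblinfun.zero_right)
    qed
    have sub: "(+) w ` N \<subseteq> (+) w' ` N" if "w - w' \<in> N" for w w'
    proof
      fix x assume "x \<in> (+) w ` N"
      then obtain n where n: "n \<in> N" "x = w + n" by blast
      then have "x = w' + ((w - w') + n)" by simp
      then show "x \<in> (+) w' ` N" using complex_vector.subspace_add[OF N(1) that n(1)] by (rule image_eqI)
    qed
    have "v - u \<in> N" using complex_vector.subspace_neg[OF N(1) uvN] by simp
    then show ?thesis using sub uvN by (intro equalityI)
  qed
  have "inj_on m Q"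
  proof (rule inj_onI)
    fix q q' assume "q \<in> Q" "q' \<in> Q" and eq: "m q = m q'"
    then obtain u v where uv: "q = (+) u ` N" "q' = (+) v ` N" unfolding Q by blast
    then show "q = q'" using coset_eq[of u v] eq by (simp add: m)
  qed
  moreover have "m ` Q = UNIV"
  proof (intro equalityI subsetI UNIV_I)
    fix a :: 'a
    obtain u where "L u = a" using surj by blast
    then have "a = m ((+) u ` N)" by (simp add: m)
    then show "a \<in> m ` Q" unfolding Q by blast
  qed
  ultimately have bij: "bij_betw m Q UNIV" by (simp add: bij_betw_def)
  have b1: "norm (m q) \<le> (norm L + 1) * quotient_norm q" if "q \<in> Q" for q
  proof -
    obtain u where u: "q = (+) u ` N" using \<open>q \<in> Q\<close> unfolding Q by blast
    have pos: "norm L + 1 > 0" by (simp add: add_nonneg_pos)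
    have "norm (L u) / (norm L + 1) \<le> qn u"
    proof (rule qn_greatest)
      fix n assume "n \<in> N"
      then have "L u = L (u + n)" by (simp add: cblinfun.add_right NL)
      then have "norm (L u) \<le> norm L * norm (u + n)" by (metis norm_cblinfun)
      also have "\<dots> \<le> (norm L + 1) * norm (u + n)" by (simp add: mult_right_mono)
      finally show "norm (L u) / (norm L + 1) \<le> norm (u + n)"
        using pos by (simp add: pos_divide_le_eq mult.commute)
    qed
    then show ?thesis using pos by (simp add: u m qn_def pos_divide_le_eq mult.commute)
  qed
  have b2: "quotient_norm q \<le> C * norm (m q)" if "q \<in> Q" for q
  proof -
    obtain u where u: "q = (+) u ` N" using \<open>q \<in> Q\<close> unfolding Q by blast
    show ?thesis using qn_bound[of u] by (simp add: u m qn_def)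
  qed
  show ?thesis
    unfolding self_induced_def Let_def Q_def[symmetric] L_def[symmetric] m_def[symmetric]
  proof (intro conjI)
    show "bij_betw m Q UNIV" by (rule bij)
    show "\<exists>C. \<forall>q\<in>Q. norm (m q) \<le> C * quotient_norm q" using b1 by blast
    show "\<exists>C. \<forall>q\<in>Q. quotient_norm q \<le> C * norm (m q)" using b2 by blast
  qed
qed

section \<open>Weak amenability of algebras that are not self-induced\<close>

lemma balanced_functional_decomposition:
  fixes D :: "'x::complex_banach approx_op \<Rightarrow>\<^sub>C\<^sub>L 'x approx_op cdual" and f0 :: "'x cdual"
  assumes wa: "weakly_amenable TYPE('x approx_op)" and D: "balanced D" and z: "f0 z = 1"
  shows "\<exists>\<psi> \<mu>. \<forall>x f y g.
    D (elem_op x f) (elem_op y g) = cblinfun_apply \<psi> (elem_op x f * elem_op y g) + \<mu> * (f y * g x)"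
proof -
  have bal: "D (a * c) b = D a (c * b)" for a b c using D by (simp add: balanced_def)
  have b1: "bounded_cbilinear (\<lambda>a b. D a b)" by (rule bounded_cbilinear_apply)
  obtain E :: "'x approx_op \<Rightarrow>\<^sub>C\<^sub>L 'x approx_op cdual" where E: "\<And>a b. E a b = D a b + (- 1) *\<^sub>C D b a"
    using curry_bounded_cbilinear[OF bounded_cbilinear_add[OF b1 bounded_cbilinear_scale[OF bounded_cbilinear_flip[OF b1]]]]
    by metis
  have "derivation E"
  proof (rule derivationI)
    fix a b c
    \<comment> \<open>Balance permits cyclic moves: on the right \<open>D b (c * a)\<close> cancels
      against \<open>D (b * c) a\<close>.\<close>
    show "E (a * b) c = E b (c * a) + E a (b * c)"
      using bal[of a b c] bal[of c a b] bal[of b c a] by (simp add: E)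
  qed
  then obtain \<phi> where \<phi>: "\<And>a b. E a b = cblinfun_apply \<phi> (b * a) - \<phi> (a * b)"
    using wa unfolding weakly_amenable_def inner_derivation_iff by blast
  define B where "B a b = D a b + \<phi> (a * b)" for a b
  have symm: "B a b = B b a" for a b
    using \<phi>[of a b] E[of a b] by (simp add: B_def algebra_simps)
  have Bbal: "B (a * c) b = B a (c * b)" for a b c by (simp add: B_def bal mult.assoc)
  have Bscale: "B (c *\<^sub>C a) b = c * B a b" "B a (c *\<^sub>C b) = c * B a b" for a b c
    by (simp_all add: B_def cblinfun_scaleC_arg cblinfun_apply_scaleC scaleC_complex_def mult_scaleC_left
        mult_scaleC_right algebra_simps)
  define \<mu> where "\<mu> = B (elem_op z f0) (elem_op z f0)"
  \<comment> \<open>Balance moves the factor over the idempotent \<open>elem_op z f0\<close> across;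
    symmetry then brings the two outer factors together for a second move, and only the value at the
    idempotent is left.\<close>
  have B_elem: "B (elem_op x f) (elem_op y g) = \<mu> * (f y * g x)" for x f y g
  proof -
    have "B (elem_op x f) (elem_op y g) = B (elem_op x f0 * elem_op z f) (elem_op y g)"
      by (simp add: elem_op_mult(1) z)
    also have "\<dots> = B (elem_op x f0) (elem_op z f * elem_op y g)" by (rule Bbal)
    also have "\<dots> = f y * B (elem_op x f0) (elem_op z g)" by (simp only: elem_op_mult(1) Bscale)
    also have "B (elem_op x f0) (elem_op z g) = B (elem_op z f0 * elem_op z g) (elem_op x f0)"
      using symm[of "elem_op x f0" "elem_op z g"] by (simp add: elem_op_mult(1) z)
    also have "\<dots> = B (elem_op z f0) (elem_op z g * elem_op x f0)" by (rule Bbal)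
    also have "\<dots> = g x * \<mu>" by (simp only: elem_op_mult(1) Bscale \<mu>_def)
    finally show ?thesis by simp
  qed
  have "D (elem_op x f) (elem_op y g) = (- \<phi>) (elem_op x f * elem_op y g) + \<mu> * (f y * g x)" for x f y g
  proof -
    have "D (elem_op x f) (elem_op y g) = B (elem_op x f) (elem_op y g) - \<phi> (elem_op x f * elem_op y g)"
      by (simp add: B_def)
    then show ?thesis by (simp add: B_elem cblinfun_apply_minus)
  qed
  then show ?thesis by blast
qed

text \<open>\<open>M b a\<close> is the product \<open>a * b\<close> lifted to P. For
  \<open>b\<close> of finite rank, the trace of a twist of the lift is \<open>B0\<close> at
  \<open>a\<close> and the twisted \<open>b\<close>, and a twist by \<open>norm T \<le> 1\<close>
  does not increase the operator norm of \<open>b\<close>. So the projective norm of the lift is at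
  most \<open>norm B0 * norm b * norm a\<close>, and density does the rest.\<close>

lemma trace_product_extension:
  fixes B0 :: "'x::complex_banach approx_op \<Rightarrow>\<^sub>C\<^sub>L 'x approx_op cdual"
  assumes B0: "\<And>x f y g. B0 (elem_op x f) (elem_op y g) = f y * g x"
  obtains M :: "'x approx_op \<Rightarrow>\<^sub>C\<^sub>L 'x approx_op \<Rightarrow>\<^sub>C\<^sub>L 'x trace_tensor"
    where "\<And>a y g. M (elem_op y g) a = op_of_approx a y \<otimes> g"
proof -
  define R where "R y g = CBlinfun (\<lambda>a. op_of_approx a y \<otimes> g)" for y :: 'x and g :: "'x cdual"
  have R: "R y g a = op_of_approx a y \<otimes> g" for y g a
  proof -
    have "bounded_clinear (\<lambda>a. op_of_approx a y \<otimes> g)"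
    proof (rule bounded_clinear_intro[where K = "norm y * norm g"])
      fix a b :: "'x approx_op" and c
      show "op_of_approx (a + b) y \<otimes> g = op_of_approx a y \<otimes> g + op_of_approx b y \<otimes> g"
        by (simp add: plus_approx_op.rep_eq cblinfun_apply_add tensor_bilinear)
      show "op_of_approx (c *\<^sub>C a) y \<otimes> g = c *\<^sub>C (op_of_approx a y \<otimes> g)"
        by (simp add: scaleC_approx_op.rep_eq cblinfun_apply_scaleC tensor_bilinear)
      have "norm (op_of_approx a y) * norm g \<le> (norm a * norm y) * norm g"
        unfolding norm_approx_op.rep_eq by (intro mult_right_mono norm_cblinfun) auto
      then show "norm (op_of_approx a y \<otimes> g) \<le> norm a * (norm y * norm g)"
        using norm_tensor_le[of "op_of_approx a y" g] by (simp add: mult.assoc)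
    qed
    then show ?thesis by (simp add: R_def CBlinfun_apply)
  qed
  have Rbil: "cbilinear R"
    unfolding cbilinear_def clinear_iff
    by (auto intro!: cblinfun_eqI simp: R cblinfun_apply_add cblinfun_apply_scaleC cblinfun.add_right
        cblinfun_scaleC_arg tensor_bilinear)
  have B0_elem: "B0 a (elem_op y g) = g (op_of_approx a y)" for a y g
  proof -
    obtain F where F: "\<And>b a. cblinfun_apply (cblinfun_apply F b) a = B0 a b"
      using curry_bounded_cbilinear[OF bounded_cbilinear_flip[OF bounded_cbilinear_apply[of B0]]] by metis
    have bl: "bounded_clinear (\<lambda>a. g (op_of_approx a y))"
    proof (rule bounded_clinear_intro[where K = "norm g * norm y"])
      fix a b :: "'x approx_op" and c
      show "g (op_of_approx (a + b) y) = g (op_of_approx a y) + g (op_of_approx b y)"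
        by (simp add: plus_approx_op.rep_eq cblinfun_apply_add cblinfun.add_right)
      show "g (op_of_approx (c *\<^sub>C a) y) = c *\<^sub>C g (op_of_approx a y)"
        by (simp add: scaleC_approx_op.rep_eq cblinfun_apply_scaleC cblinfun_scaleC_arg)
      have "norm g * norm (op_of_approx a y) \<le> norm g * (norm a * norm y)"
        unfolding norm_approx_op.rep_eq by (intro mult_left_mono norm_cblinfun) auto
      then show "norm (g (op_of_approx a y)) \<le> norm a * (norm g * norm y)"
        using norm_cblinfun[of g "op_of_approx a y"] by (simp add: mult_ac)
    qed
    have "F (elem_op y g) = CBlinfun (\<lambda>a. g (op_of_approx a y))"
      by (rule approx_cblinfun_eqI)
        (simp add: F B0 CBlinfun_apply[OF bl] rank_one_apply cblinfun_scaleC_arg scaleC_complex_def)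
    then show ?thesis using F[of "elem_op y g" a] by (simp add: CBlinfun_apply[OF bl])
  qed
  have R_norm: "norm (form_sum R qs) \<le> norm B0 * norm (form_sum elem_op qs)" for qs
  proof (rule norm_cblinfun_bound)
    fix a
    define rs where "rs = map (\<lambda>(y, g). (op_of_approx a y, g)) qs"
    have "form_sum R qs a = form_sum (\<otimes>) rs"
      unfolding rs_def by (induction qs) (auto simp: cblinfun_apply_add R)
    moreover have "norm (form_sum (\<otimes>) rs) \<le> norm B0 * norm (form_sum elem_op qs) * norm a"
    proof (rule projective_norm_le_twists)
      fix T :: "'x cdual \<Rightarrow>\<^sub>C\<^sub>L 'x cdual" assume T: "norm T \<le> 1"
      have "scalar_trace (form_sum (\<otimes>) (map (\<lambda>(y, g). (y, T g)) rs)) = B0 a (form_sum elem_op (map (\<lambda>(y, g). (y, T g)) qs))"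
        unfolding rs_def
        by (induction qs) (auto simp: cblinfun.zero_right cblinfun.add_right scalar_trace_tensor B0_elem)
      also have "cmod \<dots> \<le> norm (B0 a) * norm (form_sum elem_op (map (\<lambda>(y, g). (y, T g)) qs))"
        by (rule norm_cblinfun)
      also have "\<dots> \<le> (norm B0 * norm a) * (1 * norm (form_sum elem_op qs))"
      proof (intro mult_mono norm_cblinfun)
        show "norm (form_sum elem_op (map (\<lambda>(y, g). (y, T g)) qs)) \<le> 1 * norm (form_sum elem_op qs)"
          by (rule order_trans[OF norm_form_sum_twist mult_right_mono[OF T norm_ge_zero]])
      qed auto
      finally show "cmod (scalar_trace (form_sum (\<otimes>) (map (\<lambda>(y, g). (y, T g)) rs)))
          \<le> norm B0 * norm (form_sum elem_op qs) * norm a" by (simp add: mult_ac)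
    qed
    ultimately show "norm (form_sum R qs a) \<le> norm B0 * norm (form_sum elem_op qs) * norm a" by simp
  qed simp
  define G where "G = range (\<lambda>qs. (form_sum elem_op qs, form_sum R qs))"
  have elem_bil: "cbilinear (elem_op :: 'x \<Rightarrow> _)" using bounded_cbilinear_elem_op unfolding bounded_cbilinear_def by blast
  have G: "linear_graph G"
    unfolding linear_graph_def
  proof (intro conjI allI impI)
    show "(0, 0) \<in> G" unfolding G_def by (rule range_eqI[of _ _ "[]"]) simp
    fix a v b w c assume "(a, v) \<in> G"
    then obtain qs where qs: "a = form_sum elem_op qs" "v = form_sum R qs" unfolding G_def by blast
    show "(c *\<^sub>C a, c *\<^sub>C v) \<in> G"
      unfolding G_def by (rule range_eqI[of _ _ "list_scaleC c qs"])
        (simp add: qs form_sum_list_scaleC[OF elem_bil] form_sum_list_scaleC[OF Rbil])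
    assume "(b, w) \<in> G"
    then obtain rs where rs: "b = form_sum elem_op rs" "w = form_sum R rs" unfolding G_def by blast
    show "(a + b, v + w) \<in> G"
      unfolding G_def by (rule range_eqI[of _ _ "qs @ rs"]) (simp add: qs rs)
  qed
  have bound: "norm v \<le> norm B0 * norm a" if "(a, v) \<in> G" for a v
    using that R_norm unfolding G_def by blast
  have dense: "\<exists>b v. (b, v) \<in> G \<and> norm (b - a) < e" if e: "e > 0" for a e
  proof -
    obtain qs where "norm (form_sum elem_op qs - a) < e" using elem_op_dense[OF e] .
    then show ?thesis
      unfolding G_def by (intro exI[of _ "form_sum elem_op qs"] exI[of _ "form_sum R qs"]) blast
  qed
  obtain M where M: "\<And>a v. (a, v) \<in> G \<Longrightarrow> cblinfun_apply M a = v"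
    using linear_graph_extension[OF G bound dense] by metis
  have "M (elem_op y g) = R y g" for y g
  proof (rule M)
    show "(elem_op y g, R y g) \<in> G" unfolding G_def by (rule range_eqI[of _ _ "[(y, g)]"]) simp
  qed
  then show ?thesis by (intro that[of M]) (simp add: R)
qed

text \<open>Subtracting \<open>scalar_trace u *\<^sub>C k\<close> does not change
  \<open>approx_trace u\<close> and makes the scalar trace vanish. The bound then determines the
  kernel and supplies the norm-controlled lifts for surjectivity.\<close>

lemma one_dim_trace_kernelI:
  fixes k :: "'x::complex_banach trace_tensor"
  assumes bound: "\<And>u :: 'x trace_tensor. norm u \<le> C * (norm (approx_trace u) + cmod (scalar_trace u))"
    and k: "approx_trace k = 0" "scalar_trace k = 1"
  shows "one_dim_trace_kernel k"
proof
  show "k \<noteq> 0" using k(2) by (auto simp: cblinfun.zero_right)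
  show "kernel approx_trace = complex_vector.span {k}"
  proof (intro equalityI subsetI)
    fix u :: "'x trace_tensor" assume "u \<in> kernel approx_trace"
    then have "norm (u - scalar_trace u *\<^sub>C k) \<le> C * 0"
      using bound[of "u - scalar_trace u *\<^sub>C k"] k
      by (simp add: kernel_def cblinfun.diff_right cblinfun_scaleC_arg scaleC_complex_def)
    then have "u = scalar_trace u *\<^sub>C k" by simp
    then show "u \<in> complex_vector.span {k}" unfolding complex_vector.span_singleton by (rule range_eqI)
  next
    fix u assume "u \<in> complex_vector.span {k}"
    then obtain c where "u = c *\<^sub>C k" unfolding complex_vector.span_singleton by blast
    then show "u \<in> kernel approx_trace" using k(1) by (simp add: kernel_def cblinfun_scaleC_arg)
  qed
  have lift: "\<exists>w. approx_trace w = approx_trace u \<and> norm w \<le> C * norm (approx_trace u)"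
    for u :: "'x trace_tensor"
    using bound[of "u - scalar_trace u *\<^sub>C k"] k
    by (intro exI[of _ "u - scalar_trace u *\<^sub>C k"])
      (simp add: cblinfun.diff_right cblinfun_scaleC_arg scaleC_complex_def)
  have dense: "\<exists>u. norm (approx_trace u - a) < e" if e: "e > 0" for a :: "'x approx_op" and e
  proof -
    obtain ps where "norm (form_sum elem_op ps - a) < e" using elem_op_dense[OF e] .
    then show ?thesis by (intro exI[of _ "form_sum (\<otimes>) ps"]) (simp add: approx_trace_form_sum)
  qed
  show "range (cblinfun_apply approx_trace) = (UNIV :: 'x approx_op set)"
    using surjective_if_dense_range[OF lift dense] by (metis surjI surj_def)
qed

text \<open>Every rank-one operator is a product:
  \<open>elem_op x f = elem_op x f0 * elem_op z f\<close>.\<close>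

lemma multiplication_map_dense:
  fixes a :: "'x::complex_banach approx_op" and f0 :: "'x cdual"
  assumes z: "f0 z = 1" and e: "e > 0"
  shows "\<exists>u. norm (multiplication_map u - a) < e"
proof -
  have "\<exists>u. multiplication_map u = form_sum elem_op ps" for ps :: "('x \<times> 'x cdual) list"
  proof (induction ps)
    case Nil
    show ?case by (rule exI[of _ 0]) (simp add: cblinfun.zero_right)
  next
    case (Cons p ps)
    obtain x f where p: "p = (x, f)" by (cases p)
    obtain u where u: "multiplication_map u = form_sum elem_op ps" using Cons by blast
    have "multiplication_map (elem_op x f0 \<otimes> elem_op z f + u) = form_sum elem_op (p # ps)"
      by (simp add: p cblinfun.add_right multiplication_map_tensor u elem_op_mult(1) z)
    then show ?case by blast
  qed
  moreover obtain ps where "norm (form_sum elem_op ps - a) < e" using elem_op_dense[OF e] .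
  ultimately show ?thesis by metis
qed

lemma weakly_amenable_imp_one_dim_trace_kernel:
  assumes nsi: "\<not> self_induced TYPE('x::complex_banach approx_op)" and wa: "weakly_amenable TYPE('x approx_op)"
  shows "\<exists>k :: 'x trace_tensor. one_dim_trace_kernel k"
proof -
  \<comment> \<open>On the zero space the algebra is zero, hence self-induced.\<close>
  have "\<exists>z :: 'x. z \<noteq> 0"
  proof (rule ccontr)
    assume "\<not> ?thesis"
    then have "a = 0" for a :: "'x approx_op"
      by (intro approx_op_eqI) (metis cblinfun.zero_right)
    then have "self_induced TYPE('x approx_op)"
      by (intro self_induced_if_balanced_factor exI[of _ 0]) (metis cblinfun.zero_right norm_zero diff_self)+
    with nsi show False by simp
  qed
  then obtain z :: 'x where "z \<noteq> 0" by blast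
  then obtain f0 :: "'x cdual" where z: "f0 z = 1" by (rule separating_functional_one)
  have "\<exists>D :: 'x approx_op \<Rightarrow>\<^sub>C\<^sub>L 'x approx_op cdual. balanced D \<and> \<not> (\<exists>\<psi>. \<forall>a b. D a b = cblinfun_apply \<psi> (a * b))"
  proof (rule ccontr)
    assume "\<not> ?thesis"
    then have "self_induced TYPE('x approx_op)"
      by (intro self_induced_if_balanced_factor multiplication_map_dense[OF z]) auto
    with nsi show False by simp
  qed
  then obtain D :: "'x approx_op \<Rightarrow>\<^sub>C\<^sub>L 'x approx_op cdual" where D: "balanced D"
    and not_factor: "\<And>\<psi>. \<not> (\<forall>a b. D a b = cblinfun_apply \<psi> (a * b))" by blast
  obtain \<psi>0 \<mu>0 where dec: "\<And>x f y g. D (elem_op x f) (elem_op y g)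
      = cblinfun_apply \<psi>0 (elem_op x f * elem_op y g) + \<mu>0 * (f y * g x)"
    using balanced_functional_decomposition[OF wa D z] by metis
  have mult_bil: "bounded_cbilinear (\<lambda>a b. cblinfun_apply \<psi> (a * b))" for \<psi> :: "'x approx_op cdual"
    by (rule bounded_cbilinear_post[OF bounded_cbilinear_times])
  have \<mu>0: "\<mu>0 \<noteq> 0"
  proof
    assume "\<mu>0 = 0"
    then have "D a b = \<psi>0 (a * b)" for a b
      using bounded_cbilinear_approx_eqI[OF bounded_cbilinear_apply[of D] mult_bil[of \<psi>0]] by (simp add: dec)
    then show False using not_factor by blast
  qed
  have B0_bil: "bounded_cbilinear (\<lambda>a b. inverse \<mu>0 *\<^sub>C (D a b + (- 1) *\<^sub>C \<psi>0 (a * b)))"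
    by (rule bounded_cbilinear_scale[OF bounded_cbilinear_add[OF bounded_cbilinear_apply bounded_cbilinear_scale[OF mult_bil]]])
  obtain B0 :: "'x approx_op \<Rightarrow>\<^sub>C\<^sub>L 'x approx_op cdual"
    where B0_eq: "\<And>a b. B0 a b = inverse \<mu>0 *\<^sub>C (D a b + (- 1) *\<^sub>C \<psi>0 (a * b))"
    using curry_bounded_cbilinear[OF B0_bil] by metis
  have B0: "B0 (elem_op x f) (elem_op y g) = f y * g x" for x f y g
    using \<mu>0 by (simp add: B0_eq dec scaleC_complex_def)
  obtain M :: "'x approx_op \<Rightarrow>\<^sub>C\<^sub>L 'x approx_op \<Rightarrow>\<^sub>C\<^sub>L 'x trace_tensor"
    where M: "\<And>a y g. M (elem_op y g) a = op_of_approx a y \<otimes> g"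
    using trace_product_extension[OF B0] by metis
  \<comment> \<open>The pullback \<open>D2\<close> of \<open>\<phi>\<close> along \<open>M\<close>
    is balanced, and at \<open>elem_op x f0\<close> and \<open>elem_op z g\<close> it has the value
    \<open>\<phi> (x \<otimes> g)\<close>, so its decomposition is one of
    \<open>\<phi>\<close>.\<close>
  have decomp: "\<exists>\<psi> \<mu>. \<phi> = \<psi> o\<^sub>C\<^sub>L approx_trace + \<mu> *\<^sub>C scalar_trace" for \<phi> :: "'x trace_tensor cdual"
  proof -
    obtain D1 where D1: "\<And>a b. cblinfun_apply (cblinfun_apply D1 a) b = M b a"
      using curry_bounded_cbilinear[OF bounded_cbilinear_flip[OF bounded_cbilinear_apply[of M]]] by metis
    obtain LM :: "'x approx_op \<Rightarrow>\<^sub>C\<^sub>L 'x approx_op \<Rightarrow>\<^sub>C\<^sub>L 'x approx_op" where LM: "\<And>a b. LM a b = a * b"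
      using curry_bounded_cbilinear[OF bounded_cbilinear_times] by metis
    have "D1 (a * c) = D1 a o\<^sub>C\<^sub>L LM c" for a c
      by (rule approx_cblinfun_eqI) (simp add: D1 LM M elem_op_mult(2) times_approx_op.rep_eq)
    then have M_bal: "M b (a * c) = M (c * b) a" for a b c by (metis D1 LM cblinfun_compose_apply)
    obtain D2 :: "'x approx_op \<Rightarrow>\<^sub>C\<^sub>L 'x approx_op cdual" where D2: "\<And>a b. D2 a b = \<phi> (M b a)"
      using curry_bounded_cbilinear[OF bounded_cbilinear_post[OF bounded_cbilinear_flip[OF bounded_cbilinear_apply[of M]]], of \<phi>]
      by metis
    have "balanced D2" by (simp add: balanced_def D2 M_bal)
    from balanced_functional_decomposition[OF wa this z] obtain \<psi> \<mu> where
      \<psi>: "\<And>x f y g. D2 (elem_op x f) (elem_op y g) = cblinfun_apply \<psi> (elem_op x f * elem_op y g) + \<mu> * (f y * g x)"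
      by metis
    have "\<phi> = \<psi> o\<^sub>C\<^sub>L approx_trace + \<mu> *\<^sub>C scalar_trace"
    proof (rule proj_tensor_cblinfun_eqI)
      fix x g
      show "\<phi> (x \<otimes> g) = (\<psi> o\<^sub>C\<^sub>L approx_trace + \<mu> *\<^sub>C scalar_trace) (x \<otimes> g)"
        using \<psi>[of x f0 z g] by (simp add: D2 M rank_one_apply z elem_op_mult(1) cblinfun_apply_add
            cblinfun_apply_scaleC approx_trace_tensor scalar_trace_tensor scaleC_complex_def)
    qed
    then show ?thesis by blast
  qed
  \<comment> \<open>By \<open>decomp\<close> this map is onto the dual of P, so the coefficients can
    be chosen with bounded norm; for a norming functional of \<open>u\<close> this dominates
    \<open>norm u\<close> by the two traces.\<close>
  define J where "J p = fst p o\<^sub>C\<^sub>L approx_trace + snd p *\<^sub>C scalar_trace" for p :: "'x approx_op cdual \<times> complex"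
  have J_bl: "bounded_linear J"
    unfolding J_def
  proof (rule bounded_linear_add)
    show "bounded_linear (\<lambda>p :: 'x approx_op cdual \<times> complex. fst p o\<^sub>C\<^sub>L (approx_trace :: 'x trace_tensor \<Rightarrow>\<^sub>C\<^sub>L _))"
      by (rule bounded_linear_compose[OF bounded_bilinear.bounded_linear_left[OF bounded_bilinear_cblinfun_compose] bounded_linear_fst])
    have "bounded_linear (\<lambda>c. c *\<^sub>C (scalar_trace :: 'x trace_tensor cdual))"
      by (rule bounded_linear_intro[where K = "norm (scalar_trace :: 'x trace_tensor cdual)"])
        (simp_all add: scaleC_add_left norm_scaleC scaleR_eq_scaleC scaleC_scaleC scaleC_complex_def)
    then show "bounded_linear (\<lambda>p :: 'x approx_op cdual \<times> complex. snd p *\<^sub>C (scalar_trace :: 'x trace_tensor cdual))"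
      by (rule bounded_linear_compose[OF _ bounded_linear_snd])
  qed
  have J_im: "J ` UNIV = UNIV"
  proof (intro equalityI subsetI UNIV_I)
    fix \<phi> :: "'x trace_tensor cdual"
    obtain \<psi> \<mu> where "\<phi> = \<psi> o\<^sub>C\<^sub>L approx_trace + \<mu> *\<^sub>C scalar_trace" using decomp by blast
    then show "\<phi> \<in> J ` UNIV" by (intro image_eqI[of _ _ "(\<psi>, \<mu>)"]) (simp_all add: J_def)
  qed
  then have "closed (J ` UNIV)" by simp
  from open_mapping_subspace[OF J_bl subspace_UNIV closed_UNIV this]
  obtain C where C: "\<And>\<phi>. \<exists>p. J p = \<phi> \<and> norm p \<le> C * norm \<phi>" unfolding J_im by auto
  have bound: "norm u \<le> \<bar>C\<bar> * (norm (approx_trace u) + cmod (scalar_trace u))" for u :: "'x trace_tensor"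
  proof -
    obtain \<phi> :: "'x trace_tensor cdual" where n1: "norm \<phi> \<le> 1" and \<phi>: "\<phi> u = norm u"
      using norming_functional[of u] by metis
    obtain \<psi> \<mu> where p: "J (\<psi>, \<mu>) = \<phi>" "norm (\<psi>, \<mu>) \<le> C * norm \<phi>" using C[of \<phi>] by auto
    have "C * norm \<phi> \<le> \<bar>C\<bar> * norm \<phi>" by (intro mult_right_mono) auto
    also have "\<dots> \<le> \<bar>C\<bar> * 1" by (intro mult_left_mono n1) auto
    finally have "norm \<psi> \<le> \<bar>C\<bar>" "cmod \<mu> \<le> \<bar>C\<bar>"
      using p(2) norm_fst_le[of \<psi> \<mu>] norm_snd_le[of \<mu> \<psi>] by linarith+
    then have "norm \<psi> * norm (approx_trace u) + cmod \<mu> * cmod (scalar_trace u)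
        \<le> \<bar>C\<bar> * norm (approx_trace u) + \<bar>C\<bar> * cmod (scalar_trace u)"
      by (intro add_mono mult_right_mono) auto
    moreover have dec_u: "\<phi> u = \<psi> (approx_trace u) + \<mu> * scalar_trace u"
      using p(1) by (auto simp: J_def cblinfun_apply_add cblinfun_apply_scaleC scaleC_complex_def)
    have "norm u = cmod (\<phi> u)" by (simp add: \<phi>)
    then have "norm u = cmod (\<psi> (approx_trace u) + \<mu> * scalar_trace u)" by (simp only: dec_u)
    moreover have "cmod (\<psi> (approx_trace u) + \<mu> * scalar_trace u) \<le> norm \<psi> * norm (approx_trace u) + cmod \<mu> * cmod (scalar_trace u)"
      by (rule norm_triangle_mono[OF norm_cblinfun]) (simp add: norm_mult)
    ultimately show ?thesis by (simp add: algebra_simps)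
  qed
  \<comment> \<open>A trace bounded in the operator norm would factor through \<open>Tr\<close>, and
    then \<open>D\<close> would be a functional of the product, contrary to its choice.\<close>
  have unbounded: "\<exists>u :: 'x trace_tensor. cmod (scalar_trace u) > c * norm (approx_trace u)" for c
  proof (rule ccontr)
    assume "\<not> ?thesis"
    then have "cmod (scalar_trace u) \<le> c * norm (approx_trace u)" for u :: "'x trace_tensor"
      by (meson not_less)
    then obtain \<psi> :: "'x approx_op cdual" where factor: "scalar_trace = \<psi> o\<^sub>C\<^sub>L approx_trace"
      using functional_factors_through by metis
    have \<psi>: "\<psi> (elem_op x f) = f x" for x f
      using scalar_trace_tensor[of x f] by (simp add: factor approx_trace_tensor)
    have "D a b = (\<psi>0 + \<mu>0 *\<^sub>C \<psi>) (a * b)" for a b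
      by (rule bounded_cbilinear_approx_eqI[OF bounded_cbilinear_apply[of D] mult_bil])
        (simp add: dec elem_op_mult(1) \<psi> cblinfun_apply_add cblinfun_apply_scaleC cblinfun_scaleC_arg scaleC_complex_def algebra_simps)
    then show False using not_factor by blast
  qed
  \<comment> \<open>Differences of such tensors have trace 0, so \<open>bound\<close> makes the
    sequence Cauchy in P; its limit still has trace 1 but is annihilated by
    \<open>Tr\<close>.\<close>
  have "\<exists>u :: 'x trace_tensor. scalar_trace u = 1 \<and> norm (approx_trace u) \<le> inverse (real (Suc n))" for n
  proof -
    obtain u :: "'x trace_tensor" where u: "cmod (scalar_trace u) > real (Suc n) * norm (approx_trace u)"
      using unbounded by blast
    have "0 \<le> real (Suc n) * norm (approx_trace u)" by (rule mult_nonneg_nonneg) simp_all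
    then have "0 < cmod (scalar_trace u)" using u by linarith
    then have nz: "scalar_trace u \<noteq> 0" by simp
    define c where "c = inverse (scalar_trace u)"
    have "norm (approx_trace (c *\<^sub>C u)) = norm (approx_trace u) / cmod (scalar_trace u)"
      by (simp add: c_def cblinfun_scaleC_arg norm_scaleC norm_inverse divide_inverse mult.commute)
    also have "\<dots> \<le> inverse (real (Suc n))"
      using u nz by (simp add: field_simps)
    finally have "norm (approx_trace (c *\<^sub>C u)) \<le> inverse (real (Suc n))" .
    moreover have "scalar_trace (c *\<^sub>C u) = 1" using nz by (simp add: c_def cblinfun_scaleC_arg scaleC_complex_def)
    ultimately show ?thesis by blast
  qed
  then obtain u :: "nat \<Rightarrow> 'x trace_tensor"
    where u: "\<And>n. scalar_trace (u n) = 1" "\<And>n. norm (approx_trace (u n)) \<le> inverse (real (Suc n))" by metis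
  have lim0: "(\<lambda>n. approx_trace (u n)) \<longlonglongrightarrow> 0"
    by (rule Lim_null_comparison[OF always_eventually LIMSEQ_inverse_real_of_nat]) (use u(2) in blast)
  have "Cauchy u"
  proof (rule CauchyI)
    fix e :: real assume e: "e > 0"
    define e' where "e' = e / (\<bar>C\<bar> + 1)"
    have e': "e' > 0" using e by (simp add: e'_def add_nonneg_pos)
    obtain N where N: "\<And>m n. m \<ge> N \<Longrightarrow> n \<ge> N \<Longrightarrow> norm (approx_trace (u m) - approx_trace (u n)) < e'"
      using CauchyD[OF LIMSEQ_imp_Cauchy[OF lim0] e'] by blast
    show "\<exists>N. \<forall>m\<ge>N. \<forall>n\<ge>N. norm (u m - u n) < e"
    proof (intro exI[of _ N] allI impI)
      fix m n assume "m \<ge> N" "n \<ge> N"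
      then have lt: "norm (approx_trace (u m) - approx_trace (u n)) < e'" by (rule N)
      have "norm (u m - u n) \<le> \<bar>C\<bar> * norm (approx_trace (u m) - approx_trace (u n))"
        using bound[of "u m - u n"] by (simp add: cblinfun.diff_right u(1))
      also have "\<dots> \<le> \<bar>C\<bar> * e'" using lt by (simp add: mult_left_mono)
      also have "\<dots> < e" using e by (simp add: e'_def field_simps add_nonneg_pos)
      finally show "norm (u m - u n) < e" .
    qed
  qed
  then obtain k where k: "u \<longlonglongrightarrow> k" by (auto simp: Cauchy_convergent_iff convergent_def)
  have "(\<lambda>n. approx_trace (u n)) \<longlonglongrightarrow> approx_trace k"
    by (rule bounded_linear.tendsto[OF bounded_linear_cblinfun_apply k])
  then have k0: "approx_trace k = 0" using lim0 by (rule LIMSEQ_unique)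
  have "(\<lambda>n. scalar_trace (u n)) \<longlonglongrightarrow> scalar_trace k"
    by (rule bounded_linear.tendsto[OF bounded_linear_cblinfun_apply k])
  then have "(\<lambda>n. 1) \<longlonglongrightarrow> scalar_trace k" by (simp add: u(1))
  then have k1: "scalar_trace k = 1" using tendsto_const LIMSEQ_unique by blast
  show ?thesis using one_dim_trace_kernelI[OF bound k0 k1] by blast
qed

lemma one_dim_trace_kernel_iff:
  "(approximable_operators :: ('x::complex_banach \<Rightarrow>\<^sub>C\<^sub>L 'x) set) = nuclear_operators \<and>
    complex_vector.dim (kernel (operator_trace :: 'x trace_tensor \<Rightarrow>\<^sub>C\<^sub>L ('x \<Rightarrow>\<^sub>C\<^sub>L 'x))) = 1
  \<longleftrightarrow> (\<exists>k :: 'x trace_tensor. one_dim_trace_kernel k)"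
proof -
  define K where "K = kernel (approx_trace :: 'x trace_tensor \<Rightarrow>\<^sub>C\<^sub>L _)"
  have sub: "complex_vector.subspace K"
    by (auto simp: K_def complex_vector.subspace_def kernel_def cblinfun.zero_right cblinfun.add_right cblinfun_scaleC_arg)
  have "(nuclear_operators :: ('x \<Rightarrow>\<^sub>C\<^sub>L 'x) set) = op_of_approx ` range (cblinfun_apply approx_trace)"
    unfolding nuclear_operators_eq_range by (auto simp: op_of_approx_trace image_iff)
  moreover have A: "(approximable_operators :: ('x \<Rightarrow>\<^sub>C\<^sub>L 'x) set) = op_of_approx ` UNIV"
    by (rule type_definition.Rep_range[OF type_definition_approx_op, symmetric])
  moreover have "inj (op_of_approx :: 'x approx_op \<Rightarrow> _)" by (rule injI) (simp add: op_of_approx_inject)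
  ultimately have a: "(approximable_operators :: ('x \<Rightarrow>\<^sub>C\<^sub>L 'x) set) = nuclear_operators
      \<longleftrightarrow> range (cblinfun_apply approx_trace) = (UNIV :: 'x approx_op set)"
    by (metis inj_image_eq_iff)
  \<comment> \<open>\<open>dim\<close> counts a basis and is 0 for infinite-dimensional spaces, so
    the value 1 does mean a basis with one element.\<close>
  have b: "complex_vector.dim K = 1 \<longleftrightarrow> (\<exists>k. k \<noteq> 0 \<and> K = complex_vector.span {k})"
  proof
    assume "complex_vector.dim K = 1"
    moreover obtain B where B: "B \<subseteq> K" "complex_vector.independent B" "K \<subseteq> complex_vector.span B"
      "card B = complex_vector.dim K" using complex_vector.basis_exists by blast
    ultimately obtain k where k: "B = {k}" by (metis card_1_singletonE)
    have "k \<noteq> 0" using B(2) k complex_vector.dependent_zero by blast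
    moreover have "complex_vector.span B \<subseteq> K" using B(1) sub by (rule complex_vector.span_minimal)
    ultimately show "\<exists>k. k \<noteq> 0 \<and> K = complex_vector.span {k}" using B(3) k by blast
  next
    assume "\<exists>k. k \<noteq> 0 \<and> K = complex_vector.span {k}"
    then obtain k where k: "k \<noteq> 0" "K = complex_vector.span {k}" by blast
    then have "complex_vector.independent {k}" by simp
    then show "complex_vector.dim K = 1"
      unfolding k(2) complex_vector.dim_span using complex_vector.dim_eq_card_independent by fastforce
  qed
  show ?thesis
    unfolding a kernel_operator_trace K_def[symmetric] b one_dim_trace_kernel_def by blast
qed

theorem theorem2p9:
  assumes "\<not> self_induced TYPE('x::complex_banach approx_op)"
  shows
    "(weakly_amenable TYPE('x approx_op) \<longleftrightarrow>
        (approximable_operators :: ('x \<Rightarrow>\<^sub>C\<^sub>L 'x) set) = nuclear_operators \<and>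
        complex_vector.dim
          (kernel (operator_trace :: ('x, 'x cdual) proj_tensor \<Rightarrow>\<^sub>C\<^sub>L ('x \<Rightarrow>\<^sub>C\<^sub>L 'x))) = 1) \<and>
     ((approximable_operators :: ('x \<Rightarrow>\<^sub>C\<^sub>L 'x) set) = nuclear_operators \<and>
        complex_vector.dim
          (kernel (operator_trace :: ('x, 'x cdual) proj_tensor \<Rightarrow>\<^sub>C\<^sub>L ('x \<Rightarrow>\<^sub>C\<^sub>L 'x))) = 1
      \<longrightarrow>
        direct_sum (integral_operators :: ('x \<Rightarrow>\<^sub>C\<^sub>L 'x) set) (range (\<lambda>c. c *\<^sub>C cblinfun_id)) \<and>
        direct_sum (integral_operators :: ('x cdual \<Rightarrow>\<^sub>C\<^sub>L 'x cdual) set)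
          (range (\<lambda>c. c *\<^sub>C cblinfun_id)) \<and>
        indecomposable TYPE('x) \<and> indecomposable TYPE('x cdual))"
  unfolding one_dim_trace_kernel_iff
  using weakly_amenable_imp_one_dim_trace_kernel[OF assms] one_dim_trace_kernel.weakly_amenable_approx_op
    one_dim_trace_kernel.integral_direct_sum one_dim_trace_kernel.integral_direct_sum_dual
    one_dim_trace_kernel.indecomposable_space one_dim_trace_kernel.indecomposable_dual
  by blast

end
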